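(* Let $d\ge2$, $\alpha\in(1,2)$, and let $\mu$ be a nondegenerate $\alpha$-stable distribution on $\mathbb{R}^d$ with no shift and characteristic exponent $|z|^\alpha V(u_z)$. Let $\varrho_0=\sup_{u\in\mathbb{S}^{d-1}}|V(u)|^2/(2\Re V(u))$, fix $R>\varrho_0$, let $V_*=R-V$ and $S^*_{j,k}=(-i)^j\pi_j(V_*^k)$ for $j,k\in\mathbb{Z}_+$. Then the density of $\mu$ is $$g(x)=\frac{2^{1-d}}{\pi^{d/2}\alpha}\sum_{n=0}^\infty\Big(\frac{|x|}{2}\Big)^n\sum_{m=0}^{\lfloor n/2\rfloor}\frac{(-1)^m}{m!\,\Gamma(n-m+d/2)}\sum_{k=0}^\infty\frac{\Gamma(k+(n+d)/\alpha)}{k!\,R^{k+(n+d)/\alpha}}S^*_{n-2m,k}(u_x),\qquad x\in\mathbb{R}^d,$$ the series converging absolutely and uniformly on $\{x:|x|\le M\}$ for every $M>0$. If $X\sim\mu$, then $|X|$ has density $$g_{|X|}(r)=\frac{(r/2)^{d-1}}{\pi^{d/2}\alpha}\sum_{n=0}^\infty\frac{(-r^2/4)^n}{n!\,\Gamma(n+d/2)}\sum_{k=0}^\infty\frac{\Gamma(k+(2n+d)/\alpha)}{k!\,R^{k+(2n+d)/\alpha}}\int_{\mathbb{S}^{d-1}}V_*^k\,d\omega.$$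
   Context: Let $d\ge 2$, $\mathbb{S}^{d-1}$ the unit sphere, $\omega$ its surface measure, $u_x=x/|x|$ for $x\ne0$. $\pi_j$ is the orthogonal projection of $L^2(\mathbb{S}^{d-1},\omega)$ onto spherical harmonics of degree $j$ (restrictions of homogeneous harmonic polynomials of degree $j$). An $\alpha$-stable distribution ($\alpha\ne1$) with no shift has $\hat\mu(z)=\exp\{-|z|^\alpha V(u_z)\}$, $V(u)=\int_{\mathbb{S}^{d-1}}|\langle u,v\rangle|^\alpha[1-i\tan(\pi\alpha/2)\mathrm{sgn}\langle u,v\rangle]\lambda(dv)$, $\lambda$ a finite nonzero Borel measure on the sphere. Nondegenerate: support not contained in a proper affine subspace; then $\inf\Re V>0$ and $\varrho_0<\infty$. *)

theory Defs
  imports "HOL-Probability.Probability"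
begin

definition sphere_measure :: "(real^'n::finite) measure" where
  "sphere_measure = measure_of (sphere 0 1) (sets (restrict_space borel (sphere 0 1)))
     (\<lambda>A. of_nat CARD('n) * emeasure lborel {t *\<^sub>R v | t v. 0 < t \<and> t \<le> 1 \<and> v \<in> A})"

definition monom :: "('n::finite \<Rightarrow> nat) \<Rightarrow> real^'n \<Rightarrow> complex" where
  "monom \<beta> x = (\<Prod>i\<in>UNIV. complex_of_real ((x $ i) ^ (\<beta> i)))"

definition hom_poly :: "nat \<Rightarrow> (('n::finite \<Rightarrow> nat) \<Rightarrow> complex) \<Rightarrow> real^'n \<Rightarrow> complex" where
  "hom_poly j c x = (\<Sum>\<beta>\<in>{\<beta>. sum \<beta> UNIV = j}. c \<beta> * monom \<beta> x)"

definition partial2 :: "(real^'n::finite \<Rightarrow> complex) \<Rightarrow> 'n \<Rightarrow> real^'n \<Rightarrow> complex" where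
  "partial2 f i x = vector_derivative
      (\<lambda>t. vector_derivative (\<lambda>s. f (x + s *\<^sub>R axis i 1)) (at t)) (at 0)"

definition laplacian :: "(real^'n::finite \<Rightarrow> complex) \<Rightarrow> real^'n \<Rightarrow> complex" where
  "laplacian f x = (\<Sum>i\<in>UNIV. partial2 f i x)"

text \<open>Homogeneous harmonic polynomials of degree j (as functions on R^d);
  their restrictions to the sphere are the spherical harmonics of degree j.\<close>
definition harm :: "nat \<Rightarrow> (real^'n::finite \<Rightarrow> complex) set" where
  "harm j = {h. (\<exists>c. h = hom_poly j c) \<and> (\<forall>x. laplacian h x = 0)}"

text \<open>Orthogonal projection in L^2(sphere, omega) onto the spherical harmonics of degree j;
  the result is represented by the (unique) homogeneous harmonic polynomial whose
  restriction to the sphere is the projection.\<close>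
definition sh_proj :: "nat \<Rightarrow> (real^'n::finite \<Rightarrow> complex) \<Rightarrow> real^'n \<Rightarrow> complex" where
  "sh_proj j f = (THE h. h \<in> harm j \<and>
      (\<forall>q\<in>harm j. integral\<^sup>L sphere_measure (\<lambda>u. (f u - h u) * cnj (q u)) = 0))"

definition stable_V :: "real \<Rightarrow> (real^'n::finite) measure \<Rightarrow> real^'n \<Rightarrow> complex" where
  "stable_V \<alpha> lam u = integral\<^sup>L lam (\<lambda>v. complex_of_real (\<bar>u \<bullet> v\<bar> powr \<alpha>) *
      (1 - \<i> * complex_of_real (tan (pi * \<alpha> / 2)) * complex_of_real (sgn (u \<bullet> v))))"

definition rho0 :: "real \<Rightarrow> (real^'n::finite) measure \<Rightarrow> real" where
  "rho0 \<alpha> lam = (SUP u\<in>sphere 0 1. (cmod (stable_V \<alpha> lam u))\<^sup>2 / (2 * Re (stable_V \<alpha> lam u)))"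

definition measure_support :: "'a::metric_space measure \<Rightarrow> 'a set" where
  "measure_support M = {x. \<forall>e>0. emeasure M (ball x e) > 0}"

definition nondegenerate :: "(real^'n::finite) measure \<Rightarrow> bool" where
  "nondegenerate M \<longleftrightarrow> (\<forall>S. affine S \<and> S \<noteq> UNIV \<longrightarrow> \<not> measure_support M \<subseteq> S)"

definition Vstar :: "real \<Rightarrow> (real^'n::finite) measure \<Rightarrow> real \<Rightarrow> real^'n \<Rightarrow> complex" where
  "Vstar \<alpha> lam R u = complex_of_real R - stable_V \<alpha> lam u"

definition Sstar :: "real \<Rightarrow> (real^'n::finite) measure \<Rightarrow> real \<Rightarrow> nat \<Rightarrow> nat \<Rightarrow> real^'n \<Rightarrow> complex" where
  "Sstar \<alpha> lam R j k = (\<lambda>u. (- \<i>) ^ j * sh_proj j (\<lambda>v. (Vstar \<alpha> lam R v) ^ k) u)"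

definition dens_term :: "real \<Rightarrow> (real^'n::finite) measure \<Rightarrow> real \<Rightarrow> real^'n \<Rightarrow> nat \<Rightarrow> nat \<Rightarrow> nat \<Rightarrow> complex" where
  "dens_term \<alpha> lam R x n m k = (let d = real CARD('n) in
     complex_of_real (2 powr (1 - d) / (pi powr (d / 2) * \<alpha>) * (norm x / 2) ^ n
        * (-1) ^ m / (fact m * Gamma (real n - real m + d / 2))
        * Gamma (real k + (real n + d) / \<alpha>) / (fact k * R powr (real k + (real n + d) / \<alpha>)))
     * Sstar \<alpha> lam R (n - 2 * m) k (sgn x))"

definition stable_g :: "real \<Rightarrow> (real^'n::finite) measure \<Rightarrow> real \<Rightarrow> real^'n \<Rightarrow> complex" where
  "stable_g \<alpha> lam R x = (\<Sum>n. \<Sum>m\<le>n div 2. \<Sum>k. dens_term \<alpha> lam R x n m k)"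

definition radial_term :: "real \<Rightarrow> (real^'n::finite) measure \<Rightarrow> real \<Rightarrow> real \<Rightarrow> nat \<Rightarrow> nat \<Rightarrow> complex" where
  "radial_term \<alpha> lam R r n k = (let d = real CARD('n) in
     complex_of_real ((r / 2) ^ (CARD('n) - 1) / (pi powr (d / 2) * \<alpha>)
        * (- (r\<^sup>2 / 4)) ^ n / (fact n * Gamma (real n + d / 2))
        * Gamma (real k + (2 * real n + d) / \<alpha>) / (fact k * R powr (real k + (2 * real n + d) / \<alpha>)))
     * integral\<^sup>L (sphere_measure :: (real^'n) measure) (\<lambda>v. (Vstar \<alpha> lam R v) ^ k))"

definition radial_g :: "real \<Rightarrow> (real^'n::finite) measure \<Rightarrow> real \<Rightarrow> real \<Rightarrow> complex" where
  "radial_g \<alpha> lam R r = (\<Sum>n. \<Sum>k. radial_term \<alpha> lam R r n k)"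

end

theory Submission
  imports Defs
begin

text \<open>
  By Fourier inversion the density at \<open>x\<close> is \<open>(2 pi)^-d\<close> times the integral over \<open>z = r u\<close> (in polar
  coordinates) of \<open>exp (- i r (x \<bullet> u)) exp (- r^\<alpha> V u)\<close>. The condition \<open>R > rho0\<close> says that
  \<open>W = Vstar = R - V\<close> has modulus at most some \<open>q < R\<close> on the sphere. Expanding \<open>exp (- i r (x \<bullet> u))\<close> and
  \<open>exp (- r^\<alpha> V) = exp (- R r^\<alpha>) exp (r^\<alpha> W)\<close> into power series, dominated by
  \<open>exp (r |x|) exp (- (R - q) r^\<alpha>)\<close> with \<open>\<alpha> > 1\<close>, turns the radial integrals into Gamma values and leaves
  the spherical moments \<open>F_n x = \<integral> (x \<bullet> u)^n W(u)^k d\<omega>(u)\<close>.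

  These are homogeneous polynomials in \<open>x\<close> with \<open>\<Delta> F_n = n (n - 1) F_(n-2)\<close>. The Funk--Hecke
  constants for the powers \<open>t^n\<close> obey a matching two-step recursion, so subtracting from \<open>F_n\<close> its
  components of lower degree leaves a harmonic polynomial, which Fubini and the Funk--Hecke formula
  identify as a multiple of the projection of \<open>W^k\<close> onto degree \<open>n\<close>.
  Both the Funk--Hecke formula and the orthogonality of a harmonic polynomial to polynomials of lower degree
  follow by induction from \<open>\<integral> \<Delta> p d\<omega> = l (l + d - 2) \<integral> p d\<omega>\<close> for homogeneous \<open>p\<close> of degree \<open>l\<close>,
  which is Gaussian integration by parts. The density of the norm is obtained by
  integrating the series over spheres, where only the constant harmonic survives.
\<close>

section \<open>Polar coordinates\<close>

text \<open>The value at 0 is an arbitrary unit vector, so that \<open>dir\<close> maps into the sphere everywhere.\<close>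

definition dir :: "real^'n::finite \<Rightarrow> real^'n" where
  "dir x = (if x = 0 then axis undefined 1 else sgn x)"

lemma norm_dir [simp]: "norm (dir x) = 1"
  by (simp add: dir_def norm_sgn)

lemma norm_scaleR_dir [simp]: "norm x *\<^sub>R dir x = x"
  by (simp add: dir_def sgn_div_norm)

lemma dir_scaleR: "c > 0 \<Longrightarrow> dir (c *\<^sub>R x) = dir x"
  by (simp add: dir_def sgn_scaleR)

lemma dir_sphere: "norm u = 1 \<Longrightarrow> dir u = u"
  by (auto simp: dir_def sgn_div_norm)

lemma measurable_dir [measurable]: "dir \<in> measurable borel (restrict_space borel (sphere 0 1))"
  unfolding dir_def[abs_def] by (rule measurable_restrict_space2) (auto simp: norm_sgn)

lemma sphere_cone_eq:
  assumes "A \<subseteq> sphere (0::real^'n::finite) 1"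
  shows "{t *\<^sub>R v | t v. 0 < t \<and> t \<le> 1 \<and> v \<in> A} = (cball 0 1 \<inter> dir -` A) - {0}"
proof (intro set_eqI iffI)
  fix x assume "x \<in> {t *\<^sub>R v | t v. 0 < t \<and> t \<le> 1 \<and> v \<in> A}"
  then obtain t v where "x = t *\<^sub>R v" "0 < t" "t \<le> 1" "v \<in> A" by auto
  then show "x \<in> (cball 0 1 \<inter> dir -` A) - {0}"
    using assms dir_sphere[of v] by (auto simp: dir_scaleR)
next
  fix x assume "x \<in> (cball 0 1 \<inter> dir -` A) - {0}"
  then show "x \<in> {t *\<^sub>R v | t v. 0 < t \<and> t \<le> 1 \<and> v \<in> A}"
    by (auto intro!: exI[of _ "norm x"] exI[of _ "dir x"])
qed

lemma vimage_dir_borel: "A \<in> sets (restrict_space borel (sphere 0 1)) \<Longrightarrow> dir -` A \<in> sets borel"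
  using measurable_sets[OF measurable_dir] by auto

lemma emeasure_sphere_cone:
  assumes A_sets: "A \<in> sets (restrict_space borel (sphere (0::real^'n::finite) 1))"
  shows "emeasure lborel {t *\<^sub>R v | t v. 0 < t \<and> t \<le> 1 \<and> v \<in> A} = emeasure lborel (cball 0 1 \<inter> dir -` A)"
proof -
  have "A \<subseteq> sphere 0 1"
    using sets.sets_into_space[OF A_sets] by (simp add: space_restrict_space)
  then show ?thesis
    unfolding sphere_cone_eq[OF \<open>A \<subseteq> sphere 0 1\<close>]
    using vimage_dir_borel[OF A_sets] by (intro emeasure_Diff_null_set) auto
qed

lemma emeasure_distr_dir:
  assumes A_sets: "A \<in> sets (restrict_space borel (sphere (0::real^'n::finite) 1))"
  shows "emeasure (distr (density lborel (\<lambda>x. of_nat CARD('n) * indicator (cball 0 1) x))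
             (restrict_space borel (sphere 0 1)) dir) A
           = of_nat CARD('n) * emeasure lborel (cball 0 1 \<inter> dir -` A)"
proof -
  note [measurable, simp] = vimage_dir_borel[OF A_sets]
  have [measurable]: "cball (0::real^'n) 1 \<in> sets borel" by simp
  have "emeasure (distr (density lborel (\<lambda>x. of_nat CARD('n) * indicator (cball 0 1) x))
            (restrict_space borel (sphere 0 1)) dir) A
      = (\<integral>\<^sup>+x. of_nat CARD('n) * indicator (cball 0 1) x * indicator (dir -` A) x \<partial>lborel)"
    using A_sets by (subst emeasure_distr, simp_all, subst emeasure_density, (simp; measurable)+)
  also have "\<dots> = (\<integral>\<^sup>+x. of_nat CARD('n) * indicator (cball 0 1 \<inter> dir -` A) x \<partial>lborel)"
    by (intro nn_integral_cong) (auto split: split_indicator)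
  finally show ?thesis by (simp add: nn_integral_cmult)
qed

lemma sphere_measure_eq_distr:
  "(sphere_measure :: (real^'n::finite) measure) =
     distr (density lborel (\<lambda>x. of_nat CARD('n) * indicator (cball 0 1) x))
       (restrict_space borel (sphere 0 1)) dir" (is "_ = ?D")
proof -
  let ?S = "restrict_space borel (sphere (0::real^'n) 1)"
  have "sphere_measure = measure_of (sphere 0 1) (sets ?S) (emeasure ?D)"
    unfolding sphere_measure_def
  proof (rule measure_of_eq)
    show "sets ?S \<subseteq> Pow (sphere 0 1)"
      using sets.space_closed[of ?S] by (simp add: space_restrict_space)
    fix A assume "A \<in> sigma_sets (sphere 0 1) (sets ?S)"
    then have "A \<in> sets ?S"
      using sets.sigma_sets_eq[of ?S] by (simp add: space_restrict_space)
    then show "of_nat CARD('n) * emeasure lborel {t *\<^sub>R v |t v. 0 < t \<and> t \<le> 1 \<and> v \<in> A} = emeasure ?D A"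
      by (simp only: emeasure_sphere_cone emeasure_distr_dir)
  qed
  also have "\<dots> = ?D"
    using measure_of_of_measure[of ?D] by (simp add: space_restrict_space)
  finally show ?thesis .
qed

lemma sets_sphere_measure [measurable_cong, simp]:
  "sets (sphere_measure :: (real^'n::finite) measure) = sets (restrict_space borel (sphere 0 1))"
  by (simp add: sphere_measure_eq_distr)

lemma space_sphere_measure [simp]: "space (sphere_measure :: (real^'n::finite) measure) = sphere 0 1"
  by (simp add: sphere_measure_eq_distr space_restrict_space)

lemma emeasure_sphere_measure:
  assumes "A \<in> sets (restrict_space borel (sphere (0::real^'n::finite) 1))"
  shows "emeasure sphere_measure A = of_nat CARD('n) * emeasure lborel (cball 0 1 \<inter> dir -` A)"
  unfolding sphere_measure_eq_distr by (rule emeasure_distr_dir[OF assms])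

lemma emeasure_sphere_measure_sphere:
  "emeasure (sphere_measure :: (real^'n::finite) measure) (sphere 0 1)
     = ennreal (real CARD('n) * unit_ball_vol (real CARD('n)))"
proof -
  have "emeasure (sphere_measure :: (real^'n) measure) (sphere 0 1)
      = of_nat CARD('n) * emeasure lborel (cball (0::real^'n) 1 \<inter> dir -` sphere 0 1)"
    by (rule emeasure_sphere_measure) (auto simp: sets_restrict_space image_iff)
  also have "cball (0::real^'n) 1 \<inter> dir -` sphere 0 1 = cball 0 1" by auto
  finally show ?thesis
    by (simp add: emeasure_cball ennreal_of_nat_eq_real_of_nat ennreal_mult)
qed

interpretation sph: finite_measure "sphere_measure :: (real^'n::finite) measure"
  by standard (simp add: emeasure_sphere_measure_sphere)

lemma Gamma_plus1_pos: "x > 0 \<Longrightarrow> Gamma (x + 1) = x * Gamma (x::real)"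
  using nonpos_Ints_nonpos[of x] by (intro Gamma_plus1) auto

lemma measure_sphere_measure_sphere:
  "measure (sphere_measure :: (real^'n::finite) measure) (sphere 0 1)
     = 2 * pi powr (real CARD('n) / 2) / Gamma (real CARD('n) / 2)"
proof -
  define h where "h = real CARD('n) / 2"
  have "h > 0" by (simp add: h_def)
  have "measure (sphere_measure :: (real^'n) measure) (sphere 0 1)
      = real CARD('n) * unit_ball_vol (real CARD('n))"
    unfolding measure_def emeasure_sphere_measure_sphere by (rule enn2real_ennreal) simp
  also have "\<dots> = 2 * h * (pi powr h / Gamma (h + 1))"
    by (simp add: unit_ball_vol_def h_def)
  also have "Gamma (h + 1) = h * Gamma h"
    using \<open>h > 0\<close> by (rule Gamma_plus1_pos)
  finally show ?thesis
    using \<open>h > 0\<close> by (simp flip: h_def)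
qed

lemma emeasure_cone_scale:
  assumes A_sets: "A \<in> sets (restrict_space borel (sphere (0::real^'n::finite) 1))" and b_pos: "b > 0"
  shows "emeasure lborel (cball 0 b \<inter> dir -` A)
      = ennreal (b ^ CARD('n)) * emeasure lborel (cball 0 1 \<inter> dir -` A)"
proof -
  note [measurable, simp] = vimage_dir_borel[OF A_sets]
  have "emeasure lborel (cball 0 b \<inter> dir -` A)
      = emeasure (density (distr lborel borel (\<lambda>x. 0 + b *\<^sub>R x)) (\<lambda>_. ennreal (\<bar>b\<bar>^DIM(real^'n))))
         (cball 0 b \<inter> dir -` A)"
    using lborel_affine[of b "0::real^'n"] b_pos by simp
  also have "\<dots> = ennreal (b ^ CARD('n)) * emeasure lborel ((\<lambda>x. b *\<^sub>R x) -` (cball 0 b \<inter> dir -` A))"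
    using b_pos by (subst emeasure_density)
       (simp_all add: nn_integral_cmult_indicator emeasure_distr del: vimage_Int)
  also have "(\<lambda>x. b *\<^sub>R x) -` (cball 0 b \<inter> dir -` A) = cball 0 1 \<inter> dir -` A"
    using b_pos by (auto simp: dir_scaleR)
  finally show ?thesis .
qed

definition radial_measure :: "nat \<Rightarrow> real measure" where
  "radial_measure k = density lborel (\<lambda>r. ennreal (indicator {0<..} r * r ^ k))"

lemma sets_radial_measure [measurable_cong, simp]: "sets (radial_measure k) = sets borel"
  and space_radial_measure [simp]: "space (radial_measure k) = UNIV"
  by (simp_all add: radial_measure_def)

lemma AE_radial_measure_pos: "AE r in radial_measure k. r > 0"
  unfolding radial_measure_def by (subst AE_density) (auto split: split_indicator)

lemma sigma_finite_radial_measure: "sigma_finite_measure (radial_measure k)"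
  unfolding radial_measure_def
  by (subst sigma_finite_measure.sigma_finite_iff_density_finite[OF sigma_finite_lborel]) auto

lemma emeasure_radial_measure_atMost:
  "emeasure (radial_measure k) {..b} = ennreal (max 0 b ^ Suc k / Suc k)"
proof -
  have "emeasure (radial_measure k) {..b} = (\<integral>\<^sup>+r. ennreal (r ^ k) * indicator {0..max 0 b} r \<partial>lborel)"
    unfolding radial_measure_def
    by (subst emeasure_density)
       (auto intro!: nn_integral_cong_AE AE_I[of _ _ "{0}"] simp: le_max_iff_disj split: split_indicator
         split_indicator_asm)
  also have "\<dots> = ennreal (max 0 b ^ Suc k / Suc k - 0 ^ Suc k / Suc k)"
    by (rule nn_integral_FTC_Icc[where F="\<lambda>r. r ^ Suc k / Suc k"])
       (auto intro!: DERIV_cong[OF DERIV_cdivide[OF DERIV_pow]] simp del: power_Suc of_nat_Suc)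
  finally show ?thesis by simp
qed

lemma emeasure_cone_eq_radial_mult_sphere:
  assumes A_sets: "A \<in> sets (sphere_measure :: (real^'n::finite) measure)"
  shows "emeasure lborel (norm -` {..b} \<inter> dir -` A)
           = emeasure (radial_measure (CARD('n) - 1)) {..b} * emeasure sphere_measure A"
proof (cases "b > 0")
  case True
  have A_restrict: "A \<in> sets (restrict_space borel (sphere 0 1))" using A_sets by simp
  have "norm -` {..b} = cball (0::real^'n) b" by auto
  then have "emeasure lborel (norm -` {..b} \<inter> dir -` A)
      = ennreal (b ^ CARD('n)) * emeasure lborel (cball 0 1 \<inter> dir -` A)"
    by (simp add: emeasure_cone_scale[OF A_restrict True])
  also have "ennreal (b ^ CARD('n)) = ennreal (b ^ CARD('n) / CARD('n)) * of_nat CARD('n)"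
    using True by (simp add: ennreal_of_nat_eq_real_of_nat ennreal_mult[symmetric])
  finally show ?thesis
    using True emeasure_radial_measure_atMost[of "CARD('n) - 1" b]
    by (simp add: emeasure_sphere_measure[OF A_restrict] mult.assoc)
next
  case False
  have "norm -` {..b} \<inter> dir -` A \<subseteq> {0::real^'n}"
    using False by (auto dest: order_trans[of "norm _" b 0])
  then have "emeasure lborel (norm -` {..b} \<inter> dir -` A) \<le> emeasure lborel {0::real^'n}"
    by (rule emeasure_mono) simp
  then show ?thesis
    using False emeasure_radial_measure_atMost[of "CARD('n) - 1" b] by simp
qed

lemma measure_eqI_atMost_real:
  fixes M N :: "real measure"
  assumes sets: "sets M = sets borel" "sets N = sets borel"
    and emeasure_eq: "\<And>b. emeasure M {..b} = emeasure N {..b}" and fin: "\<And>b. emeasure M {..b} \<noteq> \<infinity>"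
  shows "M = N"
proof (rule measure_eqI_generator_eq[where E="range (\<lambda>b. {..b::real})" and \<Omega>=UNIV and A="\<lambda>i. {..real i}"])
  show "Int_stable (range (\<lambda>b. {..b::real}))"
    by (auto simp: Int_stable_def)
  show "sets M = sigma_sets UNIV (range (\<lambda>b. {..b}))" "sets N = sigma_sets UNIV (range (\<lambda>b. {..b}))"
    by (simp_all add: sets borel_eq_atMost)
  show "(\<Union>i. {..real i}) = UNIV" by (auto intro: real_arch_simple)
qed (use emeasure_eq fin in auto)

lemma emeasure_norm_vimage_cone:
  assumes A_sets: "A \<in> sets (sphere_measure :: (real^'n::finite) measure)" and B_sets: "B \<in> sets borel"
  shows "emeasure lborel (norm -` B \<inter> dir -` A)
      = emeasure (radial_measure (CARD('n) - 1)) B * emeasure sphere_measure A"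
proof -
  have [measurable, simp]: "dir -` A \<in> sets borel" using vimage_dir_borel A_sets by simp
  define cone_norm where "cone_norm
      = distr (density lborel (indicator (dir -` A))) borel (norm :: real^'n \<Rightarrow> real)"
  define scaled_radial where "scaled_radial
      = density (radial_measure (CARD('n) - 1)) (\<lambda>_. emeasure sphere_measure A)"
  have cone_norm: "emeasure cone_norm C = emeasure lborel (norm -` C \<inter> dir -` A)"
    if [measurable]: "C \<in> sets borel" for C
  proof -
    have "emeasure cone_norm C = (\<integral>\<^sup>+x. indicator (dir -` A) x * indicator (norm -` C) x \<partial>lborel)"
      unfolding cone_norm_def
      by (subst emeasure_distr, simp_all, subst emeasure_density)
         (simp_all add: measurable_sets_borel[OF borel_measurable_norm])
    also have "\<dots> = (\<integral>\<^sup>+x. indicator (norm -` C \<inter> dir -` A) x \<partial>lborel)"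
      by (intro nn_integral_cong) (auto split: split_indicator)
    finally show ?thesis by simp
  qed
  have scaled_radial: "emeasure scaled_radial C
      = emeasure (radial_measure (CARD('n) - 1)) C * emeasure sphere_measure A"
    if "C \<in> sets borel" for C
    unfolding scaled_radial_def using that
    by (subst emeasure_density)
       (simp_all add: nn_integral_multc mult.commute[of "emeasure sphere_measure A"])
  have "cone_norm = scaled_radial"
  proof (rule measure_eqI_atMost_real)
    show emeasure_atMost: "emeasure cone_norm {..b} = emeasure scaled_radial {..b}" for b
      by (simp add: cone_norm scaled_radial emeasure_cone_eq_radial_mult_sphere[OF A_sets])
    have "emeasure sphere_measure A < \<infinity>" by (simp add: sph.emeasure_finite less_top[symmetric])
    then show "emeasure cone_norm {..b} \<noteq> \<infinity>" for b
      unfolding emeasure_atMost using emeasure_radial_measure_atMost[of "CARD('n) - 1" b]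
      by (simp add: scaled_radial ennreal_mult_eq_top_iff)
  qed (simp_all add: cone_norm_def scaled_radial_def)
  then show ?thesis using cone_norm[OF B_sets] scaled_radial[OF B_sets] by simp
qed

lemma measurable_norm_dir [measurable]:
  "(\<lambda>x::real^'n::finite. (norm x, dir x)) \<in> measurable lborel (borel \<Otimes>\<^sub>M sphere_measure)"
proof (rule measurable_Pair)
  show "(dir :: real^'n \<Rightarrow> _) \<in> measurable lborel sphere_measure"
    unfolding measurable_cong_sets[OF sets_lborel sets_sphere_measure] by (rule measurable_dir)
qed simp

theorem distr_norm_dir:
  "distr lborel (borel \<Otimes>\<^sub>M sphere_measure) (\<lambda>x::real^'n::finite. (norm x, dir x))
     = radial_measure (CARD('n) - 1) \<Otimes>\<^sub>M sphere_measure" (is "?polar = ?radial \<Otimes>\<^sub>M _")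
proof (rule pair_measure_eqI[symmetric])
  show "sigma_finite_measure ?radial" by (rule sigma_finite_radial_measure)
  show "sigma_finite_measure (sphere_measure :: (real^'n) measure)" by unfold_locales
  show "sets (?radial \<Otimes>\<^sub>M sphere_measure) = sets ?polar" by (simp cong: sets_pair_measure_cong)
  fix B A assume "B \<in> sets ?radial" and A_sets: "A \<in> sets (sphere_measure :: (real^'n) measure)"
  then have B_sets: "B \<in> sets borel" by simp
  have "emeasure ?polar (B \<times> A) = emeasure lborel ((\<lambda>x::real^'n. (norm x, dir x)) -` (B \<times> A))"
    using A_sets B_sets by (subst emeasure_distr) auto
  also have "(\<lambda>x::real^'n. (norm x, dir x)) -` (B \<times> A) = norm -` B \<inter> dir -` A" by auto
  finally show "emeasure ?radial B * emeasure sphere_measure A = emeasure ?polar (B \<times> A)"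
    by (simp add: emeasure_norm_vimage_cone[OF A_sets B_sets])
qed

lemma borel_measurable_sphere_measure:
  "f \<in> borel_measurable borel \<Longrightarrow> f \<in> borel_measurable (sphere_measure :: (real^'n::finite) measure)"
  unfolding measurable_cong_sets[OF sets_sphere_measure refl] by (rule measurable_restrict_space1)

lemma borel_measurable_ident_sphere_measure [measurable]:
  "(\<lambda>u. u) \<in> borel_measurable (sphere_measure :: (real^'n::finite) measure)"
  by (rule borel_measurable_sphere_measure) auto

lemma borel_measurable_polar_scaleR:
  assumes "f \<in> borel_measurable (borel :: (real^'n::finite) measure)"
  shows "(\<lambda>(r, u). f (r *\<^sub>R u)) \<in> borel_measurable (borel \<Otimes>\<^sub>M sphere_measure)"
  unfolding split_beta
  by (rule measurable_compose[OF _ assms])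
     (intro borel_measurable_scaleR measurable_fst
       measurable_compose[OF measurable_snd borel_measurable_ident_sphere_measure])

lemma borel_measurable_nn_integral_sphere:
  assumes "f \<in> borel_measurable (borel :: (real^'n::finite) measure)"
  shows "(\<lambda>r. \<integral>\<^sup>+u. f (r *\<^sub>R u) \<partial>sphere_measure) \<in> borel_measurable borel"
  using sph.borel_measurable_nn_integral[OF borel_measurable_polar_scaleR[OF assms]] by simp

lemma nn_integral_polar:
  assumes measurable_f: "f \<in> borel_measurable (borel :: (real^'n::finite) measure)"
  shows "(\<integral>\<^sup>+x. f x \<partial>lborel) = (\<integral>\<^sup>+r. \<integral>\<^sup>+u. f (r *\<^sub>R u) \<partial>sphere_measure \<partial>radial_measure (CARD('n) - 1))"
proof -
  note [measurable] = borel_measurable_polar_scaleR[OF measurable_f]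
  have "(\<integral>\<^sup>+x. f x \<partial>lborel) = (\<integral>\<^sup>+x. (\<lambda>(r, u). f (r *\<^sub>R u)) (norm x, dir x) \<partial>lborel)"
    by simp
  also have "\<dots> = (\<integral>\<^sup>+y. (\<lambda>(r, u). f (r *\<^sub>R u)) y \<partial>(radial_measure (CARD('n) - 1) \<Otimes>\<^sub>M sphere_measure))"
    unfolding distr_norm_dir[symmetric] by (rule nn_integral_distr[symmetric]) measurable
  also have "\<dots> = (\<integral>\<^sup>+r. \<integral>\<^sup>+u. f (r *\<^sub>R u) \<partial>sphere_measure \<partial>radial_measure (CARD('n) - 1))"
    by (subst sigma_finite_measure.nn_integral_fst[symmetric]) (auto intro: sph.sigma_finite_measure_axioms)
  finally show ?thesis .
qed

lemma distr_norm_density: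
  fixes f :: "real^'n::finite \<Rightarrow> ennreal"
  assumes measurable_f: "f \<in> borel_measurable borel"
  shows "distr (density lborel f) lborel norm
           = density (radial_measure (CARD('n) - 1)) (\<lambda>r. \<integral>\<^sup>+u. f (r *\<^sub>R u) \<partial>sphere_measure)"
proof (rule measure_eqI)
  fix A assume "A \<in> sets (distr (density lborel f) lborel norm)"
  then have A [measurable]: "A \<in> sets borel" by simp
  note [measurable] = measurable_f borel_measurable_nn_integral_sphere[OF measurable_f]
  have norm_A [measurable]: "norm -` A \<in> sets (borel :: (real^'n) measure)"
    by (rule measurable_sets_borel[OF borel_measurable_norm A])
  have measurable_restricted: "(\<lambda>x. f x * indicator A (norm x)) \<in> borel_measurable borel" by measurable
  have f_scaleR: "(\<lambda>u. f (r *\<^sub>R u)) \<in> borel_measurable sphere_measure" for r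
    by (rule borel_measurable_sphere_measure) (use measurable_f in measurable)
  have "emeasure (distr (density lborel f) lborel norm) A = (\<integral>\<^sup>+x. f x * indicator A (norm x) \<partial>lborel)"
    by (subst emeasure_distr, simp_all, subst emeasure_density)
       (auto intro!: nn_integral_cong split: split_indicator)
  also have "\<dots> = (\<integral>\<^sup>+r. \<integral>\<^sup>+u. f (r *\<^sub>R u) * indicator A (norm (r *\<^sub>R u)) \<partial>sphere_measure \<partial>radial_measure (CARD('n) - 1))"
    by (rule nn_integral_polar[OF measurable_restricted])
  also have "\<dots> = (\<integral>\<^sup>+r. (\<integral>\<^sup>+u. f (r *\<^sub>R u) \<partial>sphere_measure) * indicator A r \<partial>radial_measure (CARD('n) - 1))"
  proof (rule nn_integral_cong_AE, use AE_radial_measure_pos in eventually_elim)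
    case (elim r)
    have "(\<integral>\<^sup>+u. f (r *\<^sub>R u) * indicator A (norm (r *\<^sub>R u)) \<partial>sphere_measure)
        = (\<integral>\<^sup>+u. f (r *\<^sub>R u) * indicator A r \<partial>sphere_measure)"
      using elim by (intro nn_integral_cong) simp
    also have "\<dots> = (\<integral>\<^sup>+u. f (r *\<^sub>R u) \<partial>sphere_measure) * indicator A r"
      by (rule nn_integral_multc[OF f_scaleR])
    finally show ?case .
  qed
  also have "\<dots> = emeasure (density (radial_measure (CARD('n) - 1)) (\<lambda>r. \<integral>\<^sup>+u. f (r *\<^sub>R u) \<partial>sphere_measure)) A"
    by (subst emeasure_density) simp_all
  finally show "emeasure (distr (density lborel f) lborel norm) A
      = emeasure (density (radial_measure (CARD('n) - 1)) (\<lambda>r. \<integral>\<^sup>+u. f (r *\<^sub>R u) \<partial>sphere_measure)) A" .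
qed simp

lemma
  fixes h :: "real \<Rightarrow> real" and P :: "real^'n::finite \<Rightarrow> 'b::{banach, second_countable_topology}"
  assumes integrable_h: "integrable (radial_measure (CARD('n) - 1)) h"
    and integrable_P: "integrable sphere_measure P"
  shows integrable_polar_product: "integrable lborel (\<lambda>x. h (norm x) *\<^sub>R P (dir x))"
    and integral_polar_product: "(\<integral>x. h (norm x) *\<^sub>R P (dir x) \<partial>lborel)
           = integral\<^sup>L (radial_measure (CARD('n) - 1)) h *\<^sub>R integral\<^sup>L sphere_measure P"
proof -
  let ?radial = "radial_measure (CARD('n) - 1)"
  interpret radial: sigma_finite_measure ?radial by (rule sigma_finite_radial_measure)
  interpret pair_sigma_finite ?radial "sphere_measure :: (real^'n) measure" ..
  have [measurable]: "h \<in> borel_measurable borel" "P \<in> borel_measurable sphere_measure"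
    using borel_measurable_integrable[OF integrable_h] borel_measurable_integrable[OF integrable_P]
    by simp_all
  have measurable_prod: "(\<lambda>(r, u). h r *\<^sub>R P u) \<in> borel_measurable (borel \<Otimes>\<^sub>M sphere_measure)" by measurable
  have integrable_prod: "integrable (?radial \<Otimes>\<^sub>M sphere_measure) (\<lambda>(r, u). h r *\<^sub>R P u)"
  proof (rule Fubini_integrable)
    show "(\<lambda>(r, u). h r *\<^sub>R P u) \<in> borel_measurable (?radial \<Otimes>\<^sub>M sphere_measure)" by measurable
  qed (use integrable_h integrable_P in simp_all)
  show "integrable lborel (\<lambda>x. h (norm x) *\<^sub>R P (dir x))"
    using integrable_prod unfolding distr_norm_dir[symmetric]
    by (subst (asm) integrable_distr_eq) (use measurable_prod in auto)
  have "(\<integral>x. h (norm x) *\<^sub>R P (dir x) \<partial>lborel)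
      = integral\<^sup>L (?radial \<Otimes>\<^sub>M sphere_measure) (\<lambda>(r, u). h r *\<^sub>R P u)"
    unfolding distr_norm_dir[symmetric] by (subst integral_distr) (use measurable_prod in auto)
  also have "\<dots> = integral\<^sup>L ?radial h *\<^sub>R integral\<^sup>L sphere_measure P"
    using integral_fst'[OF integrable_prod] integrable_h integrable_P by simp
  finally show "(\<integral>x. h (norm x) *\<^sub>R P (dir x) \<partial>lborel)
      = integral\<^sup>L ?radial h *\<^sub>R integral\<^sup>L sphere_measure P" .
qed

lemma has_integral_substitution_powr:
  fixes f :: "real \<Rightarrow> real" and a R :: real
  assumes abs_integrable_f: "f absolutely_integrable_on {0<..}" and a_pos: "a > 0" and R_pos: "R > 0"
  shows "((\<lambda>r. R * (a * r powr (a - 1)) * f (R * r powr a)) has_integral integral {0<..} f) {0<..}"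
proof -
  define g where "g r = R * r powr a" for r :: real
  define g' where "g' r = R * (a * r powr (a - 1))" for r :: real
  have image_g: "g ` {0<..} = {0<..}"
  proof safe
    fix t :: real assume "0 < t"
    then show "t \<in> g ` {0<..}" using a_pos R_pos
      by (intro image_eqI[of _ _ "(t / R) powr (1 / a)"]) (auto simp: g_def powr_powr)
  qed (use R_pos in \<open>auto simp: g_def\<close>)
  have inj_g: "inj_on g {0<..}"
    using R_pos a_pos by (intro inj_on_inverseI[of _ "\<lambda>t. (t / R) powr (1 / a)"])
       (auto simp: g_def powr_powr)
  have "(\<lambda>r. \<bar>g' r\<bar> * f (g r)) absolutely_integrable_on {0<..}
      \<and> integral {0<..} (\<lambda>r. \<bar>g' r\<bar> * f (g r)) = integral {0<..} f"
  proof (subst has_absolute_integral_change_of_variables_1'[where g=g and g'=g'])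
    show "(g has_field_derivative g' r) (at r within {0<..})" if "r \<in> {0<..}" for r
      using that unfolding g_def g'_def by (auto intro!: derivative_eq_intros simp: algebra_simps)
  qed (use inj_g abs_integrable_f in \<open>auto simp: image_g\<close>)
  then have "((\<lambda>r. \<bar>g' r\<bar> * f (g r)) has_integral integral {0<..} f) {0<..}"
    by (auto simp: has_integral_integrable_integral set_lebesgue_integral_eq_integral(1))
  then show ?thesis
    by (rule has_integral_eq[rotated]) (use a_pos R_pos in \<open>simp add: g_def g'_def\<close>)
qed

lemma has_integral_powr_exp_powr:
  fixes a b R :: real
  assumes a_pos: "a > 0" and b_pos: "b > 0" and R_pos: "R > 0"
  shows "((\<lambda>r. r powr (b - 1) * exp (- R * r powr a)) has_integral Gamma (b / a) / (a * R powr (b / a))) {0<..}"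
proof -
  define f where "f t = t powr (b / a - 1) / exp t" for t :: real
  have "(f has_integral Gamma (b / a)) {0..}"
    unfolding f_def using a_pos b_pos by (intro Gamma_integral_real) simp
  then have Gamma_integral: "(f has_integral Gamma (b / a)) {0<..}"
    by (subst (asm) has_integral_spike_set_eq[where T="{0<..}"])
       (auto intro!: negligible_subset[OF negligible_sing[of 0]])
  then have f_abs: "f absolutely_integrable_on {0<..}"
    by (intro nonnegative_absolutely_integrable_1) (auto simp: f_def has_integral_integrable_integral)
  have integrand: "R * (a * r powr (a - 1)) * f (R * r powr a)
      = (r powr (b - 1) * exp (- R * r powr a)) * (a * R powr (b / a))"
    if "r > 0" for r
  proof -
    have "r powr (a - 1) * (r powr a) powr (b / a - 1) = r powr (b - 1)"
      using a_pos by (simp add: powr_powr powr_add[symmetric] field_simps)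
    moreover have "R * R powr (b / a - 1) = R powr (b / a)"
      using R_pos by (simp add: powr_diff)
    ultimately show ?thesis
      using a_pos R_pos that by (simp add: f_def powr_mult exp_minus field_simps)
  qed
  have "((\<lambda>r. (r powr (b - 1) * exp (- R * r powr a)) * (a * R powr (b / a))) has_integral Gamma (b / a)) {0<..}"
    using has_integral_substitution_powr[OF f_abs a_pos R_pos] unfolding integral_unique[OF Gamma_integral]
    by (rule has_integral_eq[rotated]) (rule integrand, simp)
  from has_integral_divide[OF this, of "a * R powr (b / a)"] show ?thesis
    using a_pos R_pos by simp
qed

lemma has_bochner_integral_radial_powr_exp:
  fixes a s R :: real
  assumes a_pos: "a > 0" and s_nonneg: "s \<ge> 0" and R_pos: "R > 0"
  shows "has_bochner_integral (radial_measure k) (\<lambda>r. r powr s * exp (- R * r powr a))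
           (Gamma ((s + k + 1) / a) / (a * R powr ((s + k + 1) / a)))"
proof (rule has_bochner_integral_nn_integral)
  have "(\<integral>\<^sup>+r. ennreal (r powr s * exp (- R * r powr a)) \<partial>radial_measure k)
      = (\<integral>\<^sup>+r. ennreal (indicator {0<..} r * (r powr ((s + k + 1) - 1) * exp (- R * r powr a))) \<partial>lborel)"
    unfolding radial_measure_def
    by (subst nn_integral_density)
       (auto intro!: nn_integral_cong simp: powr_add powr_realpow ennreal_mult'[symmetric] mult_ac
         split: split_indicator)
  also have "\<dots> = Gamma ((s + k + 1) / a) / (a * R powr ((s + k + 1) / a))"
    using a_pos s_nonneg R_pos by (intro nn_integral_has_integral_lebesgue has_integral_powr_exp_powr) auto
  finally show "(\<integral>\<^sup>+r. ennreal (r powr s * exp (- R * r powr a)) \<partial>radial_measure k)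
      = ennreal (Gamma ((s + k + 1) / a) / (a * R powr ((s + k + 1) / a)))" .
  show "0 \<le> Gamma ((s + k + 1) / a) / (a * R powr ((s + k + 1) / a))"
    using a_pos s_nonneg R_pos by (intro divide_nonneg_nonneg) (auto intro!: less_imp_le[OF Gamma_real_pos])
qed auto

section \<open>Gaussian integrals\<close>

lemma
  fixes g :: "'a::euclidean_space \<Rightarrow> real \<Rightarrow> 'b::{real_normed_field,banach,second_countable_topology}"
  assumes integrable_g: "\<And>b. integrable lborel (g b)"
  shows integrable_lborel_prod_Basis: "integrable lborel (\<lambda>x::'a. \<Prod>b\<in>Basis. g b (x \<bullet> b))"
    and integral_lborel_prod_Basis:
      "(\<integral>x. (\<Prod>b\<in>Basis. g b (x \<bullet> b)) \<partial>lborel) = (\<Prod>b\<in>Basis. integral\<^sup>L lborel (g b))"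
proof -
  interpret product_sigma_finite "\<lambda>_::'a. lborel :: real measure" by standard
  have [measurable]: "g b \<in> borel_measurable borel" for b
    using borel_measurable_integrable[OF integrable_g[of b]] by simp
  have prod_coords: "(\<Prod>b\<in>Basis. g b ((\<Sum>i\<in>Basis. f i *\<^sub>R i) \<bullet> b)) = (\<Prod>b\<in>Basis. g b (f b))"
    for f :: "'a \<Rightarrow> real"
    by (intro prod.cong) simp_all
  have borel_coords: "(\<lambda>f::'a \<Rightarrow> real. \<Sum>b\<in>Basis. f b *\<^sub>R b) \<in> borel_measurable (\<Pi>\<^sub>M b\<in>Basis. lborel)"
    by measurable
  have borel_prod: "(\<lambda>x::'a. \<Prod>b\<in>Basis. g b (x \<bullet> b)) \<in> borel_measurable borel"
    by measurable
  have "integrable (\<Pi>\<^sub>M b\<in>Basis. lborel) (\<lambda>f. \<Prod>b\<in>Basis. g b (f b))"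
    by (rule product_integrable_prod) (simp_all add: integrable_g)
  then show "integrable lborel (\<lambda>x::'a. \<Prod>b\<in>Basis. g b (x \<bullet> b))"
    by (subst lborel_eq, subst integrable_distr_eq[OF borel_coords borel_prod]) (simp only: prod_coords)
  have "(\<integral>x. (\<Prod>b\<in>Basis. g b (x \<bullet> b)) \<partial>lborel) = integral\<^sup>L (\<Pi>\<^sub>M b\<in>Basis. lborel) (\<lambda>f. \<Prod>b\<in>Basis. g b (f b))"
    by (subst lborel_eq, subst integral_distr[OF borel_coords borel_prod]) (simp only: prod_coords)
  also have "\<dots> = (\<Prod>b\<in>Basis. integral\<^sup>L lborel (g b))"
    by (rule product_integral_prod) (auto simp: integrable_g)
  finally show "(\<integral>x. (\<Prod>b\<in>Basis. g b (x \<bullet> b)) \<partial>lborel) = (\<Prod>b\<in>Basis. integral\<^sup>L lborel (g b))" .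
qed

lemma
  fixes f :: "'a::euclidean_space \<Rightarrow> 'b::{banach, second_countable_topology}"
  assumes [measurable]: "f \<in> borel_measurable borel" and c_nonzero: "c \<noteq> 0"
  shows integral_lborel_affine: "integral\<^sup>L lborel f = \<bar>c\<bar> ^ DIM('a) *\<^sub>R (\<integral>x. f (t + c *\<^sub>R x) \<partial>lborel)"
    and integrable_lborel_affine: "integrable lborel f \<Longrightarrow> integrable lborel (\<lambda>x. f (t + c *\<^sub>R x))"
proof -
  have lborel: "lborel = density (distr lborel borel (\<lambda>x::'a. t + c *\<^sub>R x)) (\<lambda>_. ennreal (\<bar>c\<bar> ^ DIM('a)))"
    using lborel_affine[OF c_nonzero, of t] by simp
  have "integral\<^sup>L lborel f = integral\<^sup>L (distr lborel borel (\<lambda>x. t + c *\<^sub>R x)) (\<lambda>x. \<bar>c\<bar> ^ DIM('a) *\<^sub>R f x)"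
    by (subst lborel, rule integral_density) auto
  also have "\<dots> = (\<integral>x. \<bar>c\<bar> ^ DIM('a) *\<^sub>R f (t + c *\<^sub>R x) \<partial>lborel)"
    by (rule integral_distr) auto
  finally show "integral\<^sup>L lborel f = \<bar>c\<bar> ^ DIM('a) *\<^sub>R (\<integral>x. f (t + c *\<^sub>R x) \<partial>lborel)" by simp
  assume "integrable lborel f"
  then have "integrable (distr lborel borel (\<lambda>x. t + c *\<^sub>R x)) (\<lambda>x. \<bar>c\<bar> ^ DIM('a) *\<^sub>R f x)"
    by (subst (asm) lborel, subst (asm) integrable_density) auto
  then have "integrable lborel (\<lambda>x. \<bar>c\<bar> ^ DIM('a) *\<^sub>R f (t + c *\<^sub>R x))"
    by (subst (asm) integrable_distr_eq) auto
  from integrable_scaleR_right[OF this, of "inverse (\<bar>c\<bar> ^ DIM('a))"]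
  show "integrable lborel (\<lambda>x. f (t + c *\<^sub>R x))"
    using c_nonzero by simp
qed

definition gauss :: "'a::euclidean_space \<Rightarrow> real" where
  "gauss x = (\<Prod>b\<in>Basis. std_normal_density (x \<bullet> b))"

lemma neg_norm_sq_half_eq_sum: "- (norm (x::'a::euclidean_space))\<^sup>2 / 2 = (\<Sum>b\<in>Basis. - (x \<bullet> b)\<^sup>2 / 2)"
  unfolding power2_norm_eq_inner
  by (subst euclidean_inner) (simp add: sum_negf sum_divide_distrib power2_eq_square)

lemma gauss_eq: "gauss (x :: 'a::euclidean_space) = (1 / sqrt (2 * pi)) ^ DIM('a) * exp (- (norm x)\<^sup>2 / 2)"
  unfolding neg_norm_sq_half_eq_sum
  by (simp only: gauss_def std_normal_density_def exp_sum[OF finite_Basis] prod.distrib prod_constant)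

lemma gauss_pos [simp]: "gauss x > 0"
  by (simp add: gauss_eq)

lemma gauss_nonneg [simp]: "gauss x \<ge> 0"
  by (simp add: less_imp_le)

lemma borel_measurable_gauss [measurable]: "gauss \<in> borel_measurable borel"
  unfolding gauss_eq[abs_def] by measurable

lemma borel_measurable_cis [measurable]: "cis \<in> borel_measurable borel"
  by (rule borel_measurable_continuous_onI) (rule continuous_on_cis[OF continuous_on_id])

lemma integrable_gauss: "integrable lborel (gauss :: 'a::euclidean_space \<Rightarrow> real)"
  and integral_gauss: "integral\<^sup>L lborel (gauss :: 'a \<Rightarrow> real) = 1"
proof -
  have std_normal: "integrable lborel std_normal_density" "integral\<^sup>L lborel std_normal_density = 1"
    using integrable_std_normal_moment[of 0] integral_std_normal_moment_even[of 0] by simp_all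
  show "integrable lborel (gauss :: 'a \<Rightarrow> real)"
    unfolding gauss_def[abs_def] by (rule integrable_lborel_prod_Basis) (rule std_normal)
  show "integral\<^sup>L lborel (gauss :: 'a \<Rightarrow> real) = 1"
    unfolding gauss_def[abs_def] by (subst integral_lborel_prod_Basis) (simp_all add: std_normal)
qed

lemma
  shows integrable_std_normal_density_cis: "integrable lborel (\<lambda>t. std_normal_density t *\<^sub>R cis (c * t))"
    and integral_std_normal_density_cis:
      "(\<integral>t. std_normal_density t *\<^sub>R cis (c * t) \<partial>lborel) = complex_of_real (exp (- c\<^sup>2 / 2))"
proof -
  show "integrable lborel (\<lambda>t. std_normal_density t *\<^sub>R cis (c * t))"
    by (rule Bochner_Integration.integrable_bound[OF integrable_std_normal_moment[of 0]]) auto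
  have "complex_of_real (exp (- c\<^sup>2 / 2)) = char std_normal_distribution c"
    by (simp add: char_std_normal_distribution)
  also have "\<dots> = (\<integral>t. std_normal_density t *\<^sub>R cis (c * t) \<partial>lborel)"
    unfolding char_def by (subst integral_density) (auto simp: cis_conv_exp)
  finally show "(\<integral>t. std_normal_density t *\<^sub>R cis (c * t) \<partial>lborel) = complex_of_real (exp (- c\<^sup>2 / 2))" ..
qed

lemma cis_sum: "finite A \<Longrightarrow> cis (sum f A) = (\<Prod>k\<in>A. cis (f k))"
  by (induction rule: finite_induct) (auto simp: cis_mult[symmetric])

lemma integral_gauss_cis:
  "(\<integral>x. gauss x *\<^sub>R cis (z \<bullet> x) \<partial>lborel) = complex_of_real (exp (- (norm (z::'a::euclidean_space))\<^sup>2 / 2))"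
proof -
  have "gauss x *\<^sub>R cis (z \<bullet> x) = (\<Prod>b\<in>Basis. std_normal_density (x \<bullet> b) *\<^sub>R cis ((z \<bullet> b) * (x \<bullet> b)))" for x
    by (subst euclidean_inner) (simp add: gauss_def cis_sum scaleR_conv_of_real prod.distrib)
  then show ?thesis
    unfolding neg_norm_sq_half_eq_sum exp_sum[OF finite_Basis]
    by (simp add: integral_lborel_prod_Basis[OF integrable_std_normal_density_cis]
      integral_std_normal_density_cis)
qed

definition gauss_kernel :: "real \<Rightarrow> 'a::euclidean_space \<Rightarrow> real" where
  "gauss_kernel s w = gauss ((1 / s) *\<^sub>R w) / s ^ DIM('a)"

lemma borel_measurable_gauss_kernel [measurable]: "gauss_kernel s \<in> borel_measurable borel"
  unfolding gauss_kernel_def[abs_def] by measurable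

lemma gauss_kernel_nonneg: "s > 0 \<Longrightarrow> gauss_kernel s w \<ge> 0"
  by (simp add: gauss_kernel_def)

lemma gauss_kernel_le: "s > 0 \<Longrightarrow> gauss_kernel s (w :: 'a::euclidean_space)
    \<le> (1 / sqrt (2 * pi)) ^ DIM('a) / s ^ DIM('a)"
  unfolding gauss_kernel_def gauss_eq by (intro divide_right_mono mult_right_le_one_le) simp_all

lemma gauss_kernel_scaleR: "s > 0 \<Longrightarrow> s ^ DIM('a) * gauss_kernel s (- (s *\<^sub>R v))
    = gauss (v :: 'a::euclidean_space)"
  by (simp add: gauss_kernel_def gauss_eq)

lemma exp_neg_norm_sq_eq_gauss:
  "exp (- (norm v)\<^sup>2 / 2) = sqrt (2 * pi) ^ DIM('a) * gauss (v :: 'a::euclidean_space)"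
  unfolding gauss_eq by (simp add: power_one_over)

lemma integrable_exp_neg_norm_sq:
  "s \<noteq> 0 \<Longrightarrow> integrable lborel (\<lambda>z::'a::euclidean_space. exp (- (norm (s *\<^sub>R z))\<^sup>2 / 2))"
  unfolding exp_neg_norm_sq_eq_gauss
  using integrable_lborel_affine[of gauss s 0] integrable_gauss by simp

lemma fourier_transform_exp_neg_norm_sq:
  fixes w :: "'a::euclidean_space"
  assumes s_pos: "s > 0"
  shows "(\<integral>z. exp (- (norm (s *\<^sub>R z))\<^sup>2 / 2) *\<^sub>R cis (z \<bullet> w) \<partial>lborel)
           = complex_of_real ((2 * pi) ^ DIM('a) * gauss_kernel s w)"
proof -
  let ?d = "DIM('a)" and ?c = "sqrt (2 * pi) ^ DIM('a)"
  let ?G = "\<integral>z. gauss (s *\<^sub>R z) *\<^sub>R cis (z \<bullet> w) \<partial>lborel"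
  have "s ^ ?d *\<^sub>R ?G = (\<integral>z. gauss z *\<^sub>R cis (((1 / s) *\<^sub>R w) \<bullet> z) \<partial>lborel)"
    using s_pos by (subst integral_lborel_affine[of _ s 0]) (simp_all add: inner_commute)
  also have "\<dots> = complex_of_real (exp (- (norm ((1 / s) *\<^sub>R w))\<^sup>2 / 2))"
    by (rule integral_gauss_cis)
  also have "\<dots> = complex_of_real (?c * (s ^ ?d * gauss_kernel s w))"
    unfolding exp_neg_norm_sq_eq_gauss gauss_kernel_def using s_pos by simp
  finally have fourier_gauss: "?G = complex_of_real (?c * gauss_kernel s w)"
    using s_pos by (simp add: scaleR_conv_of_real)
  have "(\<integral>z. exp (- (norm (s *\<^sub>R z))\<^sup>2 / 2) *\<^sub>R cis (z \<bullet> w) \<partial>lborel) = ?c *\<^sub>R ?G"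
    unfolding exp_neg_norm_sq_eq_gauss by (simp only: scaleR_scaleR[symmetric] integral_scaleR_right)
  also have "\<dots> = complex_of_real (?c * ?c * gauss_kernel s w)"
    unfolding fourier_gauss by (simp add: scaleR_conv_of_real)
  also have "?c * ?c = (2 * pi) ^ ?d"
    by (subst power_mult_distrib[symmetric]) simp
  finally show ?thesis .
qed

definition gauss_moment :: "nat \<Rightarrow> real" where
  "gauss_moment k = (\<integral>t. std_normal_density t * t ^ k \<partial>lborel)"

lemma gauss_moment_odd: "odd k \<Longrightarrow> gauss_moment k = 0"
  using integral_std_normal_moment_odd by (auto simp: gauss_moment_def elim!: oddE)

lemma gauss_moment_even: "gauss_moment (2 * m) = fact (2 * m) / (2 ^ m * fact m)"
  using integral_std_normal_moment_even[of m] by (simp add: gauss_moment_def)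

lemma gauss_moment_add_2: "gauss_moment (k + 2) = real (k + 1) * gauss_moment k"
proof (cases "even k")
  case True
  then obtain m where k_eq: "k = 2 * m" by auto
  have "gauss_moment (k + 2) = fact (2 * Suc m) / (2 ^ Suc m * fact (Suc m))"
    using gauss_moment_even[of "Suc m"] by (simp add: k_eq)
  also have "\<dots> = (2 * (real m + 1)) * (real k + 1) * fact (2 * m) / (2 * (real m + 1) * (2 ^ m * fact m))"
    by (simp add: k_eq algebra_simps)
  also have "\<dots> = real (k + 1) * gauss_moment k"
    by (simp add: k_eq gauss_moment_even)
  finally show ?thesis .
qed (simp add: gauss_moment_odd)

section \<open>Homogeneous polynomials\<close>

definition partial :: "'n \<Rightarrow> (real^'n::finite \<Rightarrow> complex) \<Rightarrow> real^'n \<Rightarrow> complex" where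
  "partial i f x = vector_derivative (\<lambda>s. f (x + s *\<^sub>R axis i 1)) (at 0)"

inductive hpoly :: "nat \<Rightarrow> (real^'n::finite \<Rightarrow> complex) \<Rightarrow> bool" where
  hpoly_zero: "hpoly j (\<lambda>x. 0)"
| hpoly_const: "hpoly 0 (\<lambda>x. c)"
| hpoly_add: "hpoly j f \<Longrightarrow> hpoly j g \<Longrightarrow> hpoly j (\<lambda>x. f x + g x)"
| hpoly_coord_mult: "hpoly j f \<Longrightarrow> hpoly (Suc j) (\<lambda>x. of_real (x $ i) * f x)"

lemma hpoly_coord: "hpoly (Suc 0) (\<lambda>x. of_real (x $ i))"
  using hpoly_coord_mult[OF hpoly_const, of i 1] by simp

lemma hpoly_mult: "hpoly j f \<Longrightarrow> hpoly l g \<Longrightarrow> hpoly (j + l) (\<lambda>x. f x * g x)"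
proof (induction rule: hpoly.induct)
  case (hpoly_const c)
  show ?case using hpoly_const
  proof (induction rule: hpoly.induct)
    case (hpoly_add j f g)
    then show ?case using hpoly.hpoly_add by (fastforce simp: distrib_left)
  next
    case (hpoly_coord_mult j f i)
    then show ?case using hpoly.hpoly_coord_mult[of j "\<lambda>x. c * f x" i] by (simp add: mult_ac)
  qed (auto intro: hpoly.intros)
next
  case (hpoly_add j f g)
  then show ?case using hpoly.hpoly_add by (fastforce simp: distrib_right)
next
  case (hpoly_coord_mult j f i)
  then show ?case using hpoly.hpoly_coord_mult[of "j + l" "\<lambda>x. f x * g x" i] by (simp add: mult_ac)
qed (auto intro: hpoly.intros)

lemma hpoly_cmult: "hpoly j f \<Longrightarrow> hpoly j (\<lambda>x. c * f x)"
  using hpoly_mult[OF hpoly_const, of j f c] by simp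

lemma hpoly_diff: "hpoly j f \<Longrightarrow> hpoly j g \<Longrightarrow> hpoly j (\<lambda>x. f x - g x)"
  using hpoly_add[of j f "\<lambda>x. (-1) * g x"] hpoly_cmult[of j g "-1"] by simp

lemma hpoly_sum: "(\<And>a. a \<in> A \<Longrightarrow> hpoly j (f a)) \<Longrightarrow> hpoly j (\<lambda>x. \<Sum>a\<in>A. f a x)"
  by (induction A rule: infinite_finite_induct) (auto intro: hpoly.intros)

lemma hpoly_cnj: "hpoly j f \<Longrightarrow> hpoly j (\<lambda>x. cnj (f x))"
  by (induction rule: hpoly.induct) (auto intro: hpoly.intros)

lemma hpoly_power: "hpoly j f \<Longrightarrow> hpoly (n * j) (\<lambda>x. f x ^ n)"
  by (induction n) (auto intro: hpoly_const hpoly_mult)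

lemma hpoly_scaleR: "hpoly j f \<Longrightarrow> f (t *\<^sub>R x) = of_real (t ^ j) * f x"
  by (induction rule: hpoly.induct) (auto simp: algebra_simps)

lemma continuous_on_hpoly: "hpoly j f \<Longrightarrow> continuous_on A f"
  by (induction rule: hpoly.induct) (auto intro!: continuous_intros)

lemma hpoly_0_const: "hpoly 0 f \<Longrightarrow> \<exists>c. f = (\<lambda>x. c)"
  by (induction "0::nat" f rule: hpoly.induct) auto

lemma of_real_inner_eq_sum: "of_real (e \<bullet> u) = (\<Sum>i\<in>UNIV. of_real (e $ i) * of_real (u $ i) :: complex)"
  for e u :: "real^'n::finite"
  by (simp add: inner_vec_def)

lemma hpoly_inner: "hpoly (Suc 0) (\<lambda>u::real^'n::finite. of_real (e \<bullet> u))"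
  unfolding of_real_inner_eq_sum by (intro hpoly_sum hpoly_cmult hpoly_coord)

lemma hpoly_inner_power: "hpoly n (\<lambda>u::real^'n::finite. of_real (e \<bullet> u) ^ n)"
  using hpoly_power[OF hpoly_inner, of n e] by simp

lemma of_real_norm_sq_eq_sum: "(of_real (norm x))\<^sup>2
    = (\<Sum>i\<in>UNIV. of_real (x $ i) * of_real (x $ i) :: complex)"
  for x :: "real^'n::finite"
  by (simp only: of_real_power[symmetric] power2_norm_eq_inner of_real_inner_eq_sum)

lemma hpoly_norm_sq: "hpoly 2 (\<lambda>x::real^'n::finite. (of_real (norm x))\<^sup>2)"
  unfolding of_real_norm_sq_eq_sum unfolding numeral_2_eq_2
  by (intro hpoly_sum hpoly_coord_mult hpoly_coord)

lemma hpoly_norm_power_mult: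
  fixes p :: "real^'n::finite \<Rightarrow> complex"
  assumes "hpoly j p"
  shows "hpoly (2 * m + j) (\<lambda>x. of_real (norm x) ^ (2 * m) * p x)"
  using hpoly_mult[OF hpoly_power[OF hpoly_norm_sq, of m] assms]
  by (simp only: power_mult mult.commute[of m])

subsection \<open>Partial derivatives\<close>

lemma partialI: "(\<And>x. ((\<lambda>s. f (x + s *\<^sub>R axis i 1)) has_vector_derivative D x) (at 0)) \<Longrightarrow> partial i f = D"
  by (rule ext) (simp add: partial_def vector_derivative_at)

lemma has_vector_derivative_coord:
  "((\<lambda>s. of_real ((x + s *\<^sub>R axis i 1) $ k)) has_vector_derivative (if i = k then 1 else 0)) (at t)"
  by (auto simp: axis_def intro!: derivative_eq_intros)

lemma differentiable_hpoly_line: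
  "hpoly j f \<Longrightarrow> (\<lambda>s. f (x + s *\<^sub>R axis i 1)) differentiable (at t)"
proof (induction rule: hpoly.induct)
  case (hpoly_coord_mult j f k)
  have "(\<lambda>s. of_real ((x + s *\<^sub>R axis i 1) $ k) :: complex) differentiable (at t)"
    using has_vector_derivative_coord[of x i k t] by (rule differentiableI_vector)
  then show ?case using hpoly_coord_mult.IH by (rule differentiable_mult)
qed auto

lemma has_vector_derivative_partial:
  "hpoly j f \<Longrightarrow> ((\<lambda>s. f (x + s *\<^sub>R axis i 1)) has_vector_derivative partial i f x) (at 0)"
  unfolding partial_def using differentiable_hpoly_line vector_derivative_works by blast

lemma has_vector_derivative_partial_at:
  assumes "hpoly j f"
  shows "((\<lambda>s. f (x + s *\<^sub>R axis i 1)) has_vector_derivative partial i f (x + t *\<^sub>R axis i 1)) (at t)"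
proof -
  have shift: "((\<lambda>s. s - t) has_vector_derivative 1) (at t)"
    by (auto intro!: derivative_eq_intros)
  have "((\<lambda>s. f ((x + t *\<^sub>R axis i 1) + s *\<^sub>R axis i 1)) has_vector_derivative partial i f (x + t *\<^sub>R axis i 1)) (at (t - t))"
    using has_vector_derivative_partial[OF assms] by simp
  from vector_diff_chain_at[OF shift this] show ?thesis
    by (simp add: o_def algebra_simps)
qed

lemma partial_const [simp]: "partial i (\<lambda>x. c) = (\<lambda>x. 0)"
  by (rule partialI) simp

lemma partial_hpoly_0: "hpoly 0 f \<Longrightarrow> partial i f = (\<lambda>x. 0)"
  using hpoly_0_const[of f] by auto

lemma partial_add:
  assumes "hpoly j f" "hpoly l g"
  shows "partial i (\<lambda>x. f x + g x) = (\<lambda>x. partial i f x + partial i g x)"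
  by (rule partialI) (intro has_vector_derivative_add has_vector_derivative_partial[OF assms(1)]
    has_vector_derivative_partial[OF assms(2)])

lemma partial_sum:
  assumes "\<And>a. a \<in> A \<Longrightarrow> hpoly j (f a)"
  shows "partial i (\<lambda>x. \<Sum>a\<in>A. f a x) = (\<lambda>x. \<Sum>a\<in>A. partial i (f a) x)"
  by (rule partialI) (intro has_vector_derivative_sum has_vector_derivative_partial[OF assms])

lemma partial_cnj:
  assumes "hpoly j f"
  shows "partial i (\<lambda>x. cnj (f x)) = (\<lambda>x. cnj (partial i f x))"
  by (rule partialI) (intro has_vector_derivative_cnj has_vector_derivative_partial[OF assms])

lemma partial_mult:
  assumes "hpoly j f" "hpoly l g"
  shows "partial i (\<lambda>x. f x * g x) = (\<lambda>x. f x * partial i g x + partial i f x * g x)"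
proof (rule partialI)
  fix x
  show "((\<lambda>s. f (x + s *\<^sub>R axis i 1) * g (x + s *\<^sub>R axis i 1)) has_vector_derivative
      f x * partial i g x + partial i f x * g x) (at 0)"
    using has_vector_derivative_mult[OF assms[THEN has_vector_derivative_partial], of x i x i] by simp
qed

lemma partial_cmult: "hpoly j f \<Longrightarrow> partial i (\<lambda>x. c * f x) = (\<lambda>x. c * partial i f x)"
  using partial_mult[OF hpoly_const, of j f i c] by simp

lemma partial_coord: "partial i (\<lambda>x. of_real (x $ k)) = (\<lambda>x. if i = k then 1 else 0)"
  by (rule partialI) (rule has_vector_derivative_coord)

lemma partial_coord_mult:
  "hpoly j f \<Longrightarrow> partial i (\<lambda>x. of_real (x $ k) * f x)
     = (\<lambda>x. of_real (x $ k) * partial i f x + (if i = k then f x else 0))"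
  by (auto simp: partial_mult[OF hpoly_coord] partial_coord fun_eq_iff)

lemma partial_inner: "partial i (\<lambda>u::real^'n::finite. of_real (e \<bullet> u)) = (\<lambda>u. of_real (e $ i))"
  unfolding of_real_inner_eq_sum
  by (simp add: partial_sum[OF hpoly_cmult[OF hpoly_coord]] partial_cmult[OF hpoly_coord] partial_coord
      if_distrib cong: if_cong)

lemma partial_power:
  assumes "hpoly j f"
  shows "partial i (\<lambda>x. f x ^ n) = (\<lambda>x. of_nat n * f x ^ (n - 1) * partial i f x)"
proof (induction n)
  case (Suc n)
  show ?case
    unfolding power_Suc partial_mult[OF assms hpoly_power[OF assms]] Suc
    by (cases n) (simp_all add: fun_eq_iff algebra_simps)
qed auto

lemma partial_norm_sq: "partial i (\<lambda>x::real^'n::finite. (of_real (norm x))\<^sup>2) = (\<lambda>x. 2 * of_real (x $ i))"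
  unfolding of_real_norm_sq_eq_sum
  by (simp add: partial_sum[OF hpoly_coord_mult[OF hpoly_coord]] partial_coord_mult[OF hpoly_coord]
    partial_coord
      if_distrib sum.distrib cong: if_cong)

lemma hpoly_partial: "hpoly j f \<Longrightarrow> hpoly (j - 1) (partial i f)"
proof (induction rule: hpoly.induct)
  case (hpoly_add j f g)
  then show ?case by (simp add: partial_add hpoly.hpoly_add)
next
  case (hpoly_coord_mult j f k)
  have "hpoly j (\<lambda>x. if i = k then f x else 0)"
    using hpoly_coord_mult.hyps by (cases "i = k") (auto intro: hpoly.intros)
  moreover have "hpoly j (\<lambda>x. of_real (x $ k) * partial i f x)"
  proof (cases j)
    case 0
    then show ?thesis using partial_hpoly_0[of f i] hpoly_coord_mult.hyps by (auto intro: hpoly.intros)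
  next
    case (Suc j')
    then show ?thesis using hpoly.hpoly_coord_mult[OF hpoly_coord_mult.IH, of k] by simp
  qed
  ultimately show ?case
    using hpoly_add by (simp add: partial_coord_mult[OF hpoly_coord_mult.hyps])
qed (auto intro: hpoly.intros)

lemma partial_partial_coord_mult:
  assumes hpoly_f: "hpoly j f"
  shows "partial i (partial k (\<lambda>x. of_real (x $ m) * f x))
      = (\<lambda>x. of_real (x $ m) * partial i (partial k f) x
     + (if i = m then partial k f x else 0) + (if k = m then partial i f x else 0))"
proof -
  have "hpoly j (\<lambda>x. if k = m then f x else 0)"
    using hpoly_f by (cases "k = m") (auto intro: hpoly.intros)
  moreover have "partial i (\<lambda>x. if k = m then f x else 0) = (\<lambda>x. if k = m then partial i f x else 0)"
    by (cases "k = m") auto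
  ultimately show ?thesis
    unfolding partial_coord_mult[OF hpoly_f]
    by (simp add: partial_add[OF hpoly_coord_mult[OF hpoly_partial[OF hpoly_f]]]
      partial_coord_mult[OF hpoly_partial[OF hpoly_f]])
qed

lemma partial_commute: "hpoly j f \<Longrightarrow> partial i (partial k f) = partial k (partial i f)"
proof (induction rule: hpoly.induct)
  case (hpoly_add j f g)
  then show ?case by (simp add: partial_add[of j f j g] partial_add[OF hpoly_partial hpoly_partial])
next
  case (hpoly_coord_mult j f m)
  then show ?case by (auto simp: partial_partial_coord_mult fun_eq_iff)
qed auto

lemma hpoly_euler: "hpoly j f \<Longrightarrow> (\<Sum>i\<in>UNIV. of_real (x $ i) * partial i f x) = of_nat j * f x"
proof (induction rule: hpoly.induct)
  case (hpoly_add j f g)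
  then show ?case by (simp add: partial_add sum.distrib algebra_simps)
next
  case (hpoly_coord_mult j f k)
  have "(\<Sum>i\<in>UNIV. of_real (x $ i) * partial i (\<lambda>x. of_real (x $ k) * f x) x)
      = of_real (x $ k) * (\<Sum>i\<in>UNIV. of_real (x $ i) * partial i f x) + (\<Sum>i\<in>UNIV. if i = k then of_real (x $ i) * f x else 0)"
    unfolding partial_coord_mult[OF hpoly_coord_mult.hyps] sum_distrib_left sum.distrib[symmetric]
    by (intro sum.cong) (auto simp: algebra_simps)
  then show ?case using hpoly_coord_mult.IH by (simp add: algebra_simps)
qed auto

subsection \<open>The Laplacian\<close>

lemma laplacian_hpoly:
  assumes "hpoly j f"
  shows "laplacian f = (\<lambda>x. \<Sum>i\<in>UNIV. partial i (partial i f) x)"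
proof -
  have "vector_derivative (\<lambda>s. f (x + s *\<^sub>R axis i 1)) (at t) = partial i f (x + t *\<^sub>R axis i 1)" for x i t
    by (rule vector_derivative_at[OF has_vector_derivative_partial_at[OF assms]])
  then show ?thesis by (simp add: fun_eq_iff laplacian_def partial2_def partial_def[of _ "partial _ f"])
qed

lemma hpoly_laplacian: "hpoly j f \<Longrightarrow> hpoly (j - 2) (laplacian f)"
  using hpoly_partial[OF hpoly_partial, of j f]
  by (auto simp: laplacian_hpoly numeral_2_eq_2 intro!: hpoly_sum)

lemma laplacian_degree_less_2: "hpoly j f \<Longrightarrow> j < 2 \<Longrightarrow> laplacian f = (\<lambda>x. 0)"
  using hpoly_partial[of j f] by (simp add: laplacian_hpoly partial_hpoly_0)

lemma laplacian_cmult: "hpoly j f \<Longrightarrow> laplacian (\<lambda>x. c * f x) = (\<lambda>x. c * laplacian f x)"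
  by (simp add: laplacian_hpoly[OF hpoly_cmult] laplacian_hpoly partial_cmult
    partial_cmult[OF hpoly_partial] sum_distrib_left)

lemma laplacian_diff:
  assumes "hpoly j f" "hpoly j g"
  shows "laplacian (\<lambda>x. f x - g x) = (\<lambda>x. laplacian f x - laplacian g x)"
proof -
  have "laplacian (\<lambda>x. f x + (- 1) * g x) = (\<lambda>x. laplacian f x + laplacian (\<lambda>x. (- 1) * g x) x)"
    using hpoly_cmult[OF assms(2), of "- 1"] assms(1)
    by (simp only: laplacian_hpoly[OF hpoly_add] laplacian_hpoly partial_add[of j _ j]
      partial_add[OF hpoly_partial hpoly_partial] sum.distrib)
  then show ?thesis by (simp only: laplacian_cmult[OF assms(2)]) simp
qed

lemma laplacian_sum:
  assumes "\<And>a. a \<in> A \<Longrightarrow> hpoly j (f a)"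
  shows "laplacian (\<lambda>x. \<Sum>a\<in>A. f a x) = (\<lambda>x. \<Sum>a\<in>A. laplacian (f a) x)"
proof -
  have "partial i (partial i (\<lambda>x. \<Sum>a\<in>A. f a x)) = (\<lambda>x. \<Sum>a\<in>A. partial i (partial i (f a)) x)" for i
    by (simp add: partial_sum[OF assms] partial_sum[OF hpoly_partial[OF assms]])
  then show ?thesis
    by (simp add: laplacian_hpoly[OF hpoly_sum[OF assms]] laplacian_hpoly[OF assms] sum.swap[of _ UNIV]
      fun_eq_iff)
qed

lemma laplacian_cnj: "hpoly j f \<Longrightarrow> laplacian (\<lambda>x. cnj (f x)) = (\<lambda>x. cnj (laplacian f x))"
  by (simp add: laplacian_hpoly[OF hpoly_cnj] laplacian_hpoly partial_cnj partial_cnj[OF hpoly_partial])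

lemma laplacian_partial:
  assumes hpoly_f: "hpoly j f"
  shows "laplacian (partial i f) = partial i (laplacian f)"
  by (simp add: laplacian_hpoly[OF hpoly_partial[OF hpoly_f]] laplacian_hpoly[OF hpoly_f]
    partial_sum[OF hpoly_partial[OF hpoly_partial[OF hpoly_f]]]
      partial_commute[OF hpoly_f, of _ i] partial_commute[OF hpoly_partial[OF hpoly_f], of _ i])

lemma laplacian_mult:
  assumes hpoly_f: "hpoly j f" and hpoly_g: "hpoly l g"
  shows "laplacian (\<lambda>x. f x * g x)
      = (\<lambda>x. f x * laplacian g x + 2 * (\<Sum>i\<in>UNIV. partial i f x * partial i g x) + laplacian f x * g x)"
proof -
  have "partial i (partial i (\<lambda>x. f x * g x))
      = (\<lambda>x. f x * partial i (partial i g) x + 2 * (partial i f x * partial i g x) + partial i (partial i f) x * g x)" for i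
    unfolding partial_mult[OF hpoly_f hpoly_g]
      partial_add[OF hpoly_mult[OF hpoly_f hpoly_partial[OF hpoly_g, of i]] hpoly_mult[OF hpoly_partial[OF hpoly_f, of i] hpoly_g]]
      partial_mult[OF hpoly_f hpoly_partial[OF hpoly_g]] partial_mult[OF hpoly_partial[OF hpoly_f] hpoly_g]
    by (simp add: fun_eq_iff)
  then show ?thesis
    by (simp add: laplacian_hpoly[OF hpoly_mult[OF hpoly_f hpoly_g]] laplacian_hpoly[OF hpoly_f]
      laplacian_hpoly[OF hpoly_g]
        sum.distrib sum_distrib_left sum_distrib_right)
qed

lemma laplacian_norm_sq_mult:
  fixes q :: "real^'n::finite \<Rightarrow> complex"
  assumes hpoly_q: "hpoly l q"
  shows "laplacian (\<lambda>x. (of_real (norm x))\<^sup>2 * q x)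
           = (\<lambda>x. (of_real (norm x))\<^sup>2 * laplacian q x + of_real (4 * real l + 2 * real CARD('n)) * q x)"
proof
  fix x :: "real^'n"
  have "laplacian (\<lambda>x::real^'n. (of_real (norm x))\<^sup>2) = (\<lambda>x. of_real (2 * real CARD('n)))"
    by (simp add: laplacian_hpoly[OF hpoly_norm_sq] partial_norm_sq partial_cmult[OF hpoly_coord]
      partial_coord mult.commute)
  moreover have "2 * (\<Sum>i\<in>UNIV. 2 * of_real (x $ i) * partial i q x) = of_real (4 * real l) * q x"
    using hpoly_euler[OF hpoly_q, of x] by (simp add: sum_distrib_left[symmetric] mult.assoc)
  ultimately show "laplacian (\<lambda>x. (of_real (norm x))\<^sup>2 * q x) x
      = (of_real (norm x))\<^sup>2 * laplacian q x + of_real (4 * real l + 2 * real CARD('n)) * q x"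
    by (simp only: laplacian_mult[OF hpoly_norm_sq hpoly_q] partial_norm_sq of_real_add distrib_right
      add.assoc)
qed

lemma laplacian_norm_power_mult:
  fixes p :: "real^'n::finite \<Rightarrow> complex"
  assumes hpoly_p: "hpoly j p" "laplacian p = (\<lambda>x. 0)"
  shows "laplacian (\<lambda>x. of_real (norm x) ^ (2 * m) * p x)
     = (\<lambda>x. of_real (2 * real m * (2 * real m + 2 * real j + real CARD('n) - 2)) * (of_real (norm x) ^ (2 * (m - 1)) * p x))"
proof (induction m)
  case 0
  then show ?case using hpoly_p by simp
next
  case (Suc m)
  let ?c = "\<lambda>m. 2 * real m * (2 * real m + 2 * real j + real CARD('n) - 2)"
  let ?q = "\<lambda>x. of_real (norm x) ^ (2 * m) * p x"
  have "(\<lambda>x. of_real (norm x) ^ (2 * Suc m) * p x) = (\<lambda>x. (of_real (norm x))\<^sup>2 * ?q x)"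
    by (simp add: power2_eq_square mult.assoc)
  then have "laplacian (\<lambda>x. of_real (norm x) ^ (2 * Suc m) * p x)
      = (\<lambda>x. (of_real (norm x))\<^sup>2 * laplacian ?q x + of_real (4 * real (2 * m + j) + 2 * real CARD('n)) * ?q x)"
    by (simp only: laplacian_norm_sq_mult[OF hpoly_norm_power_mult[OF hpoly_p(1)]])
  moreover have "(of_real (norm x))\<^sup>2 * laplacian ?q x = of_real (?c m) * ?q x" for x
    unfolding Suc.IH by (cases m) (simp_all add: power_add power2_eq_square mult_ac)
  moreover have "of_real (?c m) * z + of_real (4 * real (2 * m + j) + 2 * real CARD('n)) * z
      = of_real (?c (Suc m)) * z" for z :: complex
    unfolding distrib_right[symmetric] of_real_add[symmetric] by (simp add: algebra_simps)
  ultimately show ?case by simp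
qed

lemma finite_multi_index: "finite {\<beta> :: 'n::finite \<Rightarrow> nat. sum \<beta> UNIV = j}"
proof (rule finite_subset)
  show "{\<beta> :: 'n \<Rightarrow> nat. sum \<beta> UNIV = j} \<subseteq> PiE UNIV (\<lambda>_. {..j})"
    by (auto simp: PiE_def intro: member_le_sum)
  show "finite (PiE (UNIV :: 'n set) (\<lambda>_. {..j}))" by (intro finite_PiE) auto
qed

lemma sum_fun_upd_Suc: "sum (\<beta>(i := Suc (\<beta> i))) UNIV = Suc (sum \<beta> (UNIV :: 'n::finite set))"
  by (simp add: sum.remove[of UNIV i])

lemma monom_fun_upd:
  "monom (\<beta>(i := k)) x = of_real ((x $ i) ^ k) * (\<Prod>l\<in>UNIV - {i}. of_real ((x $ l) ^ \<beta> l))"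
  unfolding monom_def by (subst prod.remove[of UNIV i]) (auto intro!: prod.cong)

lemma monom_remove:
  "monom \<beta> x = of_real ((x $ i) ^ \<beta> i) * (\<Prod>l\<in>UNIV - {i}. of_real ((x $ l) ^ \<beta> l))"
  using monom_fun_upd[of \<beta> i "\<beta> i" x] by simp

lemma coord_mult_monom: "of_real (x $ i) * monom \<beta> x = monom (\<beta>(i := Suc (\<beta> i))) x"
  unfolding monom_fun_upd monom_remove[of \<beta> x i] by simp

lemma partial_monom: "partial i (monom \<beta>) = (\<lambda>x. of_nat (\<beta> i) * monom (\<beta>(i := \<beta> i - 1)) x)"
proof (rule partialI)
  fix x :: "real^'a"
  let ?c = "\<Prod>l\<in>UNIV - {i}. complex_of_real ((x $ l) ^ \<beta> l)"
  have "(\<Prod>l\<in>UNIV - {i}. complex_of_real (((x + s *\<^sub>R axis i 1) $ l) ^ \<beta> l)) = ?c" for s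
    by (intro prod.cong) (auto simp: axis_def)
  then have line: "monom \<beta> (x + s *\<^sub>R axis i 1) = of_real ((x $ i + s) ^ \<beta> i) * ?c" for s
    using monom_remove[of \<beta> "x + s *\<^sub>R axis i 1" i] by (simp only:) (simp add: axis_def)
  have "((\<lambda>s. (x $ i + s) ^ \<beta> i) has_real_derivative (of_nat (\<beta> i) * (x $ i) ^ (\<beta> i - 1))) (at 0)"
    by (auto intro!: derivative_eq_intros)
  from has_vector_derivative_mult_left[OF has_vector_derivative_of_real[OF this], of ?c]
  show "((\<lambda>s. monom \<beta> (x + s *\<^sub>R axis i 1)) has_vector_derivative of_nat (\<beta> i) * monom (\<beta>(i := \<beta> i - 1)) x) (at 0)"
    unfolding line monom_fun_upd by (simp add: mult.assoc)
qed

lemma hpoly_monom: "sum \<beta> UNIV = j \<Longrightarrow> hpoly j (monom \<beta>)"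
proof (induction j arbitrary: \<beta>)
  case 0
  then have "monom \<beta> = (\<lambda>x. 1)" by (simp add: monom_def fun_eq_iff)
  then show ?case by (simp add: hpoly_const)
next
  case (Suc j)
  then obtain i where \<beta>_pos: "\<beta> i > 0" by (metis gr0I nat.simps(3) sum.neutral)
  define \<gamma> where "\<gamma> = \<beta>(i := \<beta> i - 1)"
  have \<beta>: "\<beta> = \<gamma>(i := Suc (\<gamma> i))" using \<beta>_pos by (auto simp: \<gamma>_def)
  have "sum \<gamma> UNIV = j" using Suc.prems sum_fun_upd_Suc[of \<gamma> i] \<beta> by simp
  from hpoly_coord_mult[OF Suc.IH[OF this], of i] show ?case
    by (subst \<beta>) (simp add: coord_mult_monom)
qed

lemma hpoly_hom_poly: "hpoly j (hom_poly j c)"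
  unfolding hom_poly_def[abs_def] by (intro hpoly_sum hpoly_cmult hpoly_monom) auto

lemma cmult_monom_eq_hom_poly:
  assumes "sum \<beta> UNIV = j"
  shows "(\<lambda>x. c * monom \<beta> x) = hom_poly j (\<lambda>\<gamma>. if \<gamma> = \<beta> then c else 0)"
proof
  fix x
  have "hom_poly j (\<lambda>\<gamma>. if \<gamma> = \<beta> then c else 0) x
      = (\<Sum>\<gamma>\<in>{\<gamma>. sum \<gamma> UNIV = j}. if \<gamma> = \<beta> then c * monom \<gamma> x else 0)"
    unfolding hom_poly_def by (intro sum.cong) auto
  also have "\<dots> = c * monom \<beta> x"
    using assms by (simp add: sum.delta finite_multi_index)
  finally show "c * monom \<beta> x = hom_poly j (\<lambda>\<gamma>. if \<gamma> = \<beta> then c else 0) x" ..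
qed

lemma sum_eq_hom_poly:
  assumes "\<And>a. a \<in> A \<Longrightarrow> \<exists>c. f a = hom_poly j c"
  shows "\<exists>c. (\<lambda>x. \<Sum>a\<in>A. f a x) = hom_poly j c"
proof -
  obtain c where "\<And>a. a \<in> A \<Longrightarrow> f a = hom_poly j (c a)" using assms by metis
  then have "(\<lambda>x. \<Sum>a\<in>A. f a x) = (\<lambda>x. \<Sum>a\<in>A. hom_poly j (c a) x)" by simp
  also have "\<dots> = hom_poly j (\<lambda>\<beta>. \<Sum>a\<in>A. c a \<beta>)"
    unfolding hom_poly_def sum_distrib_right by (rule ext) (rule sum.swap)
  finally show ?thesis by blast
qed

lemma hpoly_imp_hom_poly: "hpoly j f \<Longrightarrow> \<exists>c. f = hom_poly j c"
proof (induction rule: hpoly.induct)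
  case (hpoly_zero j)
  show ?case by (intro exI[of _ "\<lambda>_. 0"]) (simp add: hom_poly_def fun_eq_iff)
next
  case (hpoly_const c)
  show ?case using cmult_monom_eq_hom_poly[of "\<lambda>_. 0" 0 c] by (auto simp: monom_def)
next
  case (hpoly_add j f g)
  then obtain c d where "f = hom_poly j c" "g = hom_poly j d" by auto
  then show ?case
    by (intro exI[of _ "\<lambda>\<beta>. c \<beta> + d \<beta>"]) (simp add: hom_poly_def fun_eq_iff sum.distrib distrib_right)
next
  case (hpoly_coord_mult j f i)
  then obtain c where f_eq: "f = hom_poly j c" by auto
  have "\<exists>d. (\<lambda>x. \<Sum>\<beta>\<in>{\<beta>. sum \<beta> UNIV = j}. c \<beta> * monom (\<beta>(i := Suc (\<beta> i))) x) = hom_poly (Suc j) d"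
  proof (rule sum_eq_hom_poly)
    fix \<beta> :: "'a \<Rightarrow> nat" assume "\<beta> \<in> {\<beta>. sum \<beta> UNIV = j}"
    then have "sum (\<beta>(i := Suc (\<beta> i))) UNIV = Suc j" by (simp only: sum_fun_upd_Suc mem_Collect_eq)
    then show "\<exists>d. (\<lambda>x. c \<beta> * monom (\<beta>(i := Suc (\<beta> i))) x) = hom_poly (Suc j) d"
      using cmult_monom_eq_hom_poly by blast
  qed
  moreover have "of_real (x $ i) * f x = (\<Sum>\<beta>\<in>{\<beta>. sum \<beta> UNIV = j}. c \<beta> * monom (\<beta>(i := Suc (\<beta> i))) x)" for x
    by (simp add: f_eq hom_poly_def sum_distrib_left coord_mult_monom[symmetric] mult.left_commute)
  ultimately show ?case by (simp only:)
qed

lemma harm_iff: "h \<in> harm j \<longleftrightarrow> hpoly j h \<and> laplacian h = (\<lambda>x. 0)"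
proof -
  have "(\<exists>c. h = hom_poly j c) \<longleftrightarrow> hpoly j h"
    using hpoly_imp_hom_poly hpoly_hom_poly by blast
  then show ?thesis by (auto simp: harm_def)
qed

lemma hpoly_monom_induct [consumes 1, case_names zero monom add]:
  assumes "hpoly j f" and zero: "P (\<lambda>x. 0)"
    and mon: "\<And>\<beta> c. sum \<beta> UNIV = j \<Longrightarrow> P (\<lambda>x. c * monom \<beta> x)"
    and add: "\<And>f g. hpoly j f \<Longrightarrow> hpoly j g \<Longrightarrow> P f \<Longrightarrow> P g \<Longrightarrow> P (\<lambda>x. f x + g x)"
  shows "P f"
proof -
  obtain c where f_eq: "f = hom_poly j c" using hpoly_imp_hom_poly[OF assms(1)] by auto
  have "hpoly j (\<lambda>x. \<Sum>\<beta>\<in>A. c \<beta> * monom \<beta> x) \<and> P (\<lambda>x. \<Sum>\<beta>\<in>A. c \<beta> * monom \<beta> x)"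
    if "finite A" "A \<subseteq> {\<beta>. sum \<beta> UNIV = j}" for A
    using that
  proof (induction)
    case (insert \<beta> A)
    then have "hpoly j (\<lambda>x. c \<beta> * monom \<beta> x)" "P (\<lambda>x. c \<beta> * monom \<beta> x)"
      by (auto intro: mon hpoly_cmult hpoly_monom)
    then show ?case using insert by (auto intro: add hpoly_add)
  qed (auto intro: zero hpoly_zero)
  from this[OF finite_multi_index subset_refl] show ?thesis
    by (simp add: f_eq hom_poly_def[abs_def])
qed

section \<open>Integrals of polynomials over the sphere\<close>

abbreviation sphint :: "(real^'n::finite \<Rightarrow> 'b::{banach, second_countable_topology}) \<Rightarrow> 'b" where
  "sphint f \<equiv> integral\<^sup>L sphere_measure f"

lemma integrable_sphere_continuous:
  fixes f :: "real^'n::finite \<Rightarrow> 'b::{banach, second_countable_topology}"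
  assumes cont_f: "continuous_on UNIV f"
  shows "integrable sphere_measure f"
proof -
  have "bounded (f ` sphere 0 1)"
    by (intro compact_imp_bounded compact_continuous_image continuous_on_subset[OF cont_f]) auto
  then obtain B where f_bound: "\<And>x. x \<in> sphere 0 1 \<Longrightarrow> norm (f x) \<le> B"
    unfolding bounded_iff by blast
  show ?thesis
  proof (rule sph.integrable_const_bound)
    show "AE x in sphere_measure. norm (f x) \<le> B" using f_bound by (intro AE_I2) auto
    show "f \<in> borel_measurable sphere_measure"
      by (intro borel_measurable_sphere_measure borel_measurable_continuous_onI cont_f)
  qed
qed

lemma integrable_sphere_hpoly: "hpoly j f \<Longrightarrow> integrable sphere_measure f"
  by (intro integrable_sphere_continuous continuous_on_hpoly)



definition gauss_radial :: "nat \<Rightarrow> nat \<Rightarrow> real" where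
  "gauss_radial d l = (1 / sqrt (2 * pi)) ^ d
      * (Gamma ((real l + real d) / 2) / (2 * (1 / 2) powr ((real l + real d) / 2)))"

lemma gauss_radial_pos: "d > 0 \<Longrightarrow> gauss_radial d l > 0"
  by (auto simp: gauss_radial_def intro!: mult_pos_pos divide_pos_pos Gamma_real_pos)

lemma gauss_radial_add_2:
  assumes "d > 0"
  shows "gauss_radial d (l + 2) = (real l + real d) * gauss_radial d l"
proof -
  define e where "e = (real l + real d) / 2"
  have "Gamma (e + 1) = e * Gamma e" using assms by (intro Gamma_plus1_pos) (simp add: e_def)
  moreover have "(1 / 2 :: real) powr (e + 1) = (1 / 2) powr e / 2" by (simp add: powr_add)
  moreover have "(real (l + 2) + real d) / 2 = e + 1" by (simp add: e_def field_simps)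
  ultimately show ?thesis
    unfolding gauss_radial_def e_def[symmetric] by (simp only:) (simp add: e_def)
qed

lemma has_bochner_integral_radial_gauss:
  assumes "d > 0"
  shows "has_bochner_integral (radial_measure (d - 1)) (\<lambda>r. (1 / sqrt (2 * pi)) ^ d * (r ^ l * exp (- r\<^sup>2 / 2))) (gauss_radial d l)"
proof -
  have "has_bochner_integral (radial_measure (d - 1)) (\<lambda>r. r powr real l * exp (- (1 / 2) * r powr 2))
     (Gamma ((real l + real (d - 1) + 1) / 2) / (2 * (1 / 2) powr ((real l + real (d - 1) + 1) / 2)))"
    by (rule has_bochner_integral_radial_powr_exp) auto
  moreover have "real l + real (d - 1) + 1 = real l + real d" using assms by simp
  moreover have "AE r in radial_measure (d - 1). r powr real l * exp (- (1 / 2) * r powr 2)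
      = r ^ l * exp (- r\<^sup>2 / 2)"
    using AE_radial_measure_pos by eventually_elim (simp add: powr_realpow)
  ultimately have "has_bochner_integral (radial_measure (d - 1)) (\<lambda>r. r ^ l * exp (- r\<^sup>2 / 2))
     (Gamma ((real l + real d) / 2) / (2 * (1 / 2) powr ((real l + real d) / 2)))"
    by (subst has_bochner_integral_cong_AE[where g="\<lambda>r. r powr real l * exp (- (1 / 2) * r powr 2)"]) auto
  then show ?thesis
    unfolding gauss_radial_def by (rule has_bochner_integral_mult_right)
qed

lemma
  fixes q :: "real^'n::finite \<Rightarrow> complex"
  assumes hpoly_q: "hpoly l q"
  shows integrable_gauss_hpoly: "integrable lborel (\<lambda>x. gauss x *\<^sub>R q x)"
    and integral_gauss_hpoly: "(\<integral>x. gauss x *\<^sub>R q x \<partial>lborel) = gauss_radial CARD('n) l *\<^sub>R sphint q"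
proof -
  define h where "h r = (1 / sqrt (2 * pi)) ^ CARD('n) * (r ^ l * exp (- r\<^sup>2 / 2))" for r :: real
  have polar: "gauss x *\<^sub>R q x = h (norm x) *\<^sub>R q (dir x)" for x
    using hpoly_scaleR[OF hpoly_q, of "norm x" "dir x", unfolded norm_scaleR_dir]
    by (simp add: gauss_eq h_def scaleR_conv_of_real)
  have radial: "has_bochner_integral (radial_measure (CARD('n) - 1)) h (gauss_radial CARD('n) l)"
    unfolding h_def by (rule has_bochner_integral_radial_gauss) simp
  note integrable_h = integrable.intros[OF radial] and q_integrable = integrable_sphere_hpoly[OF hpoly_q]
  show "integrable lborel (\<lambda>x. gauss x *\<^sub>R q x)"
    unfolding polar by (rule integrable_polar_product[OF integrable_h q_integrable])
  show "(\<integral>x. gauss x *\<^sub>R q x \<partial>lborel) = gauss_radial CARD('n) l *\<^sub>R sphint q"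
    unfolding polar integral_polar_product[OF integrable_h q_integrable] has_bochner_integral_integral_eq[OF radial] ..
qed

lemma inj_axis: "inj (\<lambda>k. axis k (1::real))"
  by (auto simp: inj_def axis_eq_axis)

lemma prod_Basis_vec: "(\<Prod>b\<in>Basis. f b) = (\<Prod>k\<in>UNIV. f (axis k 1 :: real^'n::finite))"
proof -
  have Basis: "(Basis :: (real^'n) set) = range (\<lambda>k. axis k 1)" by (auto simp: Basis_vec_def)
  show ?thesis unfolding Basis by (simp add: prod.reindex[OF inj_axis])
qed

lemma integral_lborel_prod_vec:
  fixes g :: "'n::finite \<Rightarrow> real \<Rightarrow> 'b::{real_normed_field,banach,second_countable_topology}"
  assumes "\<And>k. integrable lborel (g k)"
  shows "(\<integral>x. (\<Prod>k\<in>UNIV. g k (x $ k)) \<partial>lborel) = (\<Prod>k\<in>UNIV. integral\<^sup>L lborel (g k))"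
proof -
  define h where "h b = g (inv (\<lambda>k. axis k 1) b)" for b :: "real^'n"
  have "h (axis k 1) = g k" for k unfolding h_def by (simp add: inv_f_f[OF inj_axis])
  then show ?thesis
    using integral_lborel_prod_Basis[of h] assms by (simp add: prod_Basis_vec inner_axis h_def)
qed

lemma integral_gauss_monom:
  "(\<integral>x. gauss x *\<^sub>R monom \<beta> x \<partial>lborel) = complex_of_real (\<Prod>k\<in>UNIV. gauss_moment (\<beta> k))"
proof -
  have factor: "gauss x *\<^sub>R monom \<beta> x
      = (\<Prod>k\<in>UNIV. complex_of_real (std_normal_density (x $ k) * (x $ k) ^ \<beta> k))" for x
    by (simp add: gauss_def prod_Basis_vec inner_axis monom_def scaleR_conv_of_real prod.distrib)
  have integrable_moment: "integrable lborel (\<lambda>t. complex_of_real (std_normal_density t * t ^ k))" for k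
    using integrable_std_normal_moment[of k] by (rule integrable_of_real)
  have "(\<integral>t. complex_of_real (std_normal_density t * t ^ k) \<partial>lborel) = complex_of_real (gauss_moment k)"
    for k
    unfolding gauss_moment_def by (rule integral_complex_of_real)
  then show ?thesis
    unfolding factor by (simp only: integral_lborel_prod_vec[OF integrable_moment] of_real_prod)
qed

lemma integral_gauss_cmult:
  "(\<integral>x. gauss x *\<^sub>R (c * f x) \<partial>lborel) = c * (\<integral>x. gauss x *\<^sub>R f x \<partial>lborel)" for c :: complex
  by (simp only: mult_scaleR_right[symmetric] integral_mult_right_zero)

lemma gauss_integration_by_parts_monom:
  "(\<integral>x. gauss x *\<^sub>R partial i (monom \<beta>) x \<partial>lborel)
      = (\<integral>x. gauss x *\<^sub>R (of_real (x $ i) * monom \<beta> x) \<partial>lborel)"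
proof -
  have prod_upd: "(\<Prod>k\<in>UNIV. gauss_moment ((\<beta>(i := v)) k))
      = gauss_moment v * (\<Prod>k\<in>UNIV - {i}. gauss_moment (\<beta> k))" for v
    by (subst prod.remove[of UNIV i]) (auto intro!: prod.cong)
  have moment: "real m * gauss_moment (m - 1) = gauss_moment (Suc m)" for m
    using gauss_moment_add_2[of "m - 1"] by (cases m) (simp_all add: gauss_moment_odd)
  have "(\<integral>x. gauss x *\<^sub>R partial i (monom \<beta>) x \<partial>lborel)
      = complex_of_real (real (\<beta> i) * gauss_moment (\<beta> i - 1) * (\<Prod>k\<in>UNIV - {i}. gauss_moment (\<beta> k)))"
    by (simp only: partial_monom integral_gauss_cmult integral_gauss_monom prod_upd of_real_mult
      of_real_of_nat_eq mult.assoc)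
  also have "\<dots> = complex_of_real (\<Prod>k\<in>UNIV. gauss_moment ((\<beta>(i := Suc (\<beta> i))) k))"
    unfolding prod_upd moment ..
  also have "\<dots> = (\<integral>x. gauss x *\<^sub>R (of_real (x $ i) * monom \<beta> x) \<partial>lborel)"
    by (simp only: coord_mult_monom integral_gauss_monom)
  finally show ?thesis .
qed

lemma gauss_integration_by_parts:
  "hpoly j q \<Longrightarrow> (\<integral>x. gauss x *\<^sub>R partial i q x \<partial>lborel) = (\<integral>x. gauss x *\<^sub>R (of_real (x $ i) * q x) \<partial>lborel)"
proof (induction rule: hpoly_monom_induct)
  case (monom \<beta> c)
  then show ?case
    by (simp only: partial_cmult[OF hpoly_monom] mult.left_commute[of _ c] integral_gauss_cmult
      gauss_integration_by_parts_monom)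
next
  case (add f g)
  have "(\<integral>x. gauss x *\<^sub>R partial i (\<lambda>x. f x + g x) x \<partial>lborel)
      = (\<integral>x. gauss x *\<^sub>R partial i f x \<partial>lborel) + (\<integral>x. gauss x *\<^sub>R partial i g x \<partial>lborel)"
    unfolding partial_add[OF add(1,2)] scaleR_add_right
    by (intro Bochner_Integration.integral_add integrable_gauss_hpoly[OF hpoly_partial[OF add(1)]]
        integrable_gauss_hpoly[OF hpoly_partial[OF add(2)]])
  also have "\<dots> = (\<integral>x. gauss x *\<^sub>R (of_real (x $ i) * f x) \<partial>lborel)
      + (\<integral>x. gauss x *\<^sub>R (of_real (x $ i) * g x) \<partial>lborel)"
    by (simp only: add)
  also have "\<dots> = (\<integral>x. gauss x *\<^sub>R (of_real (x $ i) * (f x + g x)) \<partial>lborel)"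
    unfolding scaleR_add_right distrib_left
    by (intro Bochner_Integration.integral_add[symmetric]
      integrable_gauss_hpoly[OF hpoly_coord_mult[OF add(1)]]
        integrable_gauss_hpoly[OF hpoly_coord_mult[OF add(2)]])
  finally show ?case .
qed auto

lemma integral_gauss_laplacian:
  assumes hpoly_q: "hpoly l q"
  shows "(\<integral>x. gauss x *\<^sub>R laplacian q x \<partial>lborel) = of_nat l * (\<integral>x. gauss x *\<^sub>R q x \<partial>lborel)"
proof -
  have "(\<integral>x. gauss x *\<^sub>R laplacian q x \<partial>lborel)
      = (\<Sum>i\<in>UNIV. \<integral>x. gauss x *\<^sub>R partial i (partial i q) x \<partial>lborel)"
    unfolding laplacian_hpoly[OF hpoly_q] scaleR_sum_right
    by (intro Bochner_Integration.integral_sum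
      integrable_gauss_hpoly[OF hpoly_partial[OF hpoly_partial[OF hpoly_q]]])
  also have "\<dots> = (\<Sum>i\<in>UNIV. \<integral>x. gauss x *\<^sub>R (of_real (x $ i) * partial i q x) \<partial>lborel)"
    by (simp only: gauss_integration_by_parts[OF hpoly_partial[OF hpoly_q]])
  also have "\<dots> = (\<integral>x. gauss x *\<^sub>R (\<Sum>i\<in>UNIV. of_real (x $ i) * partial i q x) \<partial>lborel)"
    unfolding scaleR_sum_right
    by (intro Bochner_Integration.integral_sum[symmetric]
      integrable_gauss_hpoly[OF hpoly_coord_mult[OF hpoly_partial[OF hpoly_q]]])
  also have "\<dots> = of_nat l * (\<integral>x. gauss x *\<^sub>R q x \<partial>lborel)"
    by (simp only: hpoly_euler[OF hpoly_q] integral_gauss_cmult)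
  finally show ?thesis .
qed

lemma sphint_laplacian:
  fixes q :: "real^'n::finite \<Rightarrow> complex"
  assumes hpoly_q: "hpoly l q"
  shows "sphint (laplacian q) = of_real (real l * (real l + real CARD('n) - 2)) * sphint q"
proof (cases "l < 2")
  case True
  then have "laplacian q = (\<lambda>x. 0)" by (rule laplacian_degree_less_2[OF hpoly_q])
  moreover from this have "of_nat l * sphint q = 0"
    using integral_gauss_laplacian[OF hpoly_q] integral_gauss_hpoly[OF hpoly_q]
      gauss_radial_pos[of "CARD('n)" l] by simp
  ultimately show ?thesis by auto
next
  case False
  then obtain m where l_eq: "l = m + 2" by (metis add.commute le_Suc_ex not_less)
  have laplacian_q: "hpoly m (laplacian q)" using hpoly_laplacian[OF hpoly_q] l_eq by simp
  have "gauss_radial CARD('n) m *\<^sub>R sphint (laplacian q)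
      = of_nat l * gauss_radial CARD('n) (m + 2) *\<^sub>R sphint q"
    using integral_gauss_laplacian[OF hpoly_q]
    unfolding integral_gauss_hpoly[OF hpoly_q] integral_gauss_hpoly[OF laplacian_q] l_eq by simp
  also have "\<dots> = gauss_radial CARD('n) m *\<^sub>R (of_real (real l * (real m + real CARD('n))) * sphint q)"
    unfolding gauss_radial_add_2[OF zero_less_card_finite] by (simp add: scaleR_conv_of_real mult_ac)
  finally show ?thesis using gauss_radial_pos[of "CARD('n)" m] l_eq by simp
qed

lemma continuous_AE_zero_imp_zero:
  fixes f :: "'a::euclidean_space \<Rightarrow> 'b::real_normed_vector"
  assumes cont_f: "continuous_on UNIV f" and AE_zero: "AE x in lborel. f x = 0"
  shows "f x = 0"
proof -
  have "open {x. f x \<noteq> 0}"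
    using cont_f by (intro open_Collect_neq) auto
  moreover from this have "{x. f x \<noteq> 0} \<in> null_sets lborel"
    using AE_zero by (subst (asm) AE_iff_null) auto
  then have "negligible {x. f x \<noteq> 0}"
    using null_sets_completionI negligible_iff_null_sets by blast
  ultimately have "{x. f x \<noteq> 0} = {}" using open_not_negligible by blast
  then show ?thesis by blast
qed

lemma hpoly_eq_0_if_sphint_norm_sq_eq_0:
  fixes h :: "real^'n::finite \<Rightarrow> complex"
  assumes hpoly_h: "hpoly j h" and zero: "sphint (\<lambda>u. h u * cnj (h u)) = 0"
  shows "h = (\<lambda>x. 0)"
proof -
  have norm_sq: "gauss x *\<^sub>R (h x * cnj (h x)) = complex_of_real (gauss x * (cmod (h x))\<^sup>2)" for x
    by (simp only: scaleR_conv_of_real of_real_mult complex_norm_square)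
  note norm_sq_hpoly = hpoly_mult[OF hpoly_h hpoly_cnj[OF hpoly_h]]
  have integrable: "integrable lborel (\<lambda>x. gauss x * (cmod (h x))\<^sup>2)"
    using integrable_gauss_hpoly[OF norm_sq_hpoly] unfolding norm_sq
    by (rule complex_of_real_integrable_eq[THEN iffD1])
  have "integral\<^sup>L lborel (\<lambda>x. complex_of_real (gauss x * (cmod (h x))\<^sup>2)) = 0"
    using integral_gauss_hpoly[OF norm_sq_hpoly] zero unfolding norm_sq by simp
  then have "AE x in lborel. gauss x * (cmod (h x))\<^sup>2 = 0"
    using integral_nonneg_eq_0_iff_AE[OF integrable]
    by (simp only: integral_complex_of_real of_real_eq_0_iff) simp
  then have "AE x in lborel. h x = 0"
    by eventually_elim (use gauss_pos in \<open>auto simp: less_le\<close>)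
  then show ?thesis using continuous_AE_zero_imp_zero[OF continuous_on_hpoly[OF hpoly_h]] by blast
qed

section \<open>Harmonic polynomials and the Funk--Hecke formula\<close>

lemma harm_cmult: "p \<in> harm j \<Longrightarrow> (\<lambda>x. c * p x) \<in> harm j"
  by (auto simp: harm_iff hpoly_cmult laplacian_cmult)

lemma harm_diff: "p \<in> harm j \<Longrightarrow> q \<in> harm j \<Longrightarrow> (\<lambda>x. p x - q x) \<in> harm j"
  by (auto simp: harm_iff hpoly_diff laplacian_diff)

lemma harm_sum: "(\<And>a. a \<in> A \<Longrightarrow> p a \<in> harm j) \<Longrightarrow> (\<lambda>x. \<Sum>a\<in>A. p a x) \<in> harm j"
  by (simp add: harm_iff hpoly_sum laplacian_sum[of A j p])

lemma harm_cnj: "p \<in> harm j \<Longrightarrow> (\<lambda>x. cnj (p x)) \<in> harm j"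
  by (auto simp: harm_iff hpoly_cnj laplacian_cnj)

lemma harm_partial: "p \<in> harm j \<Longrightarrow> partial i p \<in> harm (j - 1)"
  using hpoly_partial[of j p i] by (auto simp: harm_iff laplacian_partial)

lemma harm_const: "(\<lambda>x. c) \<in> harm 0"
  by (simp add: harm_iff hpoly_const laplacian_degree_less_2[OF hpoly_const])

lemma harm_hpoly: "p \<in> harm j \<Longrightarrow> hpoly j p"
  by (simp add: harm_iff)

lemma harm_laplacian: "p \<in> harm j \<Longrightarrow> laplacian p = (\<lambda>x. 0)"
  by (simp add: harm_iff)

lemma continuous_on_harm: "p \<in> harm j \<Longrightarrow> continuous_on A p"
  by (rule continuous_on_hpoly[OF harm_hpoly])

lemma sphint_harm_mult_lower_degree:
  fixes p q :: "real^'n::finite \<Rightarrow> complex"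
  assumes dim: "CARD('n) \<ge> 2" and "p \<in> harm j" "hpoly l q" "l < j"
  shows "sphint (\<lambda>u. p u * q u) = 0"
  using assms(2-)
proof (induction l arbitrary: j p q rule: less_induct)
  case (less l)
  note hpoly_p = harm_hpoly[OF less.prems(1)] and hpoly_q = less.prems(2)
  have laplacian_term: "sphint (\<lambda>u. p u * laplacian q u) = 0"
  proof (cases "l < 2")
    case True
    then show ?thesis by (simp add: laplacian_degree_less_2[OF hpoly_q])
  next
    case False
    then show ?thesis using less.prems by (intro less.IH[of "l - 2" p j] hpoly_laplacian) auto
  qed
  have gradient_term: "sphint (\<lambda>u. partial i p u * partial i q u) = 0" for i
  proof (cases "l = 0")
    case True
    then show ?thesis using hpoly_q by (simp add: partial_hpoly_0)
  next
    case False
    then show ?thesis using less.prems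
      by (intro less.IH[of "l - 1" _ "j - 1"] harm_partial hpoly_partial) auto
  qed
  have gradient_integrable: "integrable sphere_measure (\<lambda>u. partial i p u * partial i q u)" for i
    by (rule integrable_sphere_hpoly[OF hpoly_mult[OF hpoly_partial[OF hpoly_p] hpoly_partial[OF hpoly_q]]])
  have "of_real (real (j + l) * (real (j + l) + real CARD('n) - 2)) * sphint (\<lambda>u. p u * q u)
      = sphint (\<lambda>u. p u * laplacian q u + 2 * (\<Sum>i\<in>UNIV. partial i p u * partial i q u))"
    unfolding sphint_laplacian[OF hpoly_mult[OF hpoly_p hpoly_q], symmetric] laplacian_mult[OF hpoly_p hpoly_q]
      harm_laplacian[OF less.prems(1)] by simp
  also have "\<dots> = sphint (\<lambda>u. p u * laplacian q u)
      + 2 * (\<Sum>i\<in>UNIV. sphint (\<lambda>u. partial i p u * partial i q u))"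
    using integrable_sphere_hpoly[OF hpoly_mult[OF hpoly_p hpoly_laplacian[OF hpoly_q]]] gradient_integrable by simp
  also have "\<dots> = 0" by (simp add: laplacian_term gradient_term)
  finally have "real (j + l) * (real (j + l) + real CARD('n) - 2) = 0 \<or> sphint (\<lambda>u. p u * q u) = 0"
    unfolding mult_eq_0_iff of_real_eq_0_iff .
  moreover have "real (j + l) > 0" "real (j + l) + real CARD('n) - 2 > 0" using \<open>l < j\<close> dim by linarith+
  ultimately show ?case by simp
qed

lemma sphint_harm_orthogonal:
  fixes p q :: "real^'n::finite \<Rightarrow> complex"
  assumes dim: "CARD('n) \<ge> 2" and harm_p: "p \<in> harm j" and harm_q: "q \<in> harm l" and "j \<noteq> l"
  shows "sphint (\<lambda>u. p u * q u) = 0"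
proof (cases "l < j")
  case True
  then show ?thesis by (rule sphint_harm_mult_lower_degree[OF dim harm_p harm_hpoly[OF harm_q]])
next
  case False
  then have "sphint (\<lambda>u. q u * p u) = 0"
    using \<open>j \<noteq> l\<close> by (intro sphint_harm_mult_lower_degree[OF dim harm_q harm_hpoly[OF harm_p]]) simp
  then show ?thesis by (simp add: mult.commute)
qed

text \<open>
  For harmonic \<open>p\<close> of degree \<open>n - 2 m\<close>, the integral of \<open>(x \<bullet> u)^n * p u\<close> over the sphere is
  \<open>fh_coeff d n m * |x|^(2 m) * p x\<close>.
\<close>

definition fh_coeff :: "nat \<Rightarrow> nat \<Rightarrow> nat \<Rightarrow> real" where
  "fh_coeff d n m = 2 * pi powr (real d / 2)
      * fact n / (2 ^ n * (fact m * Gamma (real n - real m + real d / 2)))"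

lemma measure_sphere: "measure sphere_measure (sphere (0::real^'n::finite) 1) = fh_coeff CARD('n) 0 0"
  by (simp add: measure_sphere_measure_sphere fh_coeff_def)

lemma fh_coeff_pos: "d > 0 \<Longrightarrow> m \<le> n \<Longrightarrow> fh_coeff d n m > 0"
  by (auto simp: fh_coeff_def intro!: divide_pos_pos mult_pos_pos Gamma_real_pos add_nonneg_pos)



lemma fh_coeff_Suc_0:
  assumes "d > 0"
  shows "(2 * real n + real d) * fh_coeff d (Suc n) 0 = real (Suc n) * fh_coeff d n 0"
proof -
  define e where "e = real n + real d / 2"
  have e_pos: "e > 0" using assms by (simp add: e_def add_nonneg_pos)
  have "real (Suc n) - real 0 + real d / 2 = e + 1" "real n - real 0 + real d / 2 = e"
    "2 * real n + real d = 2 * e"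
    by (simp_all add: e_def)
  then show ?thesis
    unfolding fh_coeff_def using e_pos Gamma_real_pos[OF e_pos]
    by (simp only: Gamma_plus1_pos fact_Suc) (simp add: divide_simps del: of_nat_Suc)
qed

lemma fh_coeff_add_2_Suc:
  assumes "d > 0" "m \<le> n"
  shows "2 * real (Suc m) * (2 * (real n - real m) + real d) * fh_coeff d (n + 2) (Suc m)
           = real (n + 2) * real (n + 1) * fh_coeff d n m"
proof -
  define e where "e = real n - real m + real d / 2"
  have e_pos: "e > 0" using assms by (simp add: e_def add_nonneg_pos)
  have "real (n + 2) - real (Suc m) + real d / 2 = e + 1" "2 * (real n - real m) + real d = 2 * e"
    by (simp_all add: e_def)
  then show ?thesis
    unfolding fh_coeff_def e_def[symmetric] using e_pos Gamma_real_pos[OF e_pos]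
    by (simp only: Gamma_plus1_pos fact_Suc add_2_eq_Suc' add_Suc_right Nat.add_0_right One_nat_def)
       (simp add: divide_simps del: of_nat_Suc)
qed

lemma laplacian_inner_power_mult:
  fixes p :: "real^'n::finite \<Rightarrow> complex"
  assumes hpoly_p: "hpoly j p" and "laplacian p = (\<lambda>x. 0)"
  shows "laplacian (\<lambda>u. of_real (e \<bullet> u) ^ Suc n * p u)
     = (\<lambda>u. of_real (2 * (real n + 1)) * (of_real (e \<bullet> u) ^ n * (\<Sum>i\<in>UNIV. of_real (e $ i) * partial i p u))
          + p u * laplacian (\<lambda>u. of_real (e \<bullet> u) ^ Suc n) u)"
  unfolding laplacian_mult[OF hpoly_inner_power hpoly_p] assms(2) partial_power[OF hpoly_inner]
    partial_inner
  by (simp add: fun_eq_iff sum_distrib_left algebra_simps)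

theorem funk_hecke_power:
  fixes p :: "real^'n::finite \<Rightarrow> complex"
  assumes dim: "CARD('n) \<ge> 2" and "p \<in> harm n"
  shows "sphint (\<lambda>u. of_real (e \<bullet> u) ^ n * p u) = of_real (fh_coeff CARD('n) n 0) * p e"
  using assms(2)
proof (induction n arbitrary: p)
  case 0
  then obtain c where "p = (\<lambda>x. c)" using hpoly_0_const[OF harm_hpoly] by blast
  then show ?case by (simp add: measure_sphere scaleR_conv_of_real)
next
  case (Suc n)
  let ?d = "real CARD('n)" and ?q = "\<lambda>u. of_real (e \<bullet> u) ^ Suc n * p u"
  note hpoly_p = harm_hpoly[OF Suc.prems] and e_power = hpoly_inner_power[of _ e]
  define D where "D u = (\<Sum>i\<in>UNIV. of_real (e $ i) * partial i p u)" for u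
  have harm_D: "D \<in> harm n"
    unfolding D_def[abs_def] using harm_partial[OF Suc.prems] by (intro harm_sum harm_cmult) simp
  define L where "L = laplacian (\<lambda>u. of_real (e \<bullet> u) ^ Suc n)"
  have hpoly_L: "hpoly (n - 1) L"
    using hpoly_laplacian[OF e_power[of "Suc n"]] by (simp add: L_def)
  have "laplacian ?q = (\<lambda>u. of_real (2 * (real n + 1)) * (of_real (e \<bullet> u) ^ n * D u) + p u * L u)"
    unfolding D_def L_def by (rule laplacian_inner_power_mult[OF hpoly_p harm_laplacian[OF Suc.prems]])
  then have "of_real (real (Suc n + Suc n) * (real (Suc n + Suc n) + ?d - 2)) * sphint ?q
      = sphint (\<lambda>u. of_real (2 * (real n + 1)) * (of_real (e \<bullet> u) ^ n * D u) + p u * L u)"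
    by (simp only: sphint_laplacian[OF hpoly_mult[OF e_power hpoly_p], symmetric])
  also have "\<dots> = of_real (2 * (real n + 1)) * sphint (\<lambda>u. of_real (e \<bullet> u) ^ n * D u)
      + sphint (\<lambda>u. p u * L u)"
    using integrable_sphere_hpoly[OF hpoly_mult[OF e_power harm_hpoly[OF harm_D], of n]]
      integrable_sphere_hpoly[OF hpoly_mult[OF hpoly_p hpoly_L]]
    by simp
  also have "sphint (\<lambda>u. p u * L u) = 0"
    by (rule sphint_harm_mult_lower_degree[OF dim Suc.prems hpoly_L]) simp
  also have "sphint (\<lambda>u. of_real (e \<bullet> u) ^ n * D u)
      = of_real (fh_coeff CARD('n) n 0) * (of_nat (Suc n) * p e)"
    using Suc.IH[OF harm_D] hpoly_euler[OF hpoly_p, of e] by (simp only: D_def)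
  finally have "of_real (2 * (real n + 1) * (2 * real n + ?d)) * sphint ?q
      = of_real (2 * (real n + 1) * (real (Suc n) * fh_coeff CARD('n) n 0)) * p e"
    by (simp add: algebra_simps)
  then have "of_real (2 * (real n + 1) * (2 * real n + ?d)) * sphint ?q
      = of_real (2 * (real n + 1) * (2 * real n + ?d)) * (of_real (fh_coeff CARD('n) (Suc n) 0) * p e)"
    by (simp only: fh_coeff_Suc_0[OF zero_less_card_finite, symmetric] of_real_mult mult.assoc)
  moreover have "2 * (real n + 1) * (2 * real n + ?d) \<noteq> 0"
    by (simp add: add_nonneg_eq_0_iff)
  ultimately show ?case by (simp only: mult_cancel_left of_real_eq_0_iff simp_thms)
qed

lemma fh_coeff_0_le:
  assumes d_ge_2: "d \<ge> 2"
  shows "fh_coeff d 0 0 \<le> real d ^ n * fh_coeff d n 0"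
proof (induction n)
  case (Suc n)
  have pos: "fh_coeff d (Suc n) 0 > 0" using d_ge_2 by (intro fh_coeff_pos) auto
  have "real (Suc n) * fh_coeff d 0 0 \<le> real d ^ n * (real (Suc n) * fh_coeff d n 0)"
    using mult_left_mono[OF Suc, of "real (Suc n)"] by (simp add: mult_ac)
  also have "\<dots> = real d ^ n * ((2 * real n + real d) * fh_coeff d (Suc n) 0)"
    using d_ge_2 fh_coeff_Suc_0[of d n] by simp
  also have "\<dots> \<le> real d ^ n * ((real d * real (Suc n)) * fh_coeff d (Suc n) 0)"
    using mult_right_mono[of 2 "real d" "real n"] d_ge_2 pos
    by (intro mult_left_mono mult_right_mono) (auto simp: algebra_simps)
  also have "\<dots> = real (Suc n) * (real d ^ Suc n * fh_coeff d (Suc n) 0)" by (simp add: mult_ac)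
  finally show ?case by (subst (asm) mult_le_cancel_left_pos) auto
qed simp

lemma Gamma_add_nat_ge: "x \<ge> 1 \<Longrightarrow> Gamma (real j + x) \<ge> fact j * Gamma (x::real)"
proof (induction j)
  case (Suc j)
  have "fact (Suc j) * Gamma x = (real j + 1) * (fact j * Gamma x)" by simp
  also have "\<dots> \<le> (real j + x) * Gamma (real j + x)"
    using Suc Gamma_real_pos[of x] by (intro mult_mono) auto
  also have "\<dots> = Gamma (real (Suc j) + x)"
    using Gamma_plus1_pos[of "real j + x"] Suc.prems by (simp add: add_ac)
  finally show ?case .
qed simp

lemma fact_le_fact_mult_fact: "m \<le> n \<Longrightarrow> fact n \<le> (2 ^ n * (fact m * fact (n - m)) :: real)"
proof -
  assume m_le: "m \<le> n"
  have "n choose m \<le> (\<Sum>k\<le>n. n choose k)" using m_le by (intro member_le_sum) auto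
  then have "real (n choose m) \<le> 2 ^ n"
    unfolding choose_row_sum by (metis of_nat_le_iff of_nat_numeral of_nat_power)
  moreover have "fact n = fact m * fact (n - m) * real (n choose m)"
    using binomial_fact_lemma[OF m_le] by (metis of_nat_fact of_nat_mult)
  ultimately show ?thesis by (simp add: mult_ac mult_left_mono)
qed

lemma fh_coeff_le:
  assumes d_ge_2: "d \<ge> 2" and m_le: "m \<le> n"
  shows "fh_coeff d n m \<le> fh_coeff d 0 0"
proof -
  let ?x = "real d / 2"
  have Gamma_x: "Gamma ?x > 0" using d_ge_2 by (intro Gamma_real_pos) auto
  have "fact n * Gamma ?x \<le> 2 ^ n * (fact m * fact (n - m)) * Gamma ?x"
    using fact_le_fact_mult_fact[OF m_le] Gamma_x by (intro mult_right_mono) auto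
  also have "\<dots> = 2 ^ n * (fact m * (fact (n - m) * Gamma ?x))"
    by (simp add: mult_ac)
  also have "\<dots> \<le> 2 ^ n * (fact m * Gamma (real (n - m) + ?x))"
    using Gamma_add_nat_ge[of ?x "n - m"] d_ge_2 by (intro mult_left_mono) auto
  finally have "fact n * Gamma ?x \<le> 2 ^ n * (fact m * Gamma (real n - real m + ?x))"
    using m_le by (simp add: of_nat_diff)
  moreover have "2 ^ n * (fact m * Gamma (real n - real m + ?x)) > 0"
    using m_le d_ge_2 by (intro mult_pos_pos Gamma_real_pos) auto
  ultimately show ?thesis
    using Gamma_x by (simp add: fh_coeff_def divide_simps mult_ac)
qed

section \<open>Projection onto spherical harmonics\<close>

lemma integrable_sphere_mult_harm:
  "continuous_on UNIV f \<Longrightarrow> q \<in> harm j \<Longrightarrow> integrable sphere_measure (\<lambda>u. f u * q u)"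
  by (intro integrable_sphere_continuous continuous_on_mult) (auto intro: continuous_on_harm)

lemma sh_proj_eqI:
  fixes f :: "real^'n::finite \<Rightarrow> complex"
  assumes cont_f: "continuous_on UNIV f" and harm_p: "p \<in> harm j"
    and sphint_eq: "\<And>q. q \<in> harm j \<Longrightarrow> sphint (\<lambda>u. p u * q u) = sphint (\<lambda>u. f u * q u)"
  shows "sh_proj j f = p"
  unfolding sh_proj_def
proof (rule the_equality)
  have diff: "sphint (\<lambda>u. (f u - h u) * cnj (q u))
      = sphint (\<lambda>u. f u * cnj (q u)) - sphint (\<lambda>u. h u * cnj (q u))"
    if "h \<in> harm j" "q \<in> harm j" for h q
    unfolding left_diff_distrib using that
    by (intro Bochner_Integration.integral_diff integrable_sphere_mult_harm[OF _ harm_cnj] cont_f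
      continuous_on_harm)
  show "p \<in> harm j \<and> (\<forall>q\<in>harm j. sphint (\<lambda>u. (f u - p u) * cnj (q u)) = 0)"
    using harm_p sphint_eq[OF harm_cnj] by (simp add: diff)
  fix h assume harm_h: "h \<in> harm j \<and> (\<forall>q\<in>harm j. sphint (\<lambda>u. (f u - h u) * cnj (q u)) = 0)"
  define r where "r x = h x - p x" for x
  have harm_r: "r \<in> harm j" unfolding r_def[abs_def] using harm_h harm_p by (intro harm_diff) auto
  have "sphint (\<lambda>u. r u * cnj (r u)) = sphint (\<lambda>u. h u * cnj (r u) - p u * cnj (r u))"
    by (simp add: r_def left_diff_distrib)
  also have "\<dots> = sphint (\<lambda>u. h u * cnj (r u)) - sphint (\<lambda>u. p u * cnj (r u))"
    using harm_h harm_p harm_r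
    by (intro Bochner_Integration.integral_diff integrable_sphere_mult_harm[OF continuous_on_harm harm_cnj])
      auto
  also have "\<dots> = 0" using diff[of h r] harm_h harm_r sphint_eq[OF harm_cnj[OF harm_r]] by auto
  finally have "r = (\<lambda>x. 0)" by (rule hpoly_eq_0_if_sphint_norm_sq_eq_0[OF harm_hpoly[OF harm_r]])
  then show "h = p" by (simp add: r_def[abs_def] fun_eq_iff)
qed

subsection \<open>Moments against powers of linear forms\<close>

definition power_transform :: "(real^'n::finite \<Rightarrow> complex) \<Rightarrow> nat \<Rightarrow> real^'n \<Rightarrow> complex" where
  "power_transform f n x = sphint (\<lambda>u. of_real (x \<bullet> u) ^ n * f u)"

lemma continuous_on_coord_mult:
  "continuous_on A f \<Longrightarrow> continuous_on A (\<lambda>u::real^'n::finite. of_real (u $ i) * f u :: complex)"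
  by (intro continuous_intros)

lemma integrable_sphere_inner_power_mult:
  "continuous_on UNIV f
      \<Longrightarrow> integrable sphere_measure (\<lambda>u::real^'n::finite. of_real (x \<bullet> u) ^ n * f u :: complex)"
  by (intro integrable_sphere_continuous continuous_intros)

lemma power_transform_0: "power_transform f 0 = (\<lambda>x. sphint f)"
  by (simp add: power_transform_def fun_eq_iff)

lemma power_transform_Suc:
  fixes f :: "real^'n::finite \<Rightarrow> complex"
  assumes cont_f: "continuous_on UNIV f"
  shows "power_transform f (Suc n) x
           = (\<Sum>i\<in>UNIV. of_real (x $ i) * power_transform (\<lambda>u. of_real (u $ i) * f u) n x)"
proof -
  have expand: "of_real (x \<bullet> u) ^ Suc n * f u
      = (\<Sum>i\<in>UNIV. of_real (x $ i) * (of_real (x \<bullet> u) ^ n * (of_real (u $ i) * f u)))" for u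
  proof -
    have "of_real (x \<bullet> u) ^ Suc n * f u
        = (\<Sum>i\<in>UNIV. of_real (x $ i) * of_real (u $ i)) * (of_real (x \<bullet> u) ^ n * f u)"
      unfolding of_real_inner_eq_sum[symmetric] by (simp only: power_Suc mult.assoc)
    also have "\<dots> = (\<Sum>i\<in>UNIV. of_real (x $ i) * (of_real (x \<bullet> u) ^ n * (of_real (u $ i) * f u)))"
      unfolding sum_distrib_right by (intro sum.cong) (simp_all add: mult_ac)
    finally show ?thesis .
  qed
  show ?thesis
    unfolding power_transform_def expand
    using integrable_sphere_inner_power_mult[OF continuous_on_coord_mult[OF cont_f]] by simp
qed

lemma hpoly_power_transform: "continuous_on UNIV f \<Longrightarrow> hpoly n (power_transform f n)"
proof (induction n arbitrary: f)
  case 0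
  then show ?case by (simp add: power_transform_0 hpoly_const)
next
  case (Suc n)
  show ?case unfolding power_transform_Suc[OF Suc.prems, abs_def]
    by (intro hpoly_sum hpoly_coord_mult Suc.IH continuous_on_coord_mult Suc.prems)
qed

lemma partial_power_transform:
  "continuous_on UNIV f \<Longrightarrow> partial i (power_transform f n)
      = (\<lambda>x. of_nat n * power_transform (\<lambda>u. of_real (u $ i) * f u) (n - 1) x)"
proof (induction n arbitrary: f)
  case 0
  then show ?case by (simp add: power_transform_0)
next
  case (Suc n)
  note cont_f = Suc.prems
  let ?m = "\<lambda>k f. \<lambda>u::real^'a. of_real (u $ k) * f u"
  note f_coord = continuous_on_coord_mult[OF cont_f]
  have "partial i (power_transform f (Suc n))
      = (\<lambda>x. \<Sum>k\<in>UNIV. partial i (\<lambda>x. of_real (x $ k) * power_transform (?m k f) n x) x)"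
    unfolding power_transform_Suc[OF cont_f, abs_def]
    by (rule partial_sum[OF hpoly_coord_mult[OF hpoly_power_transform[OF f_coord]]])
  also have "\<dots> = (\<lambda>x. \<Sum>k\<in>UNIV. of_real (x $ k) * (of_nat n * power_transform (?m i (?m k f)) (n - 1) x)
      + (if i = k then power_transform (?m k f) n x else 0))"
    unfolding partial_coord_mult[OF hpoly_power_transform[OF f_coord]] Suc.IH[OF f_coord] ..
  also have "\<dots> = (\<lambda>x. of_nat n * (\<Sum>k\<in>UNIV. of_real (x $ k) * power_transform (?m k (?m i f)) (n - 1) x) + power_transform (?m i f) n x)"
    by (simp add: sum.distrib sum_distrib_left mult_ac)
  also have "\<dots> = (\<lambda>x. of_nat (Suc n) * power_transform (?m i f) n x)"
    using power_transform_Suc[OF f_coord[of i], of "n - 1"]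
    by (cases n) (simp_all add: fun_eq_iff algebra_simps)
  finally show ?case by simp
qed

lemma sum_power_transform_coord_coord:
  fixes f :: "real^'n::finite \<Rightarrow> complex"
  assumes cont_f: "continuous_on UNIV f"
  shows "(\<Sum>i\<in>UNIV. power_transform (\<lambda>u. of_real (u $ i) * (of_real (u $ i) * f u)) n x)
      = power_transform f n x"
proof -
  note integrable = integrable_sphere_inner_power_mult[OF continuous_on_coord_mult[OF continuous_on_coord_mult[OF cont_f]]]
  have "(\<Sum>i\<in>UNIV. of_real (x \<bullet> u) ^ n * (of_real (u $ i) * (of_real (u $ i) * f u)))
      = of_real (x \<bullet> u) ^ n * f u"
    if "norm u = 1" for u
  proof -
    have "(\<Sum>i\<in>UNIV. of_real (x \<bullet> u) ^ n * (of_real (u $ i) * (of_real (u $ i) * f u)))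
        = (\<Sum>i\<in>UNIV. of_real (u $ i) * of_real (u $ i)) * (of_real (x \<bullet> u) ^ n * f u)"
      unfolding sum_distrib_right by (intro sum.cong) (simp_all add: mult_ac)
    then show ?thesis by (simp add: of_real_norm_sq_eq_sum[symmetric] that)
  qed
  then show ?thesis
    unfolding power_transform_def Bochner_Integration.integral_sum[OF integrable, symmetric]
    by (intro Bochner_Integration.integral_cong) simp_all
qed

lemma laplacian_power_transform:
  fixes f :: "real^'n::finite \<Rightarrow> complex"
  assumes cont_f: "continuous_on UNIV f"
  shows "laplacian (power_transform f n) = (\<lambda>x. of_nat n * of_nat (n - 1) * power_transform f (n - 2) x)"
proof -
  note f_coord = continuous_on_coord_mult[OF cont_f]
  have "partial i (partial i (power_transform f n))
      = (\<lambda>x. of_nat n * of_nat (n - 1) * power_transform (\<lambda>u. of_real (u $ i) * (of_real (u $ i) * f u)) (n - 2) x)" for i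
    unfolding partial_power_transform[OF cont_f] partial_cmult[OF hpoly_power_transform[OF f_coord]]
      partial_power_transform[OF f_coord]
    by (simp add: numeral_2_eq_2 mult.assoc)
  then show ?thesis
    by (simp add: laplacian_hpoly[OF hpoly_power_transform[OF cont_f]]
      sum_power_transform_coord_coord[OF cont_f] flip: sum_distrib_left)
qed

lemma sphint_norm_power_transform_integrand_le:
  fixes f :: "real^'n::finite \<Rightarrow> complex"
  assumes cont_f: "continuous_on UNIV f" and f_bound: "\<And>u. norm u = 1 \<Longrightarrow> cmod (f u) \<le> B"
  shows "sphint (\<lambda>u. cmod (of_real (x \<bullet> u) ^ n * f u)) \<le> norm x ^ n * B * fh_coeff CARD('n) 0 0"
proof -
  have "sphint (\<lambda>u. cmod (of_real (x \<bullet> u) ^ n * f u)) \<le> sphint (\<lambda>u::real^'n. norm x ^ n * B)"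
  proof (rule integral_mono)
    show "integrable sphere_measure (\<lambda>u. cmod (of_real (x \<bullet> u) ^ n * f u))"
      by (rule integrable_norm[OF integrable_sphere_inner_power_mult[OF cont_f]])
    fix u :: "real^'n" assume "u \<in> space sphere_measure"
    then have norm_u: "norm u = 1" by simp
    then have "\<bar>x \<bullet> u\<bar> ^ n \<le> norm x ^ n" using Cauchy_Schwarz_ineq2[of x u] by (intro power_mono) auto
    then show "cmod (of_real (x \<bullet> u) ^ n * f u) \<le> norm x ^ n * B"
      unfolding norm_mult norm_power norm_of_real using f_bound[OF norm_u] by (intro mult_mono) auto
  qed simp
  also have "\<dots> = norm x ^ n * B * fh_coeff CARD('n) 0 0"
    using measure_sphere[where 'n='n] by simp
  finally show ?thesis .
qed

lemma norm_power_transform_le: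
  fixes f :: "real^'n::finite \<Rightarrow> complex"
  assumes "continuous_on UNIV f" "\<And>u. norm u = 1 \<Longrightarrow> cmod (f u) \<le> B"
  shows "cmod (power_transform f n x) \<le> norm x ^ n * B * fh_coeff CARD('n) 0 0"
  unfolding power_transform_def
  by (rule order_trans[OF integral_norm_bound sphint_norm_power_transform_integrand_le[OF assms]])

lemma sphint_swap:
  fixes k :: "real^'n::finite \<Rightarrow> real^'m::finite \<Rightarrow> complex"
  assumes cont_k: "continuous_on UNIV (\<lambda>(x, u). k x u)"
  shows "sphint (\<lambda>x. sphint (\<lambda>u. k x u)) = sphint (\<lambda>u. sphint (\<lambda>x. k x u))"
proof -
  let ?M = "(sphere_measure :: (real^'n) measure) \<Otimes>\<^sub>M (sphere_measure :: (real^'m) measure)"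
  interpret pair_sigma_finite "sphere_measure :: (real^'n) measure" "sphere_measure :: (real^'m) measure" ..
  interpret finite_measure ?M
    by (intro finite_measure_pair_measure sph.finite_measure_axioms)
  have "bounded ((\<lambda>(x, u). k x u) ` (sphere 0 1 \<times> sphere 0 1))"
    by (intro compact_imp_bounded compact_continuous_image continuous_on_subset[OF cont_k] compact_Times)
      auto
  then obtain B where k_bound: "\<And>y. y \<in> sphere 0 1 \<times> sphere 0 1 \<Longrightarrow> norm ((\<lambda>(x, u). k x u) y) \<le> B"
    unfolding bounded_iff by blast
  have "(\<lambda>y. (fst y, snd y)) \<in> measurable ?M (borel \<Otimes>\<^sub>M borel)"
    by (intro measurable_Pair measurable_compose[OF measurable_fst borel_measurable_ident_sphere_measure]
        measurable_compose[OF measurable_snd borel_measurable_ident_sphere_measure])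
  moreover have "(\<lambda>(x, u). k x u) \<in> borel_measurable (borel \<Otimes>\<^sub>M borel)"
    unfolding borel_prod by (rule borel_measurable_continuous_onI[OF cont_k])
  ultimately have k_measurable: "(\<lambda>(x, u). k x u) \<in> borel_measurable ?M"
    using measurable_compose by fastforce
  have "AE y in ?M. norm ((\<lambda>(x, u). k x u) y) \<le> B"
    using k_bound by (intro AE_I2) (simp add: space_pair_measure)
  then have "integrable ?M (\<lambda>(x, u). k x u)"
    using k_measurable by (rule integrable_const_bound)
  from Fubini_integral[OF this] show ?thesis by simp
qed

lemma sphint_power_transform_mult_harm:
  fixes f :: "real^'n::finite \<Rightarrow> complex"
  assumes dim: "CARD('n) \<ge> 2" and cont_f: "continuous_on UNIV f" and harm_q: "q \<in> harm n"
  shows "sphint (\<lambda>x. power_transform f n x * q x)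
      = of_real (fh_coeff CARD('n) n 0) * sphint (\<lambda>u. f u * q u)"
proof -
  have "sphint (\<lambda>x. power_transform f n x * q x)
      = sphint (\<lambda>x. sphint (\<lambda>u. of_real (x \<bullet> u) ^ n * f u * q x))"
    unfolding power_transform_def by simp
  also have "\<dots> = sphint (\<lambda>u. sphint (\<lambda>x. of_real (x \<bullet> u) ^ n * f u * q x))"
  proof (rule sphint_swap)
    show "continuous_on UNIV (\<lambda>(x, u). of_real (x \<bullet> u) ^ n * f u * q x)"
      unfolding split_beta
      by (intro continuous_intros continuous_on_compose2[OF cont_f]
        continuous_on_compose2[OF continuous_on_harm[OF harm_q]]) auto
  qed
  also have "\<dots> = sphint (\<lambda>u. f u * sphint (\<lambda>x. of_real (u \<bullet> x) ^ n * q x))"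
    by (simp only: integral_mult_right_zero[symmetric]) (simp add: mult_ac inner_commute)
  also have "\<dots> = sphint (\<lambda>u. of_real (fh_coeff CARD('n) n 0) * (f u * q u))"
    unfolding funk_hecke_power[OF dim harm_q] by (simp add: mult_ac)
  finally show ?thesis by simp
qed

subsection \<open>Harmonic decomposition of the moments\<close>

text \<open>
  By the Funk--Hecke formula \<open>power_transform f n\<close> pairs with harmonic polynomials of degree \<open>n\<close> as
  \<open>fh_coeff d n 0 * f\<close> does. Removing its components of lower degree makes it harmonic.
\<close>

function harmonic_component :: "(real^'n::finite \<Rightarrow> complex) \<Rightarrow> nat \<Rightarrow> real^'n \<Rightarrow> complex" where
  "harmonic_component f n x =
     (power_transform f n x - (\<Sum>m\<in>{1..n div 2}.
        of_real (fh_coeff CARD('n) n m) * (of_real (norm x) ^ (2 * m) * harmonic_component f (n - 2 * m) x)))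
     / of_real (fh_coeff CARD('n) n 0)"
  by pat_completeness auto
termination by (relation "Wellfounded.measure (\<lambda>(f, n, x). n)") auto

declare harmonic_component.simps [simp del]

lemma power_transform_eq_sum_harmonic_component:
  fixes f :: "real^'n::finite \<Rightarrow> complex"
  shows "power_transform f n x = (\<Sum>m\<le>n div 2.
     of_real (fh_coeff CARD('n) n m) * (of_real (norm x) ^ (2 * m) * harmonic_component f (n - 2 * m) x))"
proof -
  have "fh_coeff CARD('n) n 0 \<noteq> 0" using fh_coeff_pos[of "CARD('n)" 0 n] by simp
  then show ?thesis
    using harmonic_component.simps[of f n x]
    by (simp add: atMost_atLeast0 sum.atLeast_Suc_atMost field_simps)
qed

lemma laplacian_fh_term:
  fixes p :: "real^'n::finite \<Rightarrow> complex"
  assumes harm_p: "p \<in> harm (n - 2 * m)" and two_m_le: "2 * m \<le> n"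
  shows "laplacian (\<lambda>x. of_real (fh_coeff CARD('n) (n + 2) (Suc m)) * (of_real (norm x) ^ (2 * Suc m) * p x))
     = (\<lambda>x. of_real (real (n + 2) * real (n + 1)) * (of_real (fh_coeff CARD('n) n m) * (of_real (norm x) ^ (2 * m) * p x)))"
proof -
  have "2 * real (Suc m) + 2 * real (n - 2 * m) + real CARD('n) - 2 = 2 * (real n - real m) + real CARD('n)"
    using two_m_le by (simp add: of_nat_diff)
  then have laplacian_power: "laplacian (\<lambda>x. of_real (norm x) ^ (2 * Suc m) * p x)
      = (\<lambda>x. of_real (2 * real (Suc m) * (2 * (real n - real m) + real CARD('n))) * (of_real (norm x) ^ (2 * m) * p x))"
    using laplacian_norm_power_mult[OF harm_hpoly[OF harm_p] harm_laplacian[OF harm_p], of "Suc m"]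
    by (simp only: diff_Suc_1)
  have "of_real a * (of_real b * z) = of_real c * (of_real e * z)" if "b * a = c * e" for a b c e :: real
    and z :: complex
    using that by (simp only: mult.assoc[symmetric] of_real_mult[symmetric] mult.commute[of a])
  from this[OF fh_coeff_add_2_Suc[OF zero_less_card_finite[where 'a='n], of m n]] show ?thesis
    using two_m_le by (simp only: laplacian_cmult[OF hpoly_norm_power_mult[OF harm_hpoly[OF harm_p]]]
      laplacian_power)
qed

lemma harm_harmonic_component:
  fixes f :: "real^'n::finite \<Rightarrow> complex"
  assumes cont_f: "continuous_on UNIV f"
  shows "harmonic_component f n \<in> harm n"
proof (induction n rule: less_induct)
  case (less n)
  let ?Y = "harmonic_component f"
  define t where "t m x = of_real (fh_coeff CARD('n) n m) * (of_real (norm x) ^ (2 * m) * ?Y (n - 2 * m) x)"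
    for m x
  define E where "E x = power_transform f n x - (\<Sum>m\<in>{1..n div 2}. t m x)" for x
  have "hpoly (2 * m + (n - 2 * m)) (t m)" if "m \<in> {1..n div 2}" for m
    unfolding t_def[abs_def] using that by (intro hpoly_cmult hpoly_norm_power_mult harm_hpoly less.IH) auto
  then have hpoly_t: "hpoly n (t m)" if "m \<in> {1..n div 2}" for m
    using that by fastforce
  have "laplacian E = (\<lambda>x. of_nat n * of_nat (n - 1) * power_transform f (n - 2) x - (\<Sum>m\<in>{1..n div 2}. laplacian (t m) x))"
    unfolding E_def[abs_def]
    by (simp only: laplacian_diff[OF hpoly_power_transform[OF cont_f] hpoly_sum[OF hpoly_t]]
      laplacian_power_transform[OF cont_f] laplacian_sum[OF hpoly_t])
  also have "\<dots> = (\<lambda>x. 0)"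
  proof (cases "n < 2")
    case True
    then show ?thesis by (auto simp: less_2_cases_iff)
  next
    case False
    then obtain l where n_eq: "n = l + 2" by (metis add.commute le_Suc_ex not_less)
    have "laplacian (t (Suc m)) = (\<lambda>x. of_nat n * of_nat (n - 1) *
        (of_real (fh_coeff CARD('n) l m) * (of_real (norm x) ^ (2 * m) * ?Y (l - 2 * m) x)))" if "m \<le> l div
          2" for m
      using laplacian_fh_term[OF less.IH[of "l - 2 * m"]] that by (simp add: t_def[abs_def] n_eq)
    moreover have "{1..n div 2} = Suc ` {..l div 2}"
      by (simp add: n_eq image_Suc_atMost)
    ultimately show ?thesis
      using power_transform_eq_sum_harmonic_component[of f l]
      by (simp add: n_eq sum.reindex sum_distrib_left)
  qed
  finally have "laplacian E = (\<lambda>x. 0)" .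
  moreover have "hpoly n E"
    unfolding E_def[abs_def] by (intro hpoly_diff hpoly_power_transform cont_f hpoly_sum hpoly_t)
  ultimately have "E \<in> harm n" by (simp add: harm_iff)
  then have "(\<lambda>x. 1 / of_real (fh_coeff CARD('n) n 0) * E x) \<in> harm n" by (rule harm_cmult)
  moreover have "?Y n x = 1 / of_real (fh_coeff CARD('n) n 0) * E x" for x
    by (subst harmonic_component.simps) (simp add: E_def t_def)
  ultimately show ?case by (simp only:)
qed

lemma sphint_harmonic_component_mult:
  fixes f :: "real^'n::finite \<Rightarrow> complex"
  assumes dim: "CARD('n) \<ge> 2" and cont_f: "continuous_on UNIV f" and harm_q: "q \<in> harm n"
  shows "sphint (\<lambda>u. harmonic_component f n u * q u) = sphint (\<lambda>u. f u * q u)"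
proof -
  let ?c = "\<lambda>m. complex_of_real (fh_coeff CARD('n) n m)" and ?Y = "harmonic_component f"
  note harm_Y = harm_harmonic_component[OF cont_f]
  have lower: "sphint (\<lambda>u. ?Y (n - 2 * m) u * q u) = 0" if "m \<in> {..n div 2} - {0}" for m
    using that by (intro sphint_harm_orthogonal[OF dim harm_Y harm_q]) auto
  have integrable: "integrable sphere_measure (\<lambda>u. ?c m * (?Y (n - 2 * m) u * q u))" for m
    by (intro integrable_sphere_continuous continuous_intros continuous_on_harm[OF harm_Y]
      continuous_on_harm[OF harm_q])
  have "sphint (\<lambda>u. power_transform f n u * q u) = sphint (\<lambda>u. \<Sum>m\<le>n div 2. ?c m * (?Y (n - 2 * m) u * q u))"
    by (intro Bochner_Integration.integral_cong)
       (simp_all add: power_transform_eq_sum_harmonic_component sum_distrib_right mult.assoc)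
  also have "\<dots> = (\<Sum>m\<le>n div 2. ?c m * sphint (\<lambda>u. ?Y (n - 2 * m) u * q u))"
    by (simp add: Bochner_Integration.integral_sum[OF integrable])
  also have "\<dots> = ?c 0 * sphint (\<lambda>u. ?Y n u * q u)"
    using lower by (subst sum.remove[of _ 0]) auto
  finally have "?c 0 * sphint (\<lambda>u. ?Y n u * q u) = ?c 0 * sphint (\<lambda>u. f u * q u)"
    unfolding sphint_power_transform_mult_harm[OF dim cont_f harm_q] by (rule sym)
  then show ?thesis using fh_coeff_pos[of "CARD('n)" 0 n] by auto
qed

context
  fixes f :: "real^'n::finite \<Rightarrow> complex"
  assumes dim: "CARD('n) \<ge> 2" and cont_f: "continuous_on UNIV f"
begin

lemma sh_proj_eq_harmonic_component: "sh_proj n f = harmonic_component f n"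
  by (rule sh_proj_eqI[OF cont_f harm_harmonic_component[OF cont_f]])
     (rule sphint_harmonic_component_mult[OF dim cont_f])

theorem sh_proj_harm: "sh_proj n f \<in> harm n"
  unfolding sh_proj_eq_harmonic_component by (rule harm_harmonic_component[OF cont_f])

theorem sphint_sh_proj_mult: "q \<in> harm n \<Longrightarrow> sphint (\<lambda>u. sh_proj n f u * q u) = sphint (\<lambda>u. f u * q u)"
  unfolding sh_proj_eq_harmonic_component by (rule sphint_harmonic_component_mult[OF dim cont_f])

theorem power_transform_eq_sum_sh_proj:
  "power_transform f n x = (\<Sum>m\<le>n div 2.
     of_real (fh_coeff CARD('n) n m) * (of_real (norm x) ^ (2 * m) * sh_proj (n - 2 * m) f x))"
  unfolding sh_proj_eq_harmonic_component by (rule power_transform_eq_sum_harmonic_component)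

lemma sphint_sh_proj: "sphint (sh_proj n f) = (if n = 0 then sphint f else 0)"
  using sphint_sh_proj_mult[of "\<lambda>x. 1" n] sphint_harm_orthogonal[OF dim sh_proj_harm harm_const[of 1], of n]
  by (auto simp: harm_const)

lemma sphint_power_transform:
  "sphint (power_transform f n)
      = (if even n then of_real (fh_coeff CARD('n) n (n div 2)) * sphint f else 0)"
proof -
  have integrable: "integrable sphere_measure (\<lambda>u. of_real (fh_coeff CARD('n) n m) * sh_proj (n - 2 * m) f u)" for m
    by (intro integrable_sphere_continuous continuous_intros continuous_on_harm[OF sh_proj_harm])
  have "sphint (power_transform f n)
      = sphint (\<lambda>u. \<Sum>m\<le>n div 2. of_real (fh_coeff CARD('n) n m) * sh_proj (n - 2 * m) f u)"
    by (intro Bochner_Integration.integral_cong) (simp_all add: power_transform_eq_sum_sh_proj)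
  also have "\<dots> = (\<Sum>m\<le>n div 2. if n - 2 * m = 0 then of_real (fh_coeff CARD('n) n m) * sphint f else 0)"
    by (simp add: Bochner_Integration.integral_sum[OF integrable] sphint_sh_proj if_distrib cong: if_cong)
  also have "\<dots> = (\<Sum>m\<le>n div 2. if even n \<and> m = n div 2 then of_real (fh_coeff CARD('n) n m) * sphint f else 0)"
    by (intro sum.cong refl if_cong) (simp, presburger)
  finally show ?thesis by simp
qed

lemma sphint_norm_sh_proj_le:
  assumes B_bound: "B > 0" "\<And>u. norm u = 1 \<Longrightarrow> cmod (f u) \<le> B"
  shows "sphint (\<lambda>u. cmod (sh_proj j f u)) \<le> B * fh_coeff CARD('n) 0 0"
proof -
  define p where "p = sh_proj j f"
  have harm_p: "p \<in> harm j" by (simp add: p_def sh_proj_harm)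
  note continuous_p = continuous_on_harm[OF harm_p]
  let ?I = "sphint (\<lambda>u. cmod (p u))"
  have int_p: "integrable sphere_measure (\<lambda>u. cmod (p u))"
    and int_p_sq: "integrable sphere_measure (\<lambda>u. (cmod (p u))\<^sup>2)"
    and int_fp: "integrable sphere_measure (\<lambda>u. f u * cnj (p u))"
    by (intro integrable_sphere_continuous continuous_intros continuous_p cont_f)+
  have "of_real (sphint (\<lambda>u. (cmod (p u))\<^sup>2)) = sphint (\<lambda>u. f u * cnj (p u))"
    using sphint_sh_proj_mult[OF harm_cnj[OF harm_p]]
    by (simp only: integral_complex_of_real[symmetric] complex_norm_square p_def[symmetric])
  then have "\<bar>sphint (\<lambda>u. (cmod (p u))\<^sup>2)\<bar> = cmod (sphint (\<lambda>u. f u * cnj (p u)))"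
    by (metis norm_of_real)
  also have "\<dots> \<le> sphint (\<lambda>u. cmod (f u * cnj (p u)))" by (rule integral_norm_bound)
  also have "\<dots> \<le> sphint (\<lambda>u. B * cmod (p u))"
    by (intro integral_mono integrable_norm int_fp integrable_mult_right int_p)
       (auto simp: norm_mult intro!: mult_right_mono B_bound)
  finally have norm_sq: "sphint (\<lambda>u. (cmod (p u))\<^sup>2) \<le> B * ?I" by simp
  \<comment> \<open>Together with the previous bound this replaces the Cauchy--Schwarz inequality.\<close>
  have "0 \<le> sphint (\<lambda>u. (cmod (p u) - B)\<^sup>2)" by (rule integral_nonneg_AE) simp
  also have "\<dots> = sphint (\<lambda>u. (cmod (p u))\<^sup>2 - 2 * B * cmod (p u) + B\<^sup>2)"
    by (simp add: power2_diff algebra_simps)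
  also have "\<dots> = sphint (\<lambda>u. (cmod (p u))\<^sup>2) - 2 * B * ?I + B\<^sup>2 * fh_coeff CARD('n) 0 0"
    using int_p int_p_sq integrable_sphere_hpoly[OF harm_hpoly[OF harm_p]] measure_sphere[where 'n='n]
    by simp
  finally have "B * ?I \<le> B * (B * fh_coeff CARD('n) 0 0)" using norm_sq by (simp add: power2_eq_square)
  then show ?thesis using B_bound by (simp add: p_def)
qed

lemma norm_sh_proj_le:
  assumes B_bound: "B > 0" "\<And>u. norm u = 1 \<Longrightarrow> cmod (f u) \<le> B" and norm_y_le: "norm y \<le> 1"
  shows "cmod (sh_proj j f y) \<le> real CARD('n) ^ j * B"
proof -
  let ?p = "sh_proj j f" and ?c = "fh_coeff CARD('n) j 0"
  have coeff_pos: "?c > 0" by (intro fh_coeff_pos) auto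
  note continuous_p = continuous_on_harm[OF sh_proj_harm]
  have "?c * cmod (?p y) = cmod (sphint (\<lambda>u. of_real (y \<bullet> u) ^ j * ?p u))"
    unfolding funk_hecke_power[OF dim sh_proj_harm] using coeff_pos by (simp add: norm_mult)
  also have "\<dots> \<le> sphint (\<lambda>u. cmod (of_real (y \<bullet> u) ^ j * ?p u))" by (rule integral_norm_bound)
  also have "\<dots> \<le> sphint (\<lambda>u. cmod (?p u))"
  proof (rule integral_mono)
    fix u :: "real^'n" assume "u \<in> space sphere_measure"
    then have "\<bar>y \<bullet> u\<bar> ^ j \<le> 1" using Cauchy_Schwarz_ineq2[of y u] norm_y_le by (intro power_le_one) auto
    then show "cmod (of_real (y \<bullet> u) ^ j * ?p u) \<le> cmod (?p u)"
      by (simp add: norm_mult norm_power mult_left_le_one_le)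
  qed (intro integrable_norm integrable_sphere_inner_power_mult integrable_sphere_continuous continuous_p)+
  also have "\<dots> \<le> B * fh_coeff CARD('n) 0 0" by (rule sphint_norm_sh_proj_le[OF B_bound])
  also have "\<dots> \<le> B * (real CARD('n) ^ j * ?c)"
    using fh_coeff_0_le[OF dim, of j] B_bound by (intro mult_left_mono) auto
  finally have "?c * cmod (?p y) \<le> ?c * (real CARD('n) ^ j * B)" by (simp add: mult_ac)
  then show ?thesis using coeff_pos by simp
qed

end

section \<open>Fourier inversion\<close>

lemma min_1_mult_infdist_tendsto_indicator:
  fixes U :: "'a::metric_space set"
  assumes "open U" "- U \<noteq> {}"
  shows "(\<lambda>k. min 1 (real k * infdist x (- U))) \<longlonglongrightarrow> indicator U x"
proof (cases "x \<in> U")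
  case True
  then have "infdist x (- U) > 0"
    using assms by (metis ComplD closed_Compl in_closed_iff_infdist_zero infdist_nonneg less_le)
  have "\<forall>\<^sub>F k in sequentially. min 1 (real k * infdist x (- U)) = 1"
  proof (rule eventually_sequentiallyI)
    fix k assume "k \<ge> nat \<lceil>1 / infdist x (- U)\<rceil>"
    then have "1 / infdist x (- U) \<le> real k" by linarith
    then show "min 1 (real k * infdist x (- U)) = 1" using \<open>infdist x (- U) > 0\<close> by (simp add: field_simps)
  qed
  then show ?thesis using True by (simp add: tendsto_eventually)
next
  case False
  then show ?thesis using assms by (simp add: infdist_zero)
qed

lemma emeasure_eq_SUP_nn_integral_infdist:
  fixes U :: "'a::metric_space set"
  assumes "open U" "- U \<noteq> {}" and sets: "sets M = sets borel"
  shows "emeasure M U = (SUP k. \<integral>\<^sup>+x. ennreal (min 1 (real k * infdist x (- U))) \<partial>M)"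
proof -
  define f where "f k x = ennreal (min 1 (real k * infdist x (- U)))" for k x
  have inc: "incseq f"
    unfolding f_def by (intro incseq_SucI le_funI ennreal_leI min.mono mult_right_mono)
       (auto simp: infdist_nonneg)
  have "f k \<in> borel_measurable M" for k
    unfolding f_def[abs_def] measurable_cong_sets[OF sets refl]
    by (rule measurable_compose[OF borel_measurable_continuous_onI measurable_ennreal])
       (intro continuous_intros)
  note sup_integral = nn_integral_monotone_convergence_SUP[OF inc this]
  have "(SUP k. f k x) = indicator U x" for x
  proof (rule LIMSEQ_unique[OF LIMSEQ_SUP])
    show "incseq (\<lambda>k. f k x)" using inc by (simp add: incseq_def le_fun_def)
    have "(\<lambda>k. f k x) \<longlonglongrightarrow> ennreal (indicator U x)"
      unfolding f_def by (rule tendsto_ennrealI[OF min_1_mult_infdist_tendsto_indicator[OF assms(1,2)]])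
    then show "(\<lambda>k. f k x) \<longlonglongrightarrow> indicator U x" by (simp add: ennreal_indicator)
  qed
  then have "emeasure M U = (SUP k. \<integral>\<^sup>+x. f k x \<partial>M)"
    using sup_integral \<open>open U\<close> by (simp add: sets)
  then show ?thesis by (simp add: f_def)
qed

lemma measure_eqI_nn_integral_continuous:
  fixes M N :: "'a::euclidean_space measure"
  assumes "finite_measure M" and sets: "sets M = sets borel" "sets N = sets borel"
    and nn_integral_eq: "\<And>f. continuous_on UNIV f \<Longrightarrow> (\<And>x. 0 \<le> f x \<and> f x \<le> 1) \<Longrightarrow> bounded {x. f x \<noteq> 0}
                \<Longrightarrow> (\<integral>\<^sup>+x. ennreal (f x) \<partial>M) = (\<integral>\<^sup>+x. ennreal (f x) \<partial>N)"
  shows "M = N"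
proof -
  interpret finite_measure M by fact
  let ?E = "range (\<lambda>(a, b). box a b :: 'a set)"
  have emeasure_eq: "emeasure M U = emeasure N U" if open_U: "open U" "bounded U" for U
  proof -
    have nonempty: "- U \<noteq> {}" using open_U(2) not_bounded_UNIV[where 'a='a]
      by (metis Compl_empty_eq double_compl)
    have "(\<integral>\<^sup>+x. ennreal (min 1 (real k * infdist x (- U))) \<partial>M)
        = (\<integral>\<^sup>+x. ennreal (min 1 (real k * infdist x (- U))) \<partial>N)" for k
    proof (rule nn_integral_eq)
      show "continuous_on UNIV (\<lambda>x. min 1 (real k * infdist x (- U)))" by (intro continuous_intros)
      show "bounded {x. min 1 (real k * infdist x (- U)) \<noteq> 0}"
        by (rule bounded_subset[OF open_U(2)]) (rule subsetI, rule ccontr, simp add: infdist_zero)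
    qed (auto simp: infdist_nonneg)
    then show ?thesis
      by (simp add: emeasure_eq_SUP_nn_integral_infdist[OF open_U(1) nonempty] sets)
  qed
  show ?thesis
  proof (rule measure_eqI_generator_eq[where E="?E" and \<Omega>=UNIV and A="\<lambda>n::nat. box (- (real n *\<^sub>R One)) (real n *\<^sub>R One)"])
    show "Int_stable ?E" by (auto simp: Int_stable_def box_Int_box)
    show "sets M = sigma_sets UNIV ?E" "sets N = sigma_sets UNIV ?E"
      by (simp_all add: borel_eq_box sets)
    show "(\<Union>n::nat. box (- (real n *\<^sub>R One)) (real n *\<^sub>R One)) = (UNIV :: 'a set)"
      unfolding UN_box_eq_UNIV ..
  qed (auto intro!: emeasure_eq simp: emeasure_finite)
qed

definition inv_fourier :: "('a::euclidean_space \<Rightarrow> complex) \<Rightarrow> 'a \<Rightarrow> complex" where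
  "inv_fourier \<phi> x = of_real (1 / (2 * pi) ^ DIM('a)) * (\<integral>z. cis (- (x \<bullet> z)) * \<phi> z \<partial>lborel)"

lemma borel_measurable_inv_fourier:
  assumes [measurable]: "\<phi> \<in> borel_measurable borel"
  shows "inv_fourier \<phi> \<in> borel_measurable borel"
proof -
  have "(\<lambda>x. \<integral>z. cis (- (x \<bullet> z)) * \<phi> z \<partial>lborel) \<in> borel_measurable borel"
    by (rule sigma_finite_measure.borel_measurable_lebesgue_integral[OF sigma_finite_lborel]) measurable
  then show ?thesis unfolding inv_fourier_def[abs_def] by measurable
qed

lemma norm_inv_fourier_le:
  "norm (inv_fourier \<phi> (x :: 'a::euclidean_space)) \<le> 1 / (2 * pi) ^ DIM('a) * (\<integral>z. norm (\<phi> z) \<partial>lborel)"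
proof -
  have "norm (\<integral>z. cis (- (x \<bullet> z)) * \<phi> z \<partial>lborel) \<le> (\<integral>z. norm (cis (- (x \<bullet> z)) * \<phi> z) \<partial>lborel)"
    by (rule integral_norm_bound)
  then show ?thesis
    unfolding inv_fourier_def norm_mult norm_of_real by (simp add: divide_right_mono)
qed

lemma gauss_average_tendsto:
  fixes f :: "'a::euclidean_space \<Rightarrow> real"
  assumes cont_f: "continuous_on UNIV f" and f_bound: "\<And>x. \<bar>f x\<bar> \<le> B" and s_lim: "s \<longlonglongrightarrow> 0"
  shows "(\<lambda>k. \<integral>v. f (y + s k *\<^sub>R v) * gauss v \<partial>lborel) \<longlonglongrightarrow> f y"
proof -
  have [measurable]: "f \<in> borel_measurable borel" using cont_f by (rule borel_measurable_continuous_onI)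
  have "(\<lambda>k. \<integral>v. f (y + s k *\<^sub>R v) * gauss v \<partial>lborel) \<longlonglongrightarrow> (\<integral>v. f y * gauss (v :: 'a) \<partial>lborel)"
  proof (rule integral_dominated_convergence[where w="\<lambda>v. B * gauss v"])
    show "AE v in lborel. (\<lambda>k. f (y + s k *\<^sub>R v) * gauss v) \<longlonglongrightarrow> f y * gauss v"
    proof (rule AE_I2)
      fix v :: 'a
      have "(\<lambda>k. y + s k *\<^sub>R v) \<longlonglongrightarrow> y + 0 *\<^sub>R v" by (intro tendsto_intros s_lim)
      then have "(\<lambda>k. f (y + s k *\<^sub>R v)) \<longlonglongrightarrow> f (y + 0 *\<^sub>R v)"
        by (intro continuous_on_tendsto_compose[OF cont_f]) auto
      then show "(\<lambda>k. f (y + s k *\<^sub>R v) * gauss v) \<longlonglongrightarrow> f y * gauss v"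
        by (intro tendsto_intros) simp
    qed
    show "AE v in lborel. norm (f (y + s k *\<^sub>R v) * gauss v) \<le> B * gauss v" for k
      by (auto simp: abs_mult intro!: mult_right_mono f_bound)
  qed (use integrable_gauss in auto)
  then show ?thesis by (simp add: integral_gauss)
qed

lemma gauss_average_le:
  fixes f :: "'a::euclidean_space \<Rightarrow> real"
  assumes f_bound: "\<And>x. \<bar>f x\<bar> \<le> B"
  shows "\<bar>\<integral>v. f (y + s *\<^sub>R v) * gauss v \<partial>lborel\<bar> \<le> B"
proof (cases "integrable lborel (\<lambda>v. f (y + s *\<^sub>R v) * gauss v)")
  case True
  then have "norm (\<integral>v. f (y + s *\<^sub>R v) * gauss v \<partial>lborel) \<le> (\<integral>v. B * gauss (v :: 'a) \<partial>lborel)"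
    by (rule Bochner_Integration.integral_norm_bound_integral)
       (auto intro!: integrable_gauss mult_right_mono f_bound simp: abs_mult)
  then show ?thesis by (simp add: integral_gauss)
next
  case False
  then show ?thesis using f_bound[of y]
    by (simp add: not_integrable_integral_eq order_trans[OF abs_ge_zero])
qed

locale fourier_pair = prob_space \<mu> for \<mu> :: "'a::euclidean_space measure" +
  fixes \<phi> :: "'a \<Rightarrow> complex"
  assumes sets_\<mu> [measurable_cong, simp]: "sets \<mu> = sets borel"
    and charf: "\<And>z. \<phi> z = (\<integral>x. cis (z \<bullet> x) \<partial>\<mu>)"
    and integrable_\<phi>: "integrable lborel \<phi>"
begin

definition damped :: "real \<Rightarrow> 'a \<Rightarrow> complex" where
  "damped s z = exp (- (norm (s *\<^sub>R z))\<^sup>2 / 2) *\<^sub>R \<phi> z"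

lemma borel_measurable_\<phi> [measurable]: "\<phi> \<in> borel_measurable borel"
  using borel_measurable_integrable[OF integrable_\<phi>] by simp

lemma borel_measurable_damped [measurable]: "damped s \<in> borel_measurable borel"
  unfolding damped_def[abs_def] by measurable

lemma borel_measurable_\<mu>: "f \<in> borel_measurable borel \<Longrightarrow> f \<in> borel_measurable \<mu>"
  unfolding measurable_cong_sets[OF sets_\<mu> refl] .

lemma borel_measurable_lborel_pair_\<mu>:
  "f \<in> borel_measurable (borel \<Otimes>\<^sub>M borel) \<Longrightarrow> f \<in> borel_measurable (lborel \<Otimes>\<^sub>M \<mu>)"
  unfolding measurable_cong_sets[OF sets_pair_measure_cong[OF sets_lborel sets_\<mu>] refl] .

lemma norm_damped_le: "norm (damped s z) \<le> norm (\<phi> z)"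
  by (simp add: damped_def mult_left_le_one_le)

lemma norm_inv_fourier_damped_le:
  "norm (inv_fourier (damped s) x) \<le> 1 / (2 * pi) ^ DIM('a) * (\<integral>z. norm (\<phi> z) \<partial>lborel)"
proof -
  have "integrable lborel (damped s)"
    by (rule Bochner_Integration.integrable_bound[OF integrable_\<phi>]) (auto simp: norm_damped_le)
  then have "(\<integral>z. norm (damped s z) \<partial>lborel) \<le> (\<integral>z. norm (\<phi> z) \<partial>lborel)"
    by (intro integral_mono integrable_norm integrable_\<phi> norm_damped_le)
  then show ?thesis
    by (intro order_trans[OF norm_inv_fourier_le] mult_left_mono) auto
qed

lemma inv_fourier_damped_eq:
  assumes s_pos: "s > 0"
  shows "inv_fourier (damped s) x = of_real (\<integral>y. gauss_kernel s (y - x) \<partial>\<mu>)"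
proof -
  interpret pair: pair_sigma_finite "lborel :: 'a measure" \<mu> ..
  let ?e = "\<lambda>z::'a. exp (- (norm (s *\<^sub>R z))\<^sup>2 / 2)"
  have integrable: "integrable (lborel \<Otimes>\<^sub>M \<mu>) (\<lambda>(z, y). ?e z *\<^sub>R cis (z \<bullet> (y - x)))"
  proof (rule pair.Fubini_integrable)
    show "integrable lborel (\<lambda>z. \<integral>y. norm (case (z, y) of (z, y) \<Rightarrow> ?e z *\<^sub>R cis (z \<bullet> (y - x))) \<partial>\<mu>)"
      using integrable_exp_neg_norm_sq[of s, where 'a='a] s_pos by (simp add: prob_space)
    have "(\<lambda>y. cis (z \<bullet> (y - x))) \<in> borel_measurable \<mu>" for z
      by (rule borel_measurable_\<mu>) measurable
    then show "AE z in lborel. integrable \<mu> (\<lambda>y. case (z, y) of (z, y) \<Rightarrow> ?e z *\<^sub>R cis (z \<bullet> (y - x)))"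
      by (intro AE_I2) (auto intro!: integrable_const_bound[where B=1])
  qed (rule borel_measurable_lborel_pair_\<mu>, measurable)
  have "cis (- (x \<bullet> z)) * damped s z = (\<integral>y. ?e z *\<^sub>R cis (z \<bullet> (y - x)) \<partial>\<mu>)" for z
  proof -
    have "cis (- (x \<bullet> z)) * damped s z = ?e z *\<^sub>R (\<integral>y. cis (- (x \<bullet> z)) * cis (z \<bullet> y) \<partial>\<mu>)"
      unfolding damped_def charf by simp
    then show ?thesis by (simp add: cis_mult inner_diff_right inner_commute)
  qed
  then have "(\<integral>z. cis (- (x \<bullet> z)) * damped s z \<partial>lborel) = (\<integral>y. \<integral>z. ?e z *\<^sub>R cis (z \<bullet> (y - x)) \<partial>lborel \<partial>\<mu>)"
    using pair.Fubini_integral[OF integrable] by simp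
  also have "\<dots> = of_real ((2 * pi) ^ DIM('a) * (\<integral>y. gauss_kernel s (y - x) \<partial>\<mu>))"
    by (simp only: fourier_transform_exp_neg_norm_sq[OF s_pos] integral_complex_of_real
      integral_mult_right_zero)
  finally show ?thesis unfolding inv_fourier_def by simp
qed

lemma inv_fourier_damped_tendsto:
  assumes s_lim: "s \<longlonglongrightarrow> 0"
  shows "(\<lambda>k. inv_fourier (damped (s k)) x) \<longlonglongrightarrow> inv_fourier \<phi> x"
  unfolding inv_fourier_def
proof (intro tendsto_mult tendsto_const integral_dominated_convergence[where w="\<lambda>z. norm (\<phi> z)"])
  have "(\<lambda>k. damped (s k) z) \<longlonglongrightarrow> exp (- (norm (0 *\<^sub>R z))\<^sup>2 / 2) *\<^sub>R \<phi> z" for z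
    unfolding damped_def by (intro tendsto_intros s_lim) auto
  then show "AE z in lborel. (\<lambda>k. cis (- (x \<bullet> z)) * damped (s k) z) \<longlonglongrightarrow> cis (- (x \<bullet> z)) * \<phi> z"
    by (intro AE_I2 tendsto_mult tendsto_const) simp
  show "AE z in lborel. norm (cis (- (x \<bullet> z)) * damped (s k) z) \<le> norm (\<phi> z)" for k
    by (simp add: norm_mult norm_damped_le)
qed (auto intro: integrable_\<phi>)

lemma
  shows Im_inv_fourier: "Im (inv_fourier \<phi> x) = 0"
    and Re_inv_fourier_nonneg: "Re (inv_fourier \<phi> x) \<ge> 0"
proof -
  let ?s = "\<lambda>k. inverse (real (Suc k))"
  note lim = inv_fourier_damped_tendsto[OF LIMSEQ_inverse_real_of_nat, of x]
  have smoothed: "inv_fourier (damped (?s k)) x = of_real (\<integral>y. gauss_kernel (?s k) (y - x) \<partial>\<mu>)" for k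
    by (rule inv_fourier_damped_eq) simp
  have "(\<lambda>k. Im (inv_fourier (damped (?s k)) x)) \<longlonglongrightarrow> Im (inv_fourier \<phi> x)"
    by (intro tendsto_intros lim)
  then show "Im (inv_fourier \<phi> x) = 0" by (simp only: smoothed Im_complex_of_real LIMSEQ_const_iff)
  have "(\<lambda>k. Re (inv_fourier (damped (?s k)) x)) \<longlonglongrightarrow> Re (inv_fourier \<phi> x)"
    by (intro tendsto_intros lim)
  moreover have "Re (inv_fourier (damped (?s k)) x) \<ge> 0" for k
    unfolding smoothed Re_complex_of_real by (intro integral_nonneg_AE AE_I2 gauss_kernel_nonneg) simp
  ultimately show "Re (inv_fourier \<phi> x) \<ge> 0" by (intro LIMSEQ_le_const) auto
qed

lemma integrable_mult_gauss_kernel: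
  assumes s_pos: "s > 0" and integrable_f: "integrable lborel f"
  shows "integrable (lborel \<Otimes>\<^sub>M \<mu>) (\<lambda>(x, y). f x * gauss_kernel s (y - x))"
proof (rule Bochner_Integration.integrable_bound)
  let ?B = "(1 / sqrt (2 * pi)) ^ DIM('a) / s ^ DIM('a)"
  have [measurable]: "f \<in> borel_measurable borel" using borel_measurable_integrable[OF integrable_f] by simp
  have "integrable (distr (lborel \<Otimes>\<^sub>M \<mu>) lborel fst) f" unfolding distr_pair_fst by (rule integrable_f)
  then have "integrable (lborel \<Otimes>\<^sub>M \<mu>) (\<lambda>y. f (fst y))" by (rule integrable_distr[OF measurable_fst])
  then show "integrable (lborel \<Otimes>\<^sub>M \<mu>) (\<lambda>y. f (fst y) * ?B)" by (rule integrable_mult_left)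
  show "(\<lambda>(x, y). f x * gauss_kernel s (y - x)) \<in> borel_measurable (lborel \<Otimes>\<^sub>M \<mu>)"
    by (rule borel_measurable_lborel_pair_\<mu>) measurable
  have "\<bar>gauss_kernel s w\<bar> \<le> \<bar>?B\<bar>" for w :: 'a
    using gauss_kernel_nonneg[OF s_pos, of w] gauss_kernel_le[OF s_pos, of w] by linarith
  then have "\<bar>f x\<bar> * \<bar>gauss_kernel s (y - x)\<bar> \<le> \<bar>f x\<bar> * \<bar>?B\<bar>" for x y
    by (intro mult_left_mono) auto
  then show "AE y in lborel \<Otimes>\<^sub>M \<mu>. norm (case y of (x, y) \<Rightarrow> f x * gauss_kernel s (y - x))
      \<le> norm (f (fst y) * ?B)"
    by (intro AE_I2) (simp add: split_beta abs_mult)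
qed

lemma integral_mult_inv_fourier_damped:
  assumes s_pos: "s > 0" and integrable_f: "integrable lborel f"
  shows "(\<integral>x. f x * Re (inv_fourier (damped s) x) \<partial>lborel) = (\<integral>y. \<integral>v. f (y + s *\<^sub>R v) * gauss v \<partial>lborel \<partial>\<mu>)"
proof -
  interpret pair: pair_sigma_finite "lborel :: 'a measure" \<mu> ..
  have [measurable]: "f \<in> borel_measurable borel" using borel_measurable_integrable[OF integrable_f] by simp
  have average: "(\<integral>x. f x * gauss_kernel s (y - x) \<partial>lborel) = (\<integral>v. f (y + s *\<^sub>R v) * gauss v \<partial>lborel)" for y
  proof -
    have "(\<integral>x. f x * gauss_kernel s (y - x) \<partial>lborel)
        = \<bar>s\<bar> ^ DIM('a) *\<^sub>R (\<integral>v. f (y + s *\<^sub>R v) * gauss_kernel s (y - (y + s *\<^sub>R v)) \<partial>lborel)"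
      using s_pos by (intro integral_lborel_affine) auto
    also have "\<dots> = (\<integral>v. f (y + s *\<^sub>R v) * (s ^ DIM('a) * gauss_kernel s (- (s *\<^sub>R v))) \<partial>lborel)"
      using s_pos by (simp flip: integral_mult_right_zero add: mult.left_commute)
    finally show ?thesis by (simp only: gauss_kernel_scaleR[OF s_pos])
  qed
  have "(\<integral>x. f x * Re (inv_fourier (damped s) x) \<partial>lborel)
      = (\<integral>x. \<integral>y. f x * gauss_kernel s (y - x) \<partial>\<mu> \<partial>lborel)"
    by (simp add: inv_fourier_damped_eq[OF s_pos])
  also have "\<dots> = (\<integral>y. \<integral>x. f x * gauss_kernel s (y - x) \<partial>lborel \<partial>\<mu>)"
    using pair.Fubini_integral[OF integrable_mult_gauss_kernel[OF s_pos integrable_f]] by simp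
  finally show ?thesis unfolding average .
qed

lemma integral_mult_inv_fourier:
  assumes cont_f: "continuous_on UNIV f" and integrable_f: "integrable lborel f"
    and f_bound: "\<And>x. \<bar>f x\<bar> \<le> B"
  shows "(\<integral>x. f x * Re (inv_fourier \<phi> x) \<partial>lborel) = integral\<^sup>L \<mu> f"
proof (rule LIMSEQ_unique)
  let ?s = "\<lambda>k. inverse (real (Suc k))"
  have [measurable]: "f \<in> borel_measurable borel" using borel_measurable_integrable[OF integrable_f] by simp
  note [measurable] = borel_measurable_inv_fourier[OF borel_measurable_damped]
    borel_measurable_inv_fourier[OF borel_measurable_\<phi>]
  define C where "C = 1 / (2 * pi) ^ DIM('a) * (\<integral>z. norm (\<phi> z) \<partial>lborel)"
  show "(\<lambda>k. \<integral>x. f x * Re (inv_fourier (damped (?s k)) x) \<partial>lborel) \<longlonglongrightarrow> (\<integral>x. f x * Re (inv_fourier \<phi> x) \<partial>lborel)"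
  proof (rule integral_dominated_convergence[where w="\<lambda>x. \<bar>f x\<bar> * C"])
    show "AE x in lborel. (\<lambda>k. f x * Re (inv_fourier (damped (?s k)) x)) \<longlonglongrightarrow> f x * Re (inv_fourier \<phi> x)"
      by (intro AE_I2 tendsto_intros inv_fourier_damped_tendsto LIMSEQ_inverse_real_of_nat)
    have "\<bar>Re (inv_fourier (damped s) x)\<bar> \<le> C" for s x
      unfolding C_def by (rule order_trans[OF abs_Re_le_cmod norm_inv_fourier_damped_le])
    then show "AE x in lborel. norm (f x * Re (inv_fourier (damped (?s k)) x)) \<le> \<bar>f x\<bar> * C" for k
      by (intro AE_I2) (simp add: abs_mult mult_left_mono)
  qed (use integrable_f in auto)
  have s_pos: "?s k > 0" for k by simp
  show "(\<lambda>k. \<integral>x. f x * Re (inv_fourier (damped (?s k)) x) \<partial>lborel) \<longlonglongrightarrow> integral\<^sup>L \<mu> f"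
    unfolding integral_mult_inv_fourier_damped[OF s_pos integrable_f]
  proof (rule integral_dominated_convergence[where w="\<lambda>_. B"])
    show "AE y in \<mu>. (\<lambda>k. \<integral>v. f (y + ?s k *\<^sub>R v) * gauss v \<partial>lborel) \<longlonglongrightarrow> f y"
      by (intro AE_I2 gauss_average_tendsto[OF cont_f f_bound] LIMSEQ_inverse_real_of_nat)
    show "AE y in \<mu>. norm (\<integral>v. f (y + ?s k *\<^sub>R v) * gauss v \<partial>lborel) \<le> B" for k
      unfolding real_norm_def by (intro AE_I2 gauss_average_le f_bound)
    show "(\<lambda>y. \<integral>v. f (y + ?s k *\<^sub>R v) * gauss v \<partial>lborel) \<in> borel_measurable \<mu>" for k
      by (rule sigma_finite_measure.borel_measurable_lebesgue_integral[OF sigma_finite_lborel]) measurable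
  qed (use borel_measurable_\<mu>[of f] in auto)
qed

theorem fourier_inversion: "\<mu> = density lborel (\<lambda>x. ennreal (Re (inv_fourier \<phi> x)))"
proof (rule measure_eqI_nn_integral_continuous)
  show "finite_measure \<mu>" by unfold_locales
  note [measurable] = borel_measurable_inv_fourier[OF borel_measurable_\<phi>]
  fix f :: "'a \<Rightarrow> real"
  assume cont: "continuous_on UNIV f" and range: "\<And>x. 0 \<le> f x \<and> f x \<le> 1" and bdd: "bounded {x. f x \<noteq> 0}"
  have [measurable]: "f \<in> borel_measurable borel" using cont by (rule borel_measurable_continuous_onI)
  have "integrable lborel (indicator {x. f x \<noteq> 0} :: 'a \<Rightarrow> real)"
    using emeasure_bounded_finite[OF bdd] by (simp add: integrable_indicator_iff)
  then have integrable_f: "integrable lborel f"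
    by (rule Bochner_Integration.integrable_bound) (use range in \<open>auto split: split_indicator\<close>)
  define C where "C = 1 / (2 * pi) ^ DIM('a) * (\<integral>z. norm (\<phi> z) \<partial>lborel)"
  have "\<bar>Re (inv_fourier \<phi> x)\<bar> \<le> C" for x
    unfolding C_def by (rule order_trans[OF abs_Re_le_cmod norm_inv_fourier_le])
  then have "norm (f x * Re (inv_fourier \<phi> x)) \<le> norm (f x * C)" for x
    using range by (auto simp: abs_mult intro!: mult_left_mono order_trans[OF _ abs_ge_self])
  then have integrable_f_inv: "integrable lborel (\<lambda>x. f x * Re (inv_fourier \<phi> x))"
    by (intro Bochner_Integration.integrable_bound[OF integrable_mult_left[OF integrable_f]]) auto
  have "(\<integral>\<^sup>+x. ennreal (f x) \<partial>\<mu>) = ennreal (integral\<^sup>L \<mu> f)"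
    using range by (intro nn_integral_eq_integral integrable_const_bound[where B=1])
       (auto intro: borel_measurable_\<mu>)
  also have "\<dots> = ennreal (\<integral>x. f x * Re (inv_fourier \<phi> x) \<partial>lborel)"
    using integral_mult_inv_fourier[OF cont integrable_f, of 1] range by simp
  also have "\<dots> = (\<integral>\<^sup>+x. ennreal (f x * Re (inv_fourier \<phi> x)) \<partial>lborel)"
    using range Re_inv_fourier_nonneg by (intro nn_integral_eq_integral[symmetric] integrable_f_inv) auto
  also have "\<dots> = (\<integral>\<^sup>+x. ennreal (f x) \<partial>density lborel (\<lambda>x. ennreal (Re (inv_fourier \<phi> x))))"
    using range Re_inv_fourier_nonneg by (subst nn_integral_density) (auto simp: ennreal_mult mult.commute)
  finally show "(\<integral>\<^sup>+x. ennreal (f x) \<partial>\<mu>)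
      = (\<integral>\<^sup>+x. ennreal (f x) \<partial>density lborel (\<lambda>x. ennreal (Re (inv_fourier \<phi> x))))" .
qed simp_all

end

section \<open>Double series and their integrals\<close>

lemma
  fixes f :: "nat \<Rightarrow> nat \<Rightarrow> 'a::banach"
  assumes has_sum_S: "((\<lambda>(n, k). f n k) has_sum S) UNIV"
  shows summable_has_sum_prod: "summable (f n)"
    and sums_has_sum_prod: "(\<lambda>n. \<Sum>k. f n k) sums S"
proof -
  have f_Sigma: "((\<lambda>(n, k). f n k) has_sum S) (Sigma UNIV (\<lambda>_. UNIV))" using has_sum_S by simp
  have row: "f n summable_on UNIV" for n
  proof -
    have "(\<lambda>(n, k). f n k) summable_on range (Pair n)"
      by (rule summable_on_subset_banach[OF has_sum_imp_summable[OF has_sum_S]]) simp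
    then show ?thesis by (simp add: summable_on_reindex inj_on_def o_def)
  qed
  then show "summable (f n)" by (rule summable_on_imp_summable)
  have "(f n has_sum (\<Sum>k. f n k)) UNIV" for n
    using has_sum_infsum[OF row[of n]] has_sum_imp_sums sums_unique by metis
  then have "((\<lambda>n. \<Sum>k. f n k) has_sum S) UNIV"
    by (intro has_sum_SigmaD[OF f_Sigma]) simp
  then show "(\<lambda>n. \<Sum>k. f n k) sums S" by (rule has_sum_imp_sums)
qed

lemma has_sum_Times_mult:
  fixes f :: "'a \<Rightarrow> 'c::{real_normed_field, banach}" and g :: "'b \<Rightarrow> 'c"
  assumes f_sum: "(f has_sum a) A" "f abs_summable_on A" and g_sum: "(g has_sum b) B" "g abs_summable_on B"
  shows "((\<lambda>(x, y). f x * g y) has_sum (a * b)) (A \<times> B)"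
proof (rule has_sum_SigmaI)
  show "((\<lambda>y. (\<lambda>(x, y). f x * g y) (x, y)) has_sum f x * b) B" for x
    using has_sum_cmult_right[OF g_sum(1)] by simp
  show "((\<lambda>x. f x * b) has_sum a * b) A"
    by (rule has_sum_cmult_left[OF f_sum(1)])
  have "(\<lambda>p. norm (case p of (x, y) \<Rightarrow> f x * g y)) summable_on (A \<times> B)"
  proof (rule summable_on_SigmaI)
    show "((\<lambda>y. norm (case (x, y) of (x, y) \<Rightarrow> f x * g y)) has_sum norm (f x) * (\<Sum>\<^sub>\<infinity>y\<in>B. norm (g y))) B"
      for x
      using has_sum_cmult_right[OF has_sum_infsum[OF g_sum(2)]] by (simp add: norm_mult)
    show "(\<lambda>x. norm (f x) * (\<Sum>\<^sub>\<infinity>y\<in>B. norm (g y))) summable_on A"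
      by (rule summable_on_cmult_left[OF f_sum(2)])
  qed simp
  then show "(\<lambda>(x, y). f x * g y) summable_on A \<times> B" by (rule abs_summable_summable)
qed

lemma
  fixes x :: "'a::{real_normed_field, banach}"
  shows has_sum_exp: "((\<lambda>n. x ^ n / fact n) has_sum exp x) UNIV"
    and abs_summable_on_exp: "(\<lambda>n. x ^ n / fact n) abs_summable_on UNIV"
proof -
  have scaleR: "x ^ n /\<^sub>R fact n = x ^ n / fact n" for n by (simp add: scaleR_conv_of_real field_simps)
  have norm_summable: "summable (\<lambda>n. norm (x ^ n / fact n))"
    using summable_norm_exp[of x] unfolding scaleR .
  then show "(\<lambda>n. x ^ n / fact n) abs_summable_on UNIV"
    by (intro norm_summable_imp_summable_on) simp
  show "((\<lambda>n. x ^ n / fact n) has_sum exp x) UNIV"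
    using norm_summable exp_converges[of x] unfolding scaleR by (rule norm_summable_imp_has_sum)
qed

lemma has_sum_exp_mult_exp:
  fixes x y :: "'a::{real_normed_field, banach}"
  shows "((\<lambda>(n, k). (x ^ n / fact n) * (y ^ k / fact k)) has_sum (exp x * exp y)) UNIV"
  using has_sum_Times_mult[OF has_sum_exp abs_summable_on_exp has_sum_exp abs_summable_on_exp, of x y]
  by simp

lemma has_sum_integral_nat:
  fixes T :: "nat \<Rightarrow> 'a \<Rightarrow> complex"
  assumes integrable_T: "\<And>i. integrable M (T i)"
    and norm_T: "(\<lambda>i. \<integral>z. norm (T i z) \<partial>M) summable_on UNIV"
    and has_sum_S: "AE z in M. ((\<lambda>i. T i z) has_sum S z) UNIV" "S \<in> borel_measurable M"
  shows "((\<lambda>i. integral\<^sup>L M (T i)) has_sum integral\<^sup>L M S) UNIV"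
proof -
  have abs_summable: "AE z in M. summable (\<lambda>i. norm (T i z))"
    using has_sum_S(1) by eventually_elim
      (metis has_sum_imp_summable summable_on_iff_abs_summable_on_complex summable_on_imp_summable)
  have S_eq: "AE z in M. (\<Sum>i. T i z) = S z"
    using has_sum_S(1) by eventually_elim (metis has_sum_imp_sums sums_unique)
  note norm_summable = summable_on_imp_summable[OF norm_T]
  have "(\<integral>z. (\<Sum>i. T i z) \<partial>M) = integral\<^sup>L M S"
    using borel_measurable_integrable[OF integrable_suminf[OF integrable_T abs_summable norm_summable]]
      has_sum_S(2) S_eq
    by (rule integral_cong_AE)
  then have "(\<lambda>i. integral\<^sup>L M (T i)) sums integral\<^sup>L M S"
    using sums_integral[OF integrable_T abs_summable norm_summable] by simp
  moreover have "summable (\<lambda>i. norm (integral\<^sup>L M (T i)))"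
    by (rule summable_comparison_test'[OF norm_summable, of 0]) simp
  ultimately show ?thesis by (intro norm_summable_imp_has_sum)
qed

lemma has_sum_integral:
  fixes T :: "nat \<times> nat \<Rightarrow> 'a \<Rightarrow> complex"
  assumes "\<And>p. integrable M (T p)" "(\<lambda>p. \<integral>z. norm (T p z) \<partial>M) summable_on UNIV"
    and "AE z in M. ((\<lambda>p. T p z) has_sum S z) UNIV" "S \<in> borel_measurable M"
  shows "((\<lambda>p. integral\<^sup>L M (T p)) has_sum integral\<^sup>L M S) UNIV"
proof -
  have reindex: "((\<lambda>i. g (prod_decode i)) has_sum s) UNIV \<longleftrightarrow> (g has_sum s) UNIV"
    for g :: "nat \<times> nat \<Rightarrow> complex" and s
    by (rule has_sum_reindex_bij_betw[OF bij_prod_decode])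
  have "((\<lambda>i. integral\<^sup>L M (T (prod_decode i))) has_sum integral\<^sup>L M S) UNIV"
  proof (rule has_sum_integral_nat)
    show "(\<lambda>i. \<integral>z. norm (T (prod_decode i) z) \<partial>M) summable_on UNIV"
      using assms(2) summable_on_reindex_bij_betw[OF bij_prod_decode, of "\<lambda>p. \<integral>z. norm (T p z) \<partial>M"] by simp
    show "AE z in M. ((\<lambda>i. T (prod_decode i) z) has_sum S z) UNIV"
      using assms(3)
    proof eventually_elim
      case (elim z)
      then show ?case using reindex[of "\<lambda>p. T p z"] by simp
    qed
  qed (use assms in auto)
  then show ?thesis using reindex[of "\<lambda>p. integral\<^sup>L M (T p)"] by simp
qed

lemma summable_on_integral:
  fixes h :: "'i \<Rightarrow> 'a \<Rightarrow> real"
  assumes h_nonneg: "\<And>i. i \<in> A \<Longrightarrow> integrable M (h i)" "\<And>i. i \<in> A \<Longrightarrow> AE z in M. 0 \<le> h i z"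
    and dominated: "integrable M D" "\<And>F. finite F \<Longrightarrow> F \<subseteq> A \<Longrightarrow> AE z in M. (\<Sum>i\<in>F. h i z) \<le> D z"
  shows "(\<lambda>i. integral\<^sup>L M (h i)) summable_on A"
proof (rule nonneg_bdd_above_summable_on)
  show "integral\<^sup>L M (h i) \<ge> 0" if "i \<in> A" for i
    by (rule integral_nonneg_AE[OF h_nonneg(2)[OF that]])
  show "bdd_above (sum (\<lambda>i. integral\<^sup>L M (h i)) ` {F. F \<subseteq> A \<and> finite F})"
  proof (rule bdd_aboveI2)
    fix F assume "F \<in> {F. F \<subseteq> A \<and> finite F}"
    then have finite_F: "finite F" "F \<subseteq> A" by auto
    then have "(\<Sum>i\<in>F. integral\<^sup>L M (h i)) = (\<integral>z. (\<Sum>i\<in>F. h i z) \<partial>M)"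
      using h_nonneg(1) by (intro Bochner_Integration.integral_sum[symmetric]) auto
    also have "\<dots> \<le> integral\<^sup>L M D"
      using finite_F h_nonneg(1) dominated by (intro integral_mono_AE) auto
    finally show "(\<Sum>i\<in>F. integral\<^sup>L M (h i)) \<le> integral\<^sup>L M D" .
  qed
qed

section \<open>The radial coefficients\<close>

definition gamma_coeff :: "real \<Rightarrow> real \<Rightarrow> nat \<Rightarrow> nat \<Rightarrow> nat \<Rightarrow> real" where
  "gamma_coeff \<alpha> R d n k =
     Gamma (real k + (real n + real d) / \<alpha>) / (fact k * R powr (real k + (real n + real d) / \<alpha>))"

lemma gamma_coeff_nonneg: "\<alpha> > 0 \<Longrightarrow> R > 0 \<Longrightarrow> d > 0 \<Longrightarrow> gamma_coeff \<alpha> R d n k \<ge> 0"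
  unfolding gamma_coeff_def
  by (intro divide_nonneg_nonneg less_imp_le[OF Gamma_real_pos]) (auto intro!: add_nonneg_pos)

lemma has_bochner_integral_radial_power_mult_exp:
  assumes \<alpha>_pos: "\<alpha> > 0" and R_pos: "R > 0" and d_pos: "d > 0"
  shows "has_bochner_integral (radial_measure (d - 1)) (\<lambda>r. r ^ n * (r powr \<alpha>) ^ k * exp (- R * r powr \<alpha>))
     (fact k * gamma_coeff \<alpha> R d n k / \<alpha>)"
proof -
  have "has_bochner_integral (radial_measure (d - 1)) (\<lambda>r. r powr (real n + \<alpha> * real k) * exp (- R * r powr \<alpha>))
     (Gamma ((real n + \<alpha> * real k + real (d - 1) + 1) / \<alpha>) /
       (\<alpha> * R powr ((real n + \<alpha> * real k + real (d - 1) + 1) / \<alpha>)))"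
    using \<alpha>_pos R_pos by (intro has_bochner_integral_radial_powr_exp) auto
  moreover have "(real n + \<alpha> * real k + real (d - 1) + 1) / \<alpha> = real k + (real n + real d) / \<alpha>"
    using \<alpha>_pos d_pos by (simp add: of_nat_diff field_simps)
  ultimately have "has_bochner_integral (radial_measure (d - 1)) (\<lambda>r. r powr (real n + \<alpha> * real k) * exp (- R * r powr \<alpha>))
     (fact k * gamma_coeff \<alpha> R d n k / \<alpha>)"
    by (simp add: gamma_coeff_def mult.commute)
  moreover have "AE r in radial_measure (d - 1).
      r powr (real n + \<alpha> * real k) * exp (- R * r powr \<alpha>) = r ^ n * (r powr \<alpha>) ^ k * exp (- R * r powr \<alpha>)"
    using AE_radial_measure_pos by eventually_elim (simp add: powr_add powr_realpow powr_powr[symmetric])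
  ultimately show ?thesis
    by (subst has_bochner_integral_cong_AE[where g="\<lambda>r. r powr (real n + \<alpha> * real k) * exp (- R * r powr \<alpha>)"]) auto
qed

lemma integrable_radial_exp:
  assumes "\<alpha> > 0" "c > 0"
  shows "integrable (radial_measure k) (\<lambda>r. exp (- c * r powr \<alpha>))"
  using has_bochner_integral_radial_power_mult_exp[OF assms, of "Suc k" 0 0]
  by (auto intro: integrable.intros)

lemma mult_le_const_add_powr:
  fixes \<alpha> c K :: real
  assumes \<alpha>_gt_1: "\<alpha> > 1" and c_pos: "c > 0" and K_nonneg: "K \<ge> 0"
  shows "\<exists>b. \<forall>r>0. K * r \<le> b + c * r powr \<alpha>"
proof (intro exI allI impI)
  define r0 where "r0 = (K / c) powr (1 / (\<alpha> - 1))"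
  fix r :: real assume r_pos: "r > 0"
  show "K * r \<le> K * r0 + c * r powr \<alpha>"
  proof (cases "r \<le> r0")
    case True
    then show ?thesis using K_nonneg c_pos by (intro add_increasing2 mult_left_mono) auto
  next
    case False
    have "K / c = r0 powr (\<alpha> - 1)" using \<alpha>_gt_1 K_nonneg c_pos by (simp add: r0_def powr_powr)
    also have "\<dots> \<le> r powr (\<alpha> - 1)" using False \<alpha>_gt_1 by (intro powr_mono2) (auto simp: r0_def)
    finally have "K \<le> c * r powr (\<alpha> - 1)" using c_pos by (simp add: field_simps)
    then have "K * r \<le> c * r powr (\<alpha> - 1) * r" using r_pos by (intro mult_right_mono) auto
    also have "\<dots> = c * r powr \<alpha>" using r_pos by (simp add: powr_diff)
    finally show ?thesis using K_nonneg by (simp add: r0_def add_increasing)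
  qed
qed

lemma integrable_radial_exp_mult:
  assumes \<alpha>_gt_1: "\<alpha> > 1" and q_less: "q < R" and K_nonneg: "K \<ge> 0"
  shows "integrable (radial_measure k) (\<lambda>r. exp (K * r) * exp (q * r powr \<alpha>) * exp (- R * r powr \<alpha>))"
proof -
  define c where "c = (R - q) / 2"
  have c_pos: "c > 0" using q_less by (simp add: c_def)
  then obtain b where young: "\<And>r. r > 0 \<Longrightarrow> K * r \<le> b + c * r powr \<alpha>"
    using mult_le_const_add_powr[OF \<alpha>_gt_1 c_pos K_nonneg] by blast
  show ?thesis
  proof (rule Bochner_Integration.integrable_bound)
    show "integrable (radial_measure k) (\<lambda>r. exp b * exp (- c * r powr \<alpha>))"
      using \<alpha>_gt_1 c_pos by (intro integrable_mult_right integrable_radial_exp) auto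
    show "AE r in radial_measure k. norm (exp (K * r) * exp (q * r powr \<alpha>) * exp (- R * r powr \<alpha>))
        \<le> norm (exp b * exp (- c * r powr \<alpha>))"
      using AE_radial_measure_pos
    proof eventually_elim
      case (elim r)
      have "q * r powr \<alpha> + - R * r powr \<alpha> = - 2 * c * r powr \<alpha>" by (simp add: c_def field_simps)
      then have "K * r + q * r powr \<alpha> + - R * r powr \<alpha> \<le> b + - c * r powr \<alpha>"
        using young[OF elim] by linarith
      then show ?case by (simp add: exp_add[symmetric] del: mult_minus_left)
    qed
  qed measurable
qed

lemma summable_on_gamma_coeff:
  assumes \<alpha>_gt_1: "\<alpha> > 1" and q_bounds: "0 \<le> q" "q < R" and K_nonneg: "K \<ge> 0" and d_pos: "d > 0"
  shows "(\<lambda>(n, k). K ^ n / fact n * q ^ k * gamma_coeff \<alpha> R d n k) summable_on UNIV"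
proof -
  define h where "h = (\<lambda>(n, k) r. ((K * r) ^ n / fact n) * ((q * r powr \<alpha>) ^ k / fact k) * exp (- R * r powr \<alpha>))"
  let ?M = "radial_measure (d - 1)"
  have h_integral: "has_bochner_integral ?M (h (n, k)) (K ^ n / fact n * q ^ k * gamma_coeff \<alpha> R d n k / \<alpha>)"
    for n k
  proof -
    have "has_bochner_integral ?M (\<lambda>r. (K ^ n / fact n * q ^ k / fact k) * (r ^ n * (r powr \<alpha>) ^ k * exp (- R * r powr \<alpha>)))
        ((K ^ n / fact n * q ^ k / fact k) * (fact k * gamma_coeff \<alpha> R d n k / \<alpha>))"
      using \<alpha>_gt_1 q_bounds d_pos
      by (intro has_bochner_integral_mult_right has_bochner_integral_radial_power_mult_exp) auto
    then show ?thesis by (simp add: h_def power_mult_distrib mult_ac)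
  qed
  have "(\<lambda>p. integral\<^sup>L ?M (h p)) summable_on UNIV"
  proof (rule summable_on_integral)
    show "integrable ?M (h p)" for p
      using h_integral by (cases p) (auto intro: integrable.intros)
    show "AE r in ?M. 0 \<le> h p r" for p
      using AE_radial_measure_pos
      by eventually_elim (use q_bounds K_nonneg in \<open>auto simp: h_def split: prod.split\<close>)
    show "integrable ?M (\<lambda>r. exp (K * r) * exp (q * r powr \<alpha>) * exp (- R * r powr \<alpha>))"
      by (rule integrable_radial_exp_mult[OF \<alpha>_gt_1 q_bounds(2) K_nonneg])
    fix F :: "(nat \<times> nat) set" assume finite_F: "finite F"
    show "AE r in ?M. (\<Sum>p\<in>F. h p r) \<le> exp (K * r) * exp (q * r powr \<alpha>) * exp (- R * r powr \<alpha>)"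
      using AE_radial_measure_pos
    proof eventually_elim
      case (elim r)
      have "(\<Sum>p\<in>F. (\<lambda>(n, k). ((K * r) ^ n / fact n) * ((q * r powr \<alpha>) ^ k / fact k)) p)
          \<le> exp (K * r) * exp (q * r powr \<alpha>)"
        by (rule finite_sum_le_has_sum[OF has_sum_exp_mult_exp finite_F])
           (use K_nonneg q_bounds elim in auto)
      from mult_right_mono[OF this, of "exp (- R * r powr \<alpha>)"]
      show ?case by (simp add: h_def split_beta sum_distrib_right)
    qed
  qed
  moreover have "integral\<^sup>L ?M (h p) * \<alpha>
      = (case p of (n, k) \<Rightarrow> K ^ n / fact n * q ^ k * gamma_coeff \<alpha> R d n k)" for p
    using \<alpha>_gt_1 by (cases p) (simp only: has_bochner_integral_integral_eq[OF h_integral] prod.case, simp)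
  ultimately show ?thesis
    using summable_on_cmult_left[of "\<lambda>p. integral\<^sup>L ?M (h p)" UNIV \<alpha>] by (simp only:)
qed

section \<open>Expansion of the inverse Fourier transform\<close>

locale stable_exponent =
  fixes W :: "real^'n::finite \<Rightarrow> complex" and \<alpha> R q :: real
  assumes dim: "CARD('n) \<ge> 2" and \<alpha>_gt_1: "1 < \<alpha>" and continuous_W: "continuous_on UNIV W"
    and q_bounds: "0 < q" "q < R" and norm_W_le: "\<And>u. norm u = 1 \<Longrightarrow> cmod (W u) \<le> q"
begin

definition char_fun :: "real^'n \<Rightarrow> complex" where
  "char_fun z = exp (- of_real (norm z powr \<alpha>) * (of_real R - W (sgn z)))"

lemma \<alpha>_pos: "\<alpha> > 0" and R_pos: "R > 0"
  using \<alpha>_gt_1 q_bounds by simp_all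

lemma continuous_W_power: "continuous_on UNIV (\<lambda>u. W u ^ k)"
  by (intro continuous_intros continuous_W)

lemma norm_W_power_le: "norm u = 1 \<Longrightarrow> cmod (W u ^ k) \<le> q ^ k"
  by (simp add: norm_power power_mono norm_W_le)

lemma gamma_coeff_CARD_nonneg: "gamma_coeff \<alpha> R CARD('n) n k \<ge> 0"
  by (intro gamma_coeff_nonneg \<alpha>_pos R_pos) simp

lemma borel_measurable_char_fun [measurable]: "char_fun \<in> borel_measurable borel"
proof -
  have [measurable]: "(\<lambda>z. W (sgn z)) \<in> borel_measurable borel"
    by (rule measurable_compose[OF borel_measurable_sgn borel_measurable_continuous_onI[OF continuous_W]])
  show ?thesis unfolding char_fun_def[abs_def] by measurable
qed

lemma integrable_char_fun: "integrable lborel char_fun"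
proof -
  have "integrable lborel (\<lambda>z::real^'n. exp (- (R - q) * norm z powr \<alpha>) *\<^sub>R (1::real))"
    using \<alpha>_gt_1 q_bounds by (intro integrable_polar_product integrable_radial_exp) auto
  then show ?thesis
  proof (rule Bochner_Integration.integrable_bound)
    have "norm z powr \<alpha> * (R - q) \<le> norm z powr \<alpha> * (R - Re (W (sgn z)))" for z
      using norm_W_le[of "sgn z"] complex_Re_le_cmod[of "W (sgn z)"]
      by (cases "z = 0") (auto simp: norm_sgn intro!: mult_left_mono)
    then show "AE z in lborel. norm (char_fun z) \<le> norm (exp (- (R - q) * norm z powr \<alpha>) *\<^sub>R (1::real))"
      by (intro AE_I2) (simp add: char_fun_def algebra_simps)
  qed simp
qed

definition series_term :: "nat \<Rightarrow> nat \<Rightarrow> real^'n \<Rightarrow> complex" where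
  "series_term n k x = of_real (gamma_coeff \<alpha> R CARD('n) n k / ((2 * pi) ^ CARD('n) * \<alpha> * fact n))
      * (- \<i>) ^ n
     * power_transform (\<lambda>u. W u ^ k) n x"

definition majorant :: "real \<Rightarrow> nat \<Rightarrow> nat \<Rightarrow> real" where
  "majorant t n k = t ^ n / fact n * q ^ k * gamma_coeff \<alpha> R CARD('n) n k
      * (fh_coeff CARD('n) 0 0 / ((2 * pi) ^ CARD('n) * \<alpha>))"

lemma fh_coeff_0_nonneg: "fh_coeff CARD('n) 0 0 \<ge> 0"
  by (rule less_imp_le[OF fh_coeff_pos]) auto

lemma majorant_nonneg: "t \<ge> 0 \<Longrightarrow> majorant t n k \<ge> 0"
  unfolding majorant_def using q_bounds \<alpha>_pos gamma_coeff_CARD_nonneg fh_coeff_0_nonneg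
  by (intro mult_nonneg_nonneg divide_nonneg_nonneg) auto

lemma majorant_mono:
  assumes "0 \<le> s" "s \<le> t"
  shows "majorant s n k \<le> majorant t n k"
  unfolding majorant_def using assms q_bounds \<alpha>_pos gamma_coeff_CARD_nonneg fh_coeff_0_nonneg
  by (intro mult_right_mono divide_right_mono power_mono divide_nonneg_nonneg) auto

lemma majorant_double: "majorant (2 * t) n k = 2 ^ n * majorant t n k"
  by (simp add: majorant_def power_mult_distrib)

lemma summable_on_majorant:
  assumes "t \<ge> 0"
  shows "(\<lambda>(n, k). majorant t n k) summable_on UNIV"
proof -
  have "(\<lambda>(n, k). t ^ n / fact n * q ^ k * gamma_coeff \<alpha> R CARD('n) n k) summable_on UNIV"
    using q_bounds assms by (intro summable_on_gamma_coeff \<alpha>_gt_1) auto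
  from summable_on_cmult_left[OF this, of "fh_coeff CARD('n) 0 0 / ((2 * pi) ^ CARD('n) * \<alpha>)"] show ?thesis
    by (simp add: majorant_def[abs_def] case_prod_unfold)
qed

lemma
  assumes "t \<ge> 0"
  shows summable_majorant: "summable (majorant t n)"
    and summable_suminf_majorant: "summable (\<lambda>n. \<Sum>k. majorant t n k)"
  using has_sum_infsum[OF summable_on_majorant[OF assms]]
  by (auto intro: summable_has_sum_prod sums_summable[OF sums_has_sum_prod])

lemma norm_series_term_le: "norm (series_term n k x) \<le> majorant (norm x) n k"
proof -
  have coeff: "gamma_coeff \<alpha> R CARD('n) n k / ((2 * pi) ^ CARD('n) * \<alpha> * fact n) \<ge> 0"
    using gamma_coeff_CARD_nonneg \<alpha>_pos by simp
  have "norm (series_term n k x) = gamma_coeff \<alpha> R CARD('n) n k / ((2 * pi) ^ CARD('n) * \<alpha> * fact n)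
      * cmod (power_transform (\<lambda>u. W u ^ k) n x)"
    unfolding series_term_def norm_mult norm_of_real abs_of_nonneg[OF coeff] by (simp add: norm_power)
  also have "\<dots> \<le> gamma_coeff \<alpha> R CARD('n) n k / ((2 * pi) ^ CARD('n) * \<alpha> * fact n)
      * (norm x ^ n * q ^ k * fh_coeff CARD('n) 0 0)"
    by (intro mult_left_mono coeff norm_power_transform_le continuous_W_power norm_W_power_le)
  finally show ?thesis by (simp add: majorant_def mult_ac)
qed

subsection \<open>Termwise integration in polar coordinates\<close>

definition radial_factor :: "nat \<Rightarrow> nat \<Rightarrow> real \<Rightarrow> real" where
  "radial_factor n k r = r ^ n * (r powr \<alpha>) ^ k * exp (- R * r powr \<alpha>) / (fact n * fact k)"

definition spherical_factor :: "real^'n \<Rightarrow> nat \<Rightarrow> nat \<Rightarrow> real^'n \<Rightarrow> complex" where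
  "spherical_factor x n k u = (- \<i>) ^ n * (of_real (x \<bullet> u) ^ n * W u ^ k)"

definition integrand_term :: "real^'n \<Rightarrow> nat \<times> nat \<Rightarrow> real^'n \<Rightarrow> complex" where
  "integrand_term x = (\<lambda>(n, k) z. radial_factor n k (norm z) *\<^sub>R spherical_factor x n k (dir z))"

lemma radial_factor_nonneg: "r \<ge> 0 \<Longrightarrow> radial_factor n k r \<ge> 0"
  by (simp add: radial_factor_def)

lemma
  shows integrable_radial_factor: "integrable (radial_measure (CARD('n) - 1)) (radial_factor n k)"
    and integral_radial_factor:
      "integral\<^sup>L (radial_measure (CARD('n) - 1)) (radial_factor n k)
          = gamma_coeff \<alpha> R CARD('n) n k / (\<alpha> * fact n)"
proof -
  have "has_bochner_integral (radial_measure (CARD('n) - 1)) (radial_factor n k) (gamma_coeff \<alpha> R CARD('n) n k / (\<alpha> * fact n))"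
    using has_bochner_integral_divide_zero[OF has_bochner_integral_radial_power_mult_exp[OF \<alpha>_pos R_pos, of "CARD('n)" n k], of "fact n * fact k"]
    by (simp add: radial_factor_def[abs_def] mult_ac)
  then show "integrable (radial_measure (CARD('n) - 1)) (radial_factor n k)"
    and "integral\<^sup>L (radial_measure (CARD('n) - 1)) (radial_factor n k)
        = gamma_coeff \<alpha> R CARD('n) n k / (\<alpha> * fact n)"
    by (auto intro: integrable.intros has_bochner_integral_integral_eq)
qed

lemma integrable_spherical_factor: "integrable sphere_measure (spherical_factor x n k)"
  unfolding spherical_factor_def[abs_def]
  by (intro integrable_mult_right integrable_sphere_inner_power_mult continuous_W_power)

lemma integrable_integrand_term: "integrable lborel (integrand_term x p)"
  unfolding integrand_term_def
  by (cases p) (auto intro!: integrable_polar_product integrable_radial_factor integrable_spherical_factor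
    simp del: One_nat_def)

lemma integral_integrand_term: "integral\<^sup>L lborel (integrand_term x (n, k))
    = of_real ((2 * pi) ^ CARD('n)) * series_term n k x"
proof -
  have "sphint (spherical_factor x n k) = (- \<i>) ^ n * power_transform (\<lambda>u. W u ^ k) n x"
    by (simp add: spherical_factor_def[abs_def] power_transform_def)
  then show ?thesis
    unfolding integrand_term_def prod.case
      integral_polar_product[OF integrable_radial_factor integrable_spherical_factor]
    by (simp only: integral_radial_factor) (simp add: series_term_def scaleR_conv_of_real mult_ac)
qed

lemma integral_norm_integrand_term_le:
  "(\<integral>z. norm (integrand_term x (n, k) z) \<partial>lborel) \<le> (2 * pi) ^ CARD('n) * majorant (norm x) n k"
proof -
  let ?g = "gamma_coeff \<alpha> R CARD('n) n k / (\<alpha> * fact n)"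
  have "(\<integral>z. norm (integrand_term x (n, k) z) \<partial>lborel)
      = (\<integral>z. radial_factor n k (norm z) *\<^sub>R norm (spherical_factor x n k (dir z)) \<partial>lborel)"
    by (simp add: integrand_term_def radial_factor_nonneg)
  also have "\<dots> = ?g *\<^sub>R sphint (\<lambda>u. norm (spherical_factor x n k u))"
    unfolding integral_polar_product[OF integrable_radial_factor integrable_norm[OF integrable_spherical_factor]] integral_radial_factor ..
  also have "\<dots> = ?g *\<^sub>R sphint (\<lambda>u. cmod (of_real (x \<bullet> u) ^ n * W u ^ k))"
    by (simp add: spherical_factor_def norm_mult norm_power)
  also have "\<dots> \<le> ?g *\<^sub>R (norm x ^ n * q ^ k * fh_coeff CARD('n) 0 0)"
    using gamma_coeff_CARD_nonneg \<alpha>_pos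
    by (intro scaleR_left_mono sphint_norm_power_transform_integrand_le continuous_W_power norm_W_power_le)
      auto
  finally show ?thesis by (simp add: majorant_def mult_ac)
qed

lemma integrand_term_has_sum:
  assumes "z \<noteq> 0"
  shows "((\<lambda>p. integrand_term x p z) has_sum (cis (- (x \<bullet> z)) * char_fun z)) UNIV"
proof -
  define t where "t = norm z powr \<alpha>"
  define a b where "a = - \<i> * complex_of_real (x \<bullet> z)" and "b = complex_of_real t * W (sgn z)"
  have dir: "dir z = sgn z" using assms by (simp add: dir_def)
  have a_power: "a ^ n = of_real (norm z ^ n) * ((- \<i>) ^ n * of_real (x \<bullet> sgn z) ^ n)" for n
  proof -
    have "x \<bullet> z = norm z * (x \<bullet> sgn z)" using assms by (simp add: sgn_div_norm)
    then have "a = of_real (norm z) * (- \<i> * of_real (x \<bullet> sgn z))" by (simp add: a_def)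
    then show ?thesis by (simp only: power_mult_distrib of_real_power)
  qed
  have "exp (- of_real (R * t)) = complex_of_real (exp (- R * t))" by (simp flip: exp_of_real)
  then have "integrand_term x p z
      = (case p of (n, k) \<Rightarrow> (a ^ n / fact n) * (b ^ k / fact k)) * exp (- of_real (R * t))" for p
    by (cases p) (simp add: integrand_term_def radial_factor_def spherical_factor_def dir
      scaleR_conv_of_real a_power b_def
        power_mult_distrib flip: t_def)
  then have "((\<lambda>p. integrand_term x p z) has_sum (exp a * exp b * exp (- of_real (R * t)))) UNIV"
    using has_sum_cmult_left[OF has_sum_exp_mult_exp[of a b]] by simp
  also have "exp a * exp b * exp (- of_real (R * t)) = cis (- (x \<bullet> z)) * char_fun z"
    unfolding a_def b_def char_fun_def cis_conv_exp t_def by (simp add: exp_add[symmetric] algebra_simps)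
  finally show ?thesis .
qed

theorem series_term_has_sum: "((\<lambda>(n, k). series_term n k x) has_sum inv_fourier char_fun x) UNIV"
proof -
  have "((\<lambda>p. integral\<^sup>L lborel (integrand_term x p)) has_sum (\<integral>z. cis (- (x \<bullet> z)) * char_fun z \<partial>lborel)) UNIV"
  proof (rule has_sum_integral[OF integrable_integrand_term])
    have "(\<lambda>p. (2 * pi) ^ CARD('n) * (case p of (n, k) \<Rightarrow> majorant (norm x) n k)) summable_on UNIV"
      by (intro summable_on_cmult_right summable_on_majorant) simp
    then show "(\<lambda>p. \<integral>z. norm (integrand_term x p z) \<partial>lborel) summable_on UNIV"
      by (rule summable_on_comparison_test)
         (use integral_norm_integrand_term_le in \<open>auto intro!: integral_nonneg_AE\<close>)
    have "AE z in lborel. z \<noteq> (0::real^'n)" by (rule AE_lborel_singleton)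
    then show "AE z in lborel. ((\<lambda>p. integrand_term x p z) has_sum (cis (- (x \<bullet> z)) * char_fun z)) UNIV"
      by eventually_elim (rule integrand_term_has_sum)
  qed (simp, measurable)
  from has_sum_cmult_right[OF this, of "of_real (1 / (2 * pi) ^ CARD('n))"]
  have "((\<lambda>p. of_real (1 / (2 * pi) ^ CARD('n)) * integral\<^sup>L lborel (integrand_term x p)) has_sum inv_fourier char_fun x) UNIV"
    by (simp add: inv_fourier_def)
  moreover have "of_real (1 / (2 * pi) ^ CARD('n)) * integral\<^sup>L lborel (integrand_term x p)
      = (case p of (n, k) \<Rightarrow> series_term n k x)" for p
    by (cases p) (simp add: integral_integrand_term)
  ultimately show ?thesis by simp
qed

subsection \<open>Decomposition into spherical harmonics\<close>

definition harmonic_term :: "real^'n \<Rightarrow> nat \<Rightarrow> nat \<Rightarrow> nat \<Rightarrow> complex" where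
  "harmonic_term x n m k =
     of_real (fh_coeff CARD('n) n m / ((2 * pi) ^ CARD('n) * fact n) * gamma_coeff \<alpha> R CARD('n) n k / \<alpha> * norm x ^ n)
     * ((- 1) ^ m * (- \<i>) ^ (n - 2 * m)) * sh_proj (n - 2 * m) (\<lambda>u. W u ^ k) (sgn x)"

lemma series_term_eq_sum_harmonic_term: "series_term n k x = (\<Sum>m\<le>n div 2. harmonic_term x n m k)"
proof -
  let ?a = "complex_of_real (gamma_coeff \<alpha> R CARD('n) n k / ((2 * pi) ^ CARD('n) * \<alpha> * fact n)) * (- \<i>) ^ n"
  let ?p = "\<lambda>m. sh_proj (n - 2 * m) (\<lambda>u. W u ^ k)"
  have "?a * (of_real (fh_coeff CARD('n) n m) * (of_real (norm x) ^ (2 * m) * ?p m x))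
      = harmonic_term x n m k"
    if "m \<le> n div 2" for m
  proof -
    have n_eq: "n = (n - 2 * m) + 2 * m" using that by simp
    have "norm x *\<^sub>R sgn x = x" by (cases "x = 0") (simp_all add: sgn_div_norm)
    then have p_homogeneous: "?p m x = of_real (norm x) ^ (n - 2 * m) * ?p m (sgn x)"
      using hpoly_scaleR[OF harm_hpoly[OF sh_proj_harm[OF dim continuous_W_power]], of "n - 2 * m" k "norm x" "sgn x"] by simp
    have norm_power: "of_real (norm x) ^ n
        = of_real (norm x) ^ (n - 2 * m) * (of_real (norm x) ^ (2 * m) :: complex)"
      by (subst n_eq) (simp only: power_add)
    have i_power: "(- \<i>) ^ n = (- \<i>) ^ (n - 2 * m) * (- 1) ^ m"
      by (subst n_eq) (simp only: power_add power_mult, simp)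
    show ?thesis
      unfolding harmonic_term_def p_homogeneous of_real_mult of_real_power norm_power i_power
      by (simp add: mult_ac)
  qed
  then show ?thesis
    unfolding series_term_def power_transform_eq_sum_sh_proj[OF dim continuous_W_power] sum_distrib_left
    by (intro sum.cong) auto
qed

lemma norm_harmonic_term_le:
  assumes m_le: "m \<le> n div 2"
  shows "norm (harmonic_term x n m k) \<le> majorant (real CARD('n) * norm x) n k"
proof -
  let ?d = "CARD('n)"
  define A where "A = gamma_coeff \<alpha> R ?d n k / ((2 * pi) ^ ?d * fact n * \<alpha>) * norm x ^ n"
  have A_nonneg: "A \<ge> 0" unfolding A_def using gamma_coeff_CARD_nonneg \<alpha>_pos by simp
  have "m \<le> n" using m_le by simp
  note coeff_pos = fh_coeff_pos[OF zero_less_card_finite[where 'a='n] this]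
    and coeff_le = fh_coeff_le[OF dim this]
  have "cmod (sh_proj (n - 2 * m) (\<lambda>u. W u ^ k) (sgn x)) \<le> real ?d ^ (n - 2 * m) * q ^ k"
    using q_bounds by (intro norm_sh_proj_le[OF dim continuous_W_power] norm_W_power_le)
       (auto simp: norm_sgn)
  also have "\<dots> \<le> real ?d ^ n * q ^ k"
    using q_bounds by (intro mult_right_mono power_increasing) auto
  finally have proj: "cmod (sh_proj (n - 2 * m) (\<lambda>u. W u ^ k) (sgn x)) \<le> real ?d ^ n * q ^ k" .
  have "norm (harmonic_term x n m k)
      = fh_coeff ?d n m * A * cmod (sh_proj (n - 2 * m) (\<lambda>u. W u ^ k) (sgn x))"
  proof -
    have "fh_coeff ?d n m / ((2 * pi) ^ ?d * fact n) * gamma_coeff \<alpha> R ?d n k / \<alpha> * norm x ^ n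
        = fh_coeff ?d n m * A"
      by (simp add: A_def)
    then show ?thesis
      using A_nonneg coeff_pos by (simp only: harmonic_term_def norm_mult norm_of_real norm_power) simp
  qed
  also have "\<dots> \<le> fh_coeff ?d 0 0 * A * (real ?d ^ n * q ^ k)"
    using coeff_le A_nonneg proj fh_coeff_0_nonneg by (intro mult_mono mult_nonneg_nonneg) auto
  also have "\<dots> = majorant (real ?d * norm x) n k"
    by (simp add: A_def majorant_def power_mult_distrib mult_ac)
  finally show ?thesis .
qed

lemma sum_le_majorant_double:
  assumes "t \<ge> 0"
  shows "(\<Sum>m\<le>n div 2. majorant t n k) \<le> majorant (2 * t) n k"
proof -
  have "n div 2 < 2 ^ n" by (rule le_less_trans[OF div_le_dividend less_exp])
  then have "real (Suc (n div 2)) \<le> 2 ^ n" by (metis Suc_leI of_nat_le_iff of_nat_numeral of_nat_power)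
  then show ?thesis
    unfolding majorant_double using mult_right_mono[OF _ majorant_nonneg[OF assms]] by simp
qed

lemma summable_harmonic_term:
  assumes "m \<le> n div 2"
  shows "summable (harmonic_term x n m)"
  by (rule summable_comparison_test'[OF summable_majorant[of "real CARD('n) * norm x" n], of 0])
     (simp_all add: norm_harmonic_term_le[OF assms])

theorem harmonic_series_sums: "(\<lambda>n. \<Sum>m\<le>n div 2. \<Sum>k. harmonic_term x n m k) sums inv_fourier char_fun x"
proof -
  have "(\<Sum>k. series_term n k x) = (\<Sum>m\<le>n div 2. \<Sum>k. harmonic_term x n m k)" for n
    unfolding series_term_eq_sum_harmonic_term by (rule suminf_sum) (simp add: summable_harmonic_term)
  then show ?thesis using sums_has_sum_prod[OF series_term_has_sum[of x]] by simp
qed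

theorem uniform_limit_harmonic_series:
  assumes M_nonneg: "M \<ge> 0"
  shows "uniform_limit (cball 0 M) (\<lambda>N x. \<Sum>n<N. \<Sum>m\<le>n div 2. \<Sum>k. harmonic_term x n m k)
           (inv_fourier char_fun) sequentially"
proof -
  let ?t = "real CARD('n) * M"
  have arg_nonneg: "?t \<ge> 0" using M_nonneg by simp
  have "uniform_limit (cball 0 M) (\<lambda>N x. \<Sum>n<N. \<Sum>m\<le>n div 2. \<Sum>k. harmonic_term x n m k)
      (\<lambda>x. \<Sum>n. \<Sum>m\<le>n div 2. \<Sum>k. harmonic_term x n m k) sequentially"
  proof (rule Weierstrass_m_test)
    show "summable (\<lambda>n. \<Sum>k. majorant (2 * ?t) n k)"
      using arg_nonneg by (intro summable_suminf_majorant) simp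
    fix n and x :: "real^'n" assume "x \<in> cball 0 M"
    then have norm_x_le: "norm x \<le> M" by simp
    have "norm (\<Sum>m\<le>n div 2. \<Sum>k. harmonic_term x n m k) \<le> (\<Sum>m\<le>n div 2. \<Sum>k. majorant ?t n k)"
    proof (rule sum_norm_le)
      fix m assume "m \<in> {..n div 2}"
      then have "norm (harmonic_term x n m k) \<le> majorant ?t n k" for k
        using norm_x_le by (intro order_trans[OF norm_harmonic_term_le majorant_mono] mult_left_mono) auto
      then show "norm (\<Sum>k. harmonic_term x n m k) \<le> (\<Sum>k. majorant ?t n k)"
        by (intro norm_suminf_le summable_majorant arg_nonneg)
    qed
    also have "\<dots> = (\<Sum>k. \<Sum>m\<le>n div 2. majorant ?t n k)"
      by (rule suminf_sum[symmetric]) (rule summable_majorant[OF arg_nonneg])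
    also have "\<dots> \<le> (\<Sum>k. majorant (2 * ?t) n k)"
      using arg_nonneg by (intro suminf_le sum_le_majorant_double summable_sum summable_majorant) simp_all
    finally show "norm (\<Sum>m\<le>n div 2. \<Sum>k. harmonic_term x n m k) \<le> (\<Sum>k. majorant (2 * ?t) n k)" .
  qed
  then show ?thesis by (simp add: sums_unique[OF harmonic_series_sums, symmetric])
qed

theorem abs_summable_harmonic_term:
  "(\<lambda>(n, m, k). norm (harmonic_term x n m k)) summable_on {(n, m, k). m \<le> n div 2}"
proof -
  let ?t = "real CARD('n) * norm x" and ?S = "SIGMA p:UNIV. {..fst p div 2}"
  let ?f = "\<lambda>(p, m). norm (harmonic_term x (fst p) m (snd p))"
  have "?f summable_on ?S"
  proof (rule summable_on_SigmaI)
    show "((\<lambda>m. ?f (p, m)) has_sum (\<Sum>m\<le>fst p div 2. ?f (p, m))) {..fst p div 2}" for p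
      by (rule has_sum_finite) simp
    have "(\<Sum>m\<le>n div 2. norm (harmonic_term x n m k)) \<le> majorant (2 * ?t) n k" for n k
      by (rule order_trans[OF sum_mono sum_le_majorant_double]) (simp_all add: norm_harmonic_term_le)
    moreover have "(\<lambda>(n, k). majorant (2 * ?t) n k) summable_on UNIV"
      by (rule summable_on_majorant) simp
    ultimately show "(\<lambda>p. \<Sum>m\<le>fst p div 2. ?f (p, m)) summable_on UNIV"
      by (elim summable_on_comparison_test) (auto intro!: sum_nonneg)
  qed auto
  moreover have "bij_betw (\<lambda>(n, m, k). ((n, k), m)) {(n, m, k). m \<le> n div 2} ?S"
    by (rule bij_betw_byWitness[where f'="\<lambda>((n, k), m). (n, m, k)"]) auto
  ultimately have "(\<lambda>y. ?f ((\<lambda>(n, m, k). ((n, k), m)) y)) summable_on {(n, m, k). m \<le> n div 2}"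
    by (subst summable_on_reindex_bij_betw)
  then show ?thesis by (simp add: case_prod_unfold)
qed

end

section \<open>Expansion of the spherical averages\<close>

context stable_exponent
begin

lemma integrable_sphere_series_term: "integrable sphere_measure (\<lambda>u. series_term n k (r *\<^sub>R u))"
  unfolding series_term_def
  by (intro integrable_sphere_continuous continuous_intros
      continuous_on_compose2[OF continuous_on_hpoly[OF hpoly_power_transform[OF continuous_W_power], of UNIV]]) auto

lemma sphint_series_term:
  "sphint (\<lambda>u. series_term n k (r *\<^sub>R u)) =
     of_real (gamma_coeff \<alpha> R CARD('n) n k / ((2 * pi) ^ CARD('n) * \<alpha> * fact n) * r ^ n) * (- \<i>) ^ n
       * (if even n then of_real (fh_coeff CARD('n) n (n div 2)) * sphint (\<lambda>u. W u ^ k) else 0)"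
proof -
  have "series_term n k (r *\<^sub>R u)
      = of_real (gamma_coeff \<alpha> R CARD('n) n k / ((2 * pi) ^ CARD('n) * \<alpha> * fact n) * r ^ n) * (- \<i>) ^ n
        * power_transform (\<lambda>u. W u ^ k) n u" for u
    unfolding series_term_def hpoly_scaleR[OF hpoly_power_transform[OF continuous_W_power]] by simp
  then show ?thesis
    by (simp only: integral_mult_right_zero sphint_power_transform[OF dim continuous_W_power])
qed

lemma borel_measurable_inv_fourier_scaleR:
  "(\<lambda>u. inv_fourier char_fun (r *\<^sub>R u)) \<in> borel_measurable sphere_measure"
  by (rule borel_measurable_sphere_measure,
      rule measurable_compose[OF _ borel_measurable_inv_fourier[OF borel_measurable_char_fun]]) simp

lemma sphint_series_term_has_sum:
  assumes r_nonneg: "r \<ge> 0"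
  shows "((\<lambda>(n, k). sphint (\<lambda>u. series_term n k (r *\<^sub>R u))) has_sum sphint (\<lambda>u. inv_fourier char_fun (r *\<^sub>R u))) UNIV"
proof -
  have norm_integral: "sphint (\<lambda>u. norm (series_term n k (r *\<^sub>R u)))
      \<le> majorant r n k * fh_coeff CARD('n) 0 0" for n k
  proof -
    have "sphint (\<lambda>u. norm (series_term n k (r *\<^sub>R u))) \<le> sphint (\<lambda>u::real^'n. majorant r n k)"
    proof (rule integral_mono)
      show "norm (series_term n k (r *\<^sub>R u)) \<le> majorant r n k" if "u \<in> space sphere_measure" for u
        using norm_series_term_le[of n k "r *\<^sub>R u"] that r_nonneg by simp
    qed (use integrable_sphere_series_term in auto)
    then show ?thesis using measure_sphere[where 'n='n] by (simp add: mult.commute)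
  qed
  have "((\<lambda>p. sphint (\<lambda>u. case p of (n, k) \<Rightarrow> series_term n k (r *\<^sub>R u))) has_sum sphint (\<lambda>u. inv_fourier char_fun (r *\<^sub>R u))) UNIV"
  proof (rule has_sum_integral)
    show "integrable sphere_measure (\<lambda>u. case p of (n, k) \<Rightarrow> series_term n k (r *\<^sub>R u))" for p
      using integrable_sphere_series_term by (cases p) simp
    have "(\<lambda>p. (case p of (n, k) \<Rightarrow> majorant r n k) * fh_coeff CARD('n) 0 0) summable_on UNIV"
      by (intro summable_on_cmult_left summable_on_majorant r_nonneg)
    then show "(\<lambda>p. sphint (\<lambda>u. norm (case p of (n, k) \<Rightarrow> series_term n k (r *\<^sub>R u)))) summable_on UNIV"
      by (rule summable_on_comparison_test) (use norm_integral in \<open>auto intro!: integral_nonneg_AE\<close>)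
    show "AE u in sphere_measure. ((\<lambda>p. case p of (n, k) \<Rightarrow> series_term n k (r *\<^sub>R u)) has_sum inv_fourier char_fun (r *\<^sub>R u)) UNIV"
      by (intro AE_I2) (rule series_term_has_sum)
  qed (rule borel_measurable_inv_fourier_scaleR)
  moreover have "sphint (\<lambda>u. case p of (n, k) \<Rightarrow> series_term n k (r *\<^sub>R u))
      = (case p of (n, k) \<Rightarrow> sphint (\<lambda>u. series_term n k (r *\<^sub>R u)))" for p
    by (cases p) simp
  ultimately show ?thesis by simp
qed

lemma summable_sphint_series_term: "r \<ge> 0 \<Longrightarrow> summable (\<lambda>k. sphint (\<lambda>u. series_term n k (r *\<^sub>R u)))"
  by (rule summable_has_sum_prod[OF sphint_series_term_has_sum])

lemma sphint_even_series_sums: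
  assumes r_nonneg: "r \<ge> 0"
  shows "(\<lambda>n. \<Sum>k. sphint (\<lambda>u. series_term (2 * n) k (r *\<^sub>R u))) sums sphint (\<lambda>u. inv_fourier char_fun (r *\<^sub>R u))"
proof -
  have "(\<Sum>k. sphint (\<lambda>u. series_term n k (r *\<^sub>R u))) = 0" if "n \<notin> range (\<lambda>n. 2 * n)" for n
  proof -
    have "odd n" using that by (auto elim!: evenE)
    then show ?thesis by (simp add: sphint_series_term)
  qed
  then show ?thesis
    using sums_mono_reindex[of "\<lambda>n. 2 * n" "\<lambda>n. \<Sum>k. sphint (\<lambda>u. series_term n k (r *\<^sub>R u))"]
      sums_has_sum_prod[OF sphint_series_term_has_sum[OF r_nonneg]]
    by (simp add: strict_mono_def)
qed

end

section \<open>Density and radial density\<close>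

locale stable_density = stable_exponent W \<alpha> R q + prob_space \<mu>
  for W :: "real^'n::finite \<Rightarrow> complex" and \<alpha> R q and \<mu> :: "(real^'n) measure" +
  assumes sets_\<mu>: "sets \<mu> = sets borel" and charf_\<mu>: "\<And>z. (\<integral>x. cis (z \<bullet> x) \<partial>\<mu>) = char_fun z"

sublocale stable_density \<subseteq> fourier_pair \<mu> char_fun
  by unfold_locales (simp_all add: sets_\<mu> charf_\<mu> integrable_char_fun)

context stable_density
begin

definition radial_density :: "real \<Rightarrow> complex" where
  "radial_density r = of_real (r ^ (CARD('n) - 1)) * sphint (\<lambda>u. inv_fourier char_fun (r *\<^sub>R u))"

lemma radial_density_eq_of_real:
  "radial_density r = of_real (r ^ (CARD('n) - 1) * sphint (\<lambda>u. Re (inv_fourier char_fun (r *\<^sub>R u))))"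
proof -
  have "inv_fourier char_fun x = of_real (Re (inv_fourier char_fun x))" for x
    using Im_inv_fourier[of x] by (simp add: complex_eq_iff)
  then have "sphint (\<lambda>u. inv_fourier char_fun (r *\<^sub>R u))
      = sphint (\<lambda>u. complex_of_real (Re (inv_fourier char_fun (r *\<^sub>R u))))"
    by simp
  then show ?thesis by (simp add: radial_density_def del: of_real_Re)
qed

lemma Im_radial_density: "Im (radial_density r) = 0"
  unfolding radial_density_eq_of_real by (rule Im_complex_of_real)

lemma ennreal_Re_radial_density:
  assumes "r > 0"
  shows "ennreal (Re (radial_density r))
           = ennreal (r ^ (CARD('n) - 1)) * (\<integral>\<^sup>+u. ennreal (Re (inv_fourier char_fun (r *\<^sub>R u))) \<partial>sphere_measure)"
proof -
  have "integrable sphere_measure (\<lambda>u. inv_fourier char_fun (r *\<^sub>R u))"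
    by (rule sph.integrable_const_bound[OF AE_I2[OF norm_inv_fourier_le] borel_measurable_inv_fourier_scaleR])
  then have "ennreal (sphint (\<lambda>u. Re (inv_fourier char_fun (r *\<^sub>R u))))
      = (\<integral>\<^sup>+u. ennreal (Re (inv_fourier char_fun (r *\<^sub>R u))) \<partial>sphere_measure)"
    by (intro nn_integral_eq_integral[symmetric] integrable_Re AE_I2 Re_inv_fourier_nonneg)
  then show ?thesis
    unfolding radial_density_eq_of_real Re_complex_of_real using assms
    by (simp add: ennreal_mult integral_nonneg_AE Re_inv_fourier_nonneg)
qed

theorem distr_norm_eq_radial_density:
  "distr \<mu> lborel norm = density lborel (\<lambda>r. if r > 0 then ennreal (Re (radial_density r)) else 0)"
proof -
  let ?g = "\<lambda>x. ennreal (Re (inv_fourier char_fun x))"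
  have measurable_integrand: "?g \<in> borel_measurable borel"
    using borel_measurable_inv_fourier[OF borel_measurable_char_fun] by measurable
  have "distr \<mu> lborel norm = distr (density lborel ?g) lborel norm"
    using fourier_inversion by simp
  also have "\<dots> = density (radial_measure (CARD('n) - 1)) (\<lambda>r. \<integral>\<^sup>+u. ?g (r *\<^sub>R u) \<partial>sphere_measure)"
    by (rule distr_norm_density[OF measurable_integrand])
  also have "\<dots> = density lborel (\<lambda>r. ennreal (indicator {0<..} r * r ^ (CARD('n) - 1)) * (\<integral>\<^sup>+u. ?g (r *\<^sub>R u) \<partial>sphere_measure))"
    unfolding radial_measure_def using borel_measurable_nn_integral_sphere[OF measurable_integrand]
    by (intro density_density_eq) simp_all
  also have "\<dots> = density lborel (\<lambda>r. if r > 0 then ennreal (Re (radial_density r)) else 0)"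
    by (intro arg_cong[where f="density lborel"] ext) (simp add: ennreal_Re_radial_density)
  finally show ?thesis .
qed

lemma radial_series_eq_radial_density:
  assumes "r \<ge> 0"
  shows "(\<Sum>n. \<Sum>k. of_real (r ^ (CARD('n) - 1)) * sphint (\<lambda>u. series_term (2 * n) k (r *\<^sub>R u)))
      = radial_density r"
  unfolding radial_density_def suminf_mult[OF summable_sphint_series_term[OF assms]]
  by (rule sums_unique[symmetric, OF sums_mult[OF sphint_even_series_sums[OF assms]]])

end

section \<open>The characteristic exponent of a stable law\<close>

lemma (in prob_space) AE_eq_0_if_expectation_cis_eq_1:
  fixes X :: "'a \<Rightarrow> real"
  assumes rv_X: "random_variable borel X" and cis: "\<And>t. (\<integral>x. cis (t * X x) \<partial>M) = 1"
  shows "AE x in M. X x = 0"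
proof -
  have "distr M borel X = return borel 0"
  proof (rule Levy_uniqueness)
    show "real_distribution (distr M borel X)" by (intro real_distribution_distr rv_X)
    interpret dirac: prob_space "return borel (0::real)" by (rule prob_space_return) simp
    show "real_distribution (return borel 0)" by unfold_locales auto
    have "char (distr M borel X) t = 1" for t
      unfolding char_def using cis[of t] by (subst integral_distr[OF rv_X]) (auto simp: cis_conv_exp)
    moreover have "char (return borel 0) t = 1" for t
      unfolding char_def by (subst integral_return) auto
    ultimately show "char (distr M borel X) = char (return borel 0)" by auto
  qed
  moreover have "AE t in return borel (0::real). t = 0" by (simp add: AE_return)
  ultimately have "AE t in distr M borel X. t = 0" by (simp only:)
  then show ?thesis using rv_X by (simp add: AE_distr_iff)
qed

lemma measure_support_subset_closed:
  fixes M :: "'a::metric_space measure"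
  assumes closed_C: "closed C" and sets: "sets M = sets borel" and AE_in_C: "AE x in M. x \<in> C"
  shows "measure_support M \<subseteq> C"
proof (rule subsetI, rule ccontr)
  fix x assume x_supp: "x \<in> measure_support M" "x \<notin> C"
  then obtain e where e_pos: "e > 0" "ball x e \<subseteq> - C"
    using closed_C open_contains_ball[of "- C"] by auto
  have "AE y in M. y \<notin> ball x e" using AE_in_C by eventually_elim (use e_pos(2) in blast)
  then have "emeasure M (ball x e) = 0"
    using emeasure_eq_0_AE[of "\<lambda>y. y \<in> ball x e" M] sets_eq_imp_space_eq[OF sets]
    by (simp only: space_borel UNIV_I simp_thms Collect_mem_eq)
  then show False using x_supp(1) e_pos(1) by (auto simp: measure_support_def)
qed

lemma nondegenerate_not_AE_hyperplane:
  fixes \<mu> :: "(real^'n::finite) measure"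
  assumes "nondegenerate \<mu>" "sets \<mu> = sets borel" "u \<noteq> 0"
  shows "\<not> (AE x in \<mu>. u \<bullet> x = 0)"
proof
  assume "AE x in \<mu>. u \<bullet> x = 0"
  then have "measure_support \<mu> \<subseteq> {x. u \<bullet> x = 0}"
    using assms(2) by (intro measure_support_subset_closed closed_hyperplane) auto
  moreover have "u \<notin> {x. u \<bullet> x = 0}" using \<open>u \<noteq> 0\<close> by simp
  ultimately show False
    using assms(1) affine_hyperplane[of u 0] unfolding nondegenerate_def by blast
qed

definition stable_kernel :: "real \<Rightarrow> real \<Rightarrow> complex" where
  "stable_kernel \<alpha> t = of_real (\<bar>t\<bar> powr \<alpha>) * (1 - \<i> * of_real (tan (pi * \<alpha> / 2)) * of_real (sgn t))"

lemma stable_V_eq: "stable_V \<alpha> lam u = (\<integral>v. stable_kernel \<alpha> (u \<bullet> v) \<partial>lam)"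
  by (simp add: stable_V_def stable_kernel_def)

lemma abs_powr_mult_sgn: "\<bar>t\<bar> powr \<alpha> * sgn t = t * \<bar>t\<bar> powr (\<alpha> - 1)" for t :: real
proof (cases "t = 0")
  case False
  then have "\<bar>t\<bar> powr \<alpha> = \<bar>t\<bar> * \<bar>t\<bar> powr (\<alpha> - 1)" by (simp add: powr_diff)
  then show ?thesis using False by (simp add: sgn_if)
qed simp

lemma stable_kernel_eq:
  "stable_kernel \<alpha> t = of_real (\<bar>t\<bar> powr \<alpha>)
      - \<i> * of_real (tan (pi * \<alpha> / 2)) * of_real (t * \<bar>t\<bar> powr (\<alpha> - 1))"
  unfolding stable_kernel_def abs_powr_mult_sgn[symmetric] by (simp add: algebra_simps)

lemma continuous_stable_kernel: "\<alpha> > 1 \<Longrightarrow> continuous_on A (stable_kernel \<alpha>)"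
  unfolding stable_kernel_eq[abs_def] by (intro continuous_intros continuous_on_powr') auto

lemma norm_stable_kernel_le: "norm (stable_kernel \<alpha> t) \<le> \<bar>t\<bar> powr \<alpha> * (1 + \<bar>tan (pi * \<alpha> / 2)\<bar>)"
proof -
  have "norm (1 - \<i> * of_real (tan (pi * \<alpha> / 2)) * of_real (sgn t)) \<le> 1 + \<bar>tan (pi * \<alpha> / 2)\<bar> * \<bar>sgn t\<bar>"
    by (rule order_trans[OF norm_triangle_ineq4]) (simp add: norm_mult)
  also have "\<dots> \<le> 1 + \<bar>tan (pi * \<alpha> / 2)\<bar>" by (simp add: abs_sgn_eq)
  finally show ?thesis unfolding stable_kernel_def norm_mult by (simp add: mult_left_mono)
qed

locale spectral_measure = finite_measure lam for lam :: "(real^'n::finite) measure" +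
  fixes \<alpha> :: real
  assumes sets_lam: "sets lam = sets (restrict_space borel (sphere 0 1))" and \<alpha>_gt_1: "1 < \<alpha>"
begin

abbreviation "V \<equiv> stable_V \<alpha> lam"

lemma space_lam: "space lam = sphere 0 1"
  using sets_eq_imp_space_eq[OF sets_lam] by (simp add: space_restrict_space)

lemma borel_measurable_stable_kernel_inner: "(\<lambda>v. stable_kernel \<alpha> (u \<bullet> v)) \<in> borel_measurable lam"
  unfolding measurable_cong_sets[OF sets_lam refl]
  by (intro measurable_restrict_space1 borel_measurable_continuous_onI
      continuous_on_compose2[OF continuous_stable_kernel[OF \<alpha>_gt_1, of UNIV]] continuous_intros) auto

lemma norm_stable_kernel_inner_le:
  assumes v_in: "v \<in> space lam" and norm_u_le: "norm u \<le> K"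
  shows "norm (stable_kernel \<alpha> (u \<bullet> v)) \<le> K powr \<alpha> * (1 + \<bar>tan (pi * \<alpha> / 2)\<bar>)"
proof -
  have "\<bar>u \<bullet> v\<bar> \<le> K" using Cauchy_Schwarz_ineq2[of u v] norm_u_le v_in by (simp add: space_lam)
  then have "\<bar>u \<bullet> v\<bar> powr \<alpha> * (1 + \<bar>tan (pi * \<alpha> / 2)\<bar>) \<le> K powr \<alpha> * (1 + \<bar>tan (pi * \<alpha> / 2)\<bar>)"
    using \<alpha>_gt_1 by (intro mult_right_mono powr_mono2) auto
  then show ?thesis using norm_stable_kernel_le order_trans by blast
qed

lemma integrable_stable_kernel_inner: "integrable lam (\<lambda>v. stable_kernel \<alpha> (u \<bullet> v))"
  by (rule integrable_const_bound[OF AE_I2[OF norm_stable_kernel_inner_le[OF _ order_refl]] borel_measurable_stable_kernel_inner])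

lemma continuous_V: "continuous_on A V"
proof -
  have "continuous_on UNIV V"
    unfolding continuous_on_sequentially
  proof (intro allI ballI impI)
    fix x :: "nat \<Rightarrow> real^'n" and a assume "(\<forall>n. x n \<in> UNIV) \<and> x \<longlonglongrightarrow> a"
    then have x_lim: "x \<longlonglongrightarrow> a" by simp
    then have "Bseq x" by (intro convergent_imp_Bseq convergentI)
    then obtain K where x_bound: "\<And>n. norm (x n) \<le> K" by (auto simp: Bseq_def)
    show "(V \<circ> x) \<longlonglongrightarrow> V a"
      unfolding stable_V_eq o_def
    proof (rule integral_dominated_convergence[where w="\<lambda>_. K powr \<alpha> * (1 + \<bar>tan (pi * \<alpha> / 2)\<bar>)"])
      show "AE v in lam. (\<lambda>i. stable_kernel \<alpha> (x i \<bullet> v)) \<longlonglongrightarrow> stable_kernel \<alpha> (a \<bullet> v)"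
        by (intro AE_I2 continuous_on_tendsto_compose[OF continuous_stable_kernel[OF \<alpha>_gt_1, of UNIV]]
          tendsto_intros x_lim) auto
      show "AE v in lam. norm (stable_kernel \<alpha> (x i \<bullet> v)) \<le> K powr \<alpha> * (1 + \<bar>tan (pi * \<alpha> / 2)\<bar>)" for i
        by (intro AE_I2 norm_stable_kernel_inner_le x_bound)
    qed (auto intro: borel_measurable_stable_kernel_inner)
  qed
  then show ?thesis by (rule continuous_on_subset) simp
qed

lemma Re_V: "Re (V u) = (\<integral>v. \<bar>u \<bullet> v\<bar> powr \<alpha> \<partial>lam)"
  unfolding stable_V_eq
  by (subst integral_Re[OF integrable_stable_kernel_inner, symmetric]) (simp add: stable_kernel_def)

lemma Re_V_nonneg: "Re (V u) \<ge> 0"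
  unfolding Re_V by (rule integral_nonneg_AE) simp

lemma V_scaleR_eq_0_if_Re_V_eq_0:
  assumes "Re (V u) = 0"
  shows "V (c *\<^sub>R u) = 0"
proof -
  have "integrable lam (\<lambda>v. \<bar>u \<bullet> v\<bar> powr \<alpha>)"
    using integrable_Re[OF integrable_stable_kernel_inner[of u]] by (simp add: stable_kernel_def)
  then have "AE v in lam. \<bar>u \<bullet> v\<bar> powr \<alpha> = 0"
    using assms unfolding Re_V by (subst (asm) integral_nonneg_eq_0_iff_AE) auto
  then have "AE v in lam. stable_kernel \<alpha> ((c *\<^sub>R u) \<bullet> v) = 0"
    by eventually_elim (simp add: stable_kernel_def)
  then have "V (c *\<^sub>R u) = (\<integral>v. 0 \<partial>lam)"
    unfolding stable_V_eq
    by (intro integral_cong_AE borel_measurable_stable_kernel_inner borel_measurable_const)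
  then show ?thesis by simp
qed

end

locale stable_law = spectral_measure lam \<alpha> for lam :: "(real^'n::finite) measure" and \<alpha> +
  fixes \<mu> :: "(real^'n) measure" and R :: real
  assumes prob_space_\<mu>: "prob_space \<mu>" and sets_\<mu>: "sets \<mu> = sets borel"
    and charf_\<mu>: "\<And>z. (\<integral>x. cis (z \<bullet> x) \<partial>\<mu>) = exp (- of_real (norm z powr \<alpha>) * V (sgn z))"
    and nondegenerate_\<mu>: "nondegenerate \<mu>"
    and rho0_less: "R > rho0 \<alpha> lam"
begin

lemma Re_V_pos:
  assumes norm_u: "norm u = 1"
  shows "Re (V u) > 0"
proof (rule ccontr)
  interpret prob_space \<mu> by (rule prob_space_\<mu>)
  assume "\<not> Re (V u) > 0"
  then have V_line: "V (c *\<^sub>R u) = 0" for c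
    using Re_V_nonneg[of u] by (intro V_scaleR_eq_0_if_Re_V_eq_0) simp
  have "(\<integral>x. cis (t * (u \<bullet> x)) \<partial>\<mu>) = 1" for t
  proof -
    have "sgn (t *\<^sub>R u) = sgn t *\<^sub>R u" using norm_u by (simp add: sgn_scaleR sgn_div_norm[of u])
    then show ?thesis using charf_\<mu>[of "t *\<^sub>R u"] by (simp add: V_line)
  qed
  moreover have "random_variable borel (\<lambda>x. u \<bullet> x)"
    unfolding measurable_cong_sets[OF sets_\<mu> refl] by simp
  ultimately have "AE x in \<mu>. u \<bullet> x = 0" by (intro AE_eq_0_if_expectation_cis_eq_1)
  then show False
    using nondegenerate_not_AE_hyperplane[OF nondegenerate_\<mu> sets_\<mu>, of u] norm_u by force
qed

lemma norm_V_sq_less: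
  assumes norm_u: "norm u = 1"
  shows "(cmod (V u))\<^sup>2 < 2 * R * Re (V u)"
proof -
  let ?f = "\<lambda>u. (cmod (V u))\<^sup>2 / (2 * Re (V u))"
  have "continuous_on (sphere 0 1) ?f"
    using Re_V_pos by (intro continuous_intros continuous_V) (auto simp: less_le)
  then have "bdd_above (?f ` sphere 0 1)"
    by (intro bounded_imp_bdd_above compact_imp_bounded compact_continuous_image) auto
  then have "?f u \<le> rho0 \<alpha> lam" unfolding rho0_def using norm_u by (intro cSUP_upper) simp_all
  then have "?f u < R" using rho0_less by linarith
  then show ?thesis using Re_V_pos[OF norm_u] by (simp add: divide_less_eq mult_ac)
qed

lemma R_pos: "R > 0"
proof -
  have "0 \<le> (cmod (V (dir 0)))\<^sup>2" by simp
  also have "\<dots> < 2 * R * Re (V (dir 0))" by (rule norm_V_sq_less) simp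
  finally show ?thesis using Re_V_pos[of "dir 0"] by (simp add: zero_less_mult_iff)
qed

lemma norm_Vstar_less:
  assumes norm_u: "norm u = 1"
  shows "cmod (Vstar \<alpha> lam R u) < R"
proof -
  have "(cmod (Vstar \<alpha> lam R u))\<^sup>2 = R\<^sup>2 - 2 * R * Re (V u) + (cmod (V u))\<^sup>2"
    unfolding Vstar_def cmod_power2 by (simp add: power2_diff)
  then have "(cmod (Vstar \<alpha> lam R u))\<^sup>2 < R\<^sup>2" using norm_V_sq_less[OF norm_u] by simp
  then show ?thesis using R_pos by (intro power2_less_imp_less[of _ R]) linarith+
qed

lemma ex_norm_Vstar_le: "\<exists>q. 0 < q \<and> q < R \<and> (\<forall>u. norm u = 1 \<longrightarrow> cmod (Vstar \<alpha> lam R u) \<le> q)"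
proof -
  have "sphere (0::real^'n) 1 \<noteq> {}" using norm_dir[of "0::real^'n"] by force
  moreover have "continuous_on (sphere 0 1) (\<lambda>u. cmod (Vstar \<alpha> lam R u))"
    unfolding Vstar_def by (intro continuous_intros continuous_V)
  ultimately obtain u where norm_u: "norm u = 1" "\<And>y. norm y = 1 \<Longrightarrow> cmod (Vstar \<alpha> lam R y) \<le> cmod (Vstar \<alpha> lam R u)"
    using continuous_attains_sup[OF compact_sphere] by (metis mem_sphere_0)
  show ?thesis
  proof (intro exI conjI allI impI)
    show "0 < max (cmod (Vstar \<alpha> lam R u)) (R / 2)" using R_pos by simp
    show "max (cmod (Vstar \<alpha> lam R u)) (R / 2) < R" using R_pos norm_Vstar_less[OF norm_u(1)] by simp
  qed (use norm_u(2) in \<open>simp add: le_max_iff_disj\<close>)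
qed

lemma ex_stable_density:
  assumes "CARD('n) \<ge> 2"
  shows "\<exists>q. stable_density (Vstar \<alpha> lam R) \<alpha> R q \<mu>"
proof -
  obtain q where q_bounds: "0 < q" "q < R" "\<And>u. norm u = 1 \<Longrightarrow> cmod (Vstar \<alpha> lam R u) \<le> q"
    using ex_norm_Vstar_le by blast
  interpret stable_exponent "Vstar \<alpha> lam R" \<alpha> R q
    using assms \<alpha>_gt_1 q_bounds
    by unfold_locales (auto simp: Vstar_def intro!: continuous_intros continuous_V)
  have "(\<integral>x. cis (z \<bullet> x) \<partial>\<mu>) = char_fun z" for z
    unfolding charf_\<mu> char_fun_def by (simp add: Vstar_def)
  then have "stable_density (Vstar \<alpha> lam R) \<alpha> R q \<mu>"
    by (intro stable_density.intro stable_density_axioms.intro stable_exponent_axioms prob_space_\<mu> sets_\<mu>)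
  then show ?thesis ..
qed

end

section \<open>The series for stable densities\<close>

lemma fh_coeff_normalised:
  "fh_coeff d n m / ((2 * pi) ^ d * fact n)
     = 2 powr (1 - real d) / pi powr (real d / 2) / (2 ^ n * (fact m * Gamma (real n - real m + real d / 2)))"
proof -
  have "2 powr (1 - real d) = 2 / 2 ^ d" by (simp add: powr_diff powr_realpow)
  moreover have "(2 * pi) ^ d = 2 ^ d * (pi powr (real d / 2) * pi powr (real d / 2))"
    by (simp add: power_mult_distrib powr_realpow flip: powr_add)
  moreover have "2 * P * F / (N * G) / (D * (P * P) * F) = 2 / D / P / (N * G)" if "F \<noteq> 0" "P \<noteq> 0"
    for F P N G D :: real
    using that by simp
  ultimately show ?thesis unfolding fh_coeff_def by simp
qed

locale stable_law_series = stable_density "Vstar \<alpha> lam R" \<alpha> R q \<mu>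
  for lam \<mu> :: "(real^'n::finite) measure" and \<alpha> R q
begin

lemma dens_term_eq: "dens_term \<alpha> lam R x n m k = harmonic_term x n m k"
  unfolding dens_term_def Let_def Sstar_def harmonic_term_def gamma_coeff_def fh_coeff_normalised
  by (simp add: power_divide mult_ac)

lemma stable_g_eq: "stable_g \<alpha> lam R x = inv_fourier char_fun x"
  unfolding stable_g_def dens_term_eq by (rule sums_unique[OF harmonic_series_sums, symmetric])

lemma radial_term_eq:
  "radial_term \<alpha> lam R r n k = of_real (r ^ (CARD('n) - 1)) * sphint (\<lambda>u. series_term (2 * n) k (r *\<^sub>R u))"
proof -
  let ?d = "CARD('n)" and ?S = "sphint (\<lambda>u::real^'n. Vstar \<alpha> lam R u ^ k)"
  have "1 - real ?d = - real (?d - 1)" using dim by (simp add: of_nat_diff)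
  then have "2 powr (1 - real ?d) = 1 / 2 ^ (?d - 1)"
    by (simp only: powr_minus powr_realpow) (simp add: powr_realpow divide_inverse)
  then have r_half: "(r / 2) ^ (?d - 1) = r ^ (?d - 1) * 2 powr (1 - real ?d)" by (simp add: power_divide)
  have r_sq: "(- (r\<^sup>2 / 4)) ^ n = (- 1) ^ n * r ^ (2 * n) / 2 ^ (2 * n)"
    by (simp add: power_minus[of "r\<^sup>2 / 4"] power_divide power_mult)
  have i_power: "(- \<i>) ^ (2 * n) = (- 1) ^ n" by (simp add: power_mult)
  have "of_real (r ^ (?d - 1)) * sphint (\<lambda>u. series_term (2 * n) k (r *\<^sub>R u))
      = of_real (r ^ (?d - 1) * (fh_coeff ?d (2 * n) n / ((2 * pi) ^ ?d * fact (2 * n))) * gamma_coeff \<alpha> R ?d (2 * n) k / \<alpha>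
          * r ^ (2 * n) * (- 1) ^ n) * ?S"
    unfolding sphint_series_term i_power by (simp add: mult_ac)
  also have "\<dots> = radial_term \<alpha> lam R r n k"
    unfolding fh_coeff_normalised radial_term_def Let_def r_half r_sq gamma_coeff_def by (simp add: mult_ac)
  finally show ?thesis ..
qed

lemma radial_g_eq: "r > 0 \<Longrightarrow> radial_g \<alpha> lam R r = radial_density r"
  unfolding radial_g_def radial_term_eq by (rule radial_series_eq_radial_density) simp

end

theorem theorem5p4:
  fixes \<mu> lam :: "(real^'n::finite) measure" and \<alpha> R :: real
  assumes d2: "CARD('n) \<ge> 2"
    and alpha: "1 < \<alpha>" "\<alpha> < 2"
    and lam: "finite_measure lam" "sets lam = sets (restrict_space borel (sphere (0::real^'n) 1))"
             "emeasure lam (space lam) \<noteq> 0"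
    and mu: "prob_space \<mu>" "sets \<mu> = sets borel"
    and charf: "\<forall>z. integral\<^sup>L \<mu> (\<lambda>x. cis (z \<bullet> x))
                   = exp (- complex_of_real (norm z powr \<alpha>) * stable_V \<alpha> lam (sgn z))"
    and nondeg: "nondegenerate \<mu>"
    and R: "R > rho0 \<alpha> lam"
  shows "(\<forall>x. Im (stable_g \<alpha> lam R x) = 0)
       \<and> \<mu> = density lborel (\<lambda>x. ennreal (Re (stable_g \<alpha> lam R x)))
       \<and> (\<forall>M>0. uniform_limit (cball 0 M)
                 (\<lambda>N x. \<Sum>n<N. \<Sum>m\<le>n div 2. \<Sum>k. dens_term \<alpha> lam R x n m k)
                 (stable_g \<alpha> lam R) sequentially
              \<and> (\<forall>x\<in>cball 0 M. ((\<lambda>(n, m, k). norm (dens_term \<alpha> lam R x n m k))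
                                  summable_on {(n, m, k). m \<le> n div 2})))
       \<and> (\<forall>r>0. Im (radial_g \<alpha> lam R r) = 0)
       \<and> distr \<mu> lborel norm
           = density lborel (\<lambda>r. if r > 0 then ennreal (Re (radial_g \<alpha> lam R r)) else 0)"
proof -
  interpret law: stable_law lam \<alpha> \<mu> R
    by (intro stable_law.intro spectral_measure.intro spectral_measure_axioms.intro stable_law_axioms.intro)
       (use alpha lam mu charf nondeg R in auto)
  obtain q where "stable_density (Vstar \<alpha> lam R) \<alpha> R q \<mu>"
    using law.ex_stable_density[OF d2] by blast
  then interpret stable_law_series lam \<mu> \<alpha> R q
    by (rule stable_law_series.intro)
  have stable_g: "stable_g \<alpha> lam R = inv_fourier char_fun"
    by (rule ext) (rule stable_g_eq)
  have "distr \<mu> lborel norm = density lborel (\<lambda>r. if r > 0 then ennreal (Re (radial_g \<alpha> lam R r)) else 0)"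
    unfolding distr_norm_eq_radial_density by (simp add: radial_g_eq cong: if_cong)
  then show ?thesis
    unfolding stable_g dens_term_eq
    using Im_inv_fourier fourier_inversion uniform_limit_harmonic_series abs_summable_harmonic_term
      radial_g_eq Im_radial_density by simp
qed

end
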